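(* Let $\rho:\Lambda\to\mathbb{R}$ be a specialization given by $$1+\sum_{n=1}^\infty\rho(h_n)z^n=e^{\gamma z+\delta z/(1-z)}\prod_{n=1}^\infty\frac{1}{1-\alpha_nz}\prod_{n=1}^\infty\left(1+\frac{\beta_nz}{1-z}\right)$$ for nonnegative reals $\{\alpha_n\}$, $\{\beta_n\}$, $\gamma$, $\delta$ such that $\sum_n(\alpha_n+\beta_n)<\infty$. Then $\rho$ is $g$-positive.
   Context: $\Lambda=\mathbb{R}[h_1,h_2,\ldots]$ is the ring of symmetric functions over $\mathbb{R}$ in $x_1,x_2,\ldots$, with $h_n$ the complete homogeneous symmetric functions; a specialization is a (unital $\mathbb{R}$-algebra) homomorphism $\Lambda\to\mathbb{R}$. For partitions $\mu\subset\lambda$, a reverse plane partition of shape $\lambda/\mu$ is a filling of the boxes of $\lambda/\mu$ (English notation) with positive integers that weakly increase along rows from left to right and down columns from top to bottom. The dual symmetric Grothendieck polynomial is $g_{\lambda/\mu}:=\sum_T\prod_{i\ge1}x_i^{c_i(T)}\in\Lambda$, the sum over all reverse plane partitions $T$ of shape $\lambda/\mu$, where $c_i(T)$ is the number of columns of $T$ that contain $i$. A homomorphism $\rho:\Lambda\to\mathbb{R}$ is $g$-positive if $\rho(g_{\lambda/\mu})\ge0$ for all partitions $\mu\subset\lambda$. *)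

theory Defs
  imports "HOL-Analysis.Analysis" "HOL-Library.Poly_Mapping"
begin

section \<open>The ring of symmetric functions\<close>

text \<open>
  Formal power series in countably many variables \<open>x\<^sub>1, x\<^sub>2, \<dots>\<close> are coefficient functions on
  exponent vectors.  The exponent of \<open>x\<^sub>i\<close> (for \<open>i \<ge> 1\<close>) is stored at position \<open>i - 1\<close>.
\<close>

type_synonym monom = "nat \<Rightarrow>\<^sub>0 nat"
type_synonym series = "monom \<Rightarrow> real"

definition mdeg :: "monom \<Rightarrow> nat" where
  "mdeg m = (\<Sum>i\<in>Poly_Mapping.keys m. Poly_Mapping.lookup m i)"

definition series_one :: series where
  "series_one = (\<lambda>m. if m = 0 then 1 else 0)"

definition series_add :: "series \<Rightarrow> series \<Rightarrow> series" where
  "series_add f g = (\<lambda>m. f m + g m)"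

definition series_scale :: "real \<Rightarrow> series \<Rightarrow> series" where
  "series_scale c f = (\<lambda>m. c * f m)"

text \<open>The index set of the sum is finite, see \<open>finite_splittings\<close> below.\<close>

definition series_mult :: "series \<Rightarrow> series \<Rightarrow> series" where
  "series_mult f g = (\<lambda>m. \<Sum>(a, b)\<in>{(a, b). a + b = m}. f a * g b)"

text \<open>Power series of bounded degree that are invariant under permutations of the variables.\<close>

definition Lambda :: "series set" where
  "Lambda = {f. (\<exists>d. \<forall>m. f m \<noteq> 0 \<longrightarrow> mdeg m \<le> d) \<and>
                (\<forall>\<pi> m. bij \<pi> \<longrightarrow> f (Poly_Mapping.map_key \<pi> m) = f m)}"

definition complete_h :: "nat \<Rightarrow> series" where
  "complete_h n = (\<lambda>m. if mdeg m = n then 1 else 0)"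

text \<open>
  Unital algebra homomorphisms from \<open>Lambda\<close> to the reals; values outside \<open>Lambda\<close> are irrelevant.
\<close>

definition specialization :: "(series \<Rightarrow> real) \<Rightarrow> bool" where
  "specialization \<rho> \<longleftrightarrow>
     (\<forall>f\<in>Lambda. \<forall>g\<in>Lambda. \<rho> (series_add f g) = \<rho> f + \<rho> g) \<and>
     (\<forall>c. \<forall>f\<in>Lambda. \<rho> (series_scale c f) = c * \<rho> f) \<and>
     (\<forall>f\<in>Lambda. \<forall>g\<in>Lambda. \<rho> (series_mult f g) = \<rho> f * \<rho> g) \<and>
     \<rho> series_one = 1"


section \<open>Dual symmetric Grothendieck polynomials\<close>

text \<open>Row lengths are indexed from 0 and padded with zeros.\<close>

definition is_partition :: "(nat \<Rightarrow> nat) \<Rightarrow> bool" where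
  "is_partition l \<longleftrightarrow> antimono l \<and> finite {i. l i \<noteq> 0}"

text \<open>Boxes are pairs (row, column), with row indices growing downwards.\<close>

definition skew_diagram :: "(nat \<Rightarrow> nat) \<Rightarrow> (nat \<Rightarrow> nat) \<Rightarrow> (nat \<times> nat) set" where
  "skew_diagram l m = {(i, j). m i \<le> j \<and> j < l i}"

definition rpp :: "(nat \<Rightarrow> nat) \<Rightarrow> (nat \<Rightarrow> nat) \<Rightarrow> (nat \<times> nat \<Rightarrow> nat) set" where
  "rpp l m = {T \<in> skew_diagram l m \<rightarrow>\<^sub>E {0<..}.
     (\<forall>i j j'. (i, j) \<in> skew_diagram l m \<longrightarrow> (i, j') \<in> skew_diagram l m \<longrightarrow> j \<le> j'
        \<longrightarrow> T (i, j) \<le> T (i, j')) \<and>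
     (\<forall>i i' j. (i, j) \<in> skew_diagram l m \<longrightarrow> (i', j) \<in> skew_diagram l m \<longrightarrow> i \<le> i'
        \<longrightarrow> T (i, j) \<le> T (i', j))}"

text \<open>The number of columns (not boxes) containing the entry \<open>k\<close>.\<close>

definition col_count :: "(nat \<Rightarrow> nat) \<Rightarrow> (nat \<Rightarrow> nat) \<Rightarrow> (nat \<times> nat \<Rightarrow> nat) \<Rightarrow> nat \<Rightarrow> nat" where
  "col_count l m T k = card {j. \<exists>i. (i, j) \<in> skew_diagram l m \<and> T (i, j) = k}"

text \<open>
  The coefficient of a monomial in the sum over all reverse plane partitions is the number of
  those whose weight is that monomial; it is finite by \<open>finite_rpp_weight\<close> below.
\<close>

definition dual_groth :: "(nat \<Rightarrow> nat) \<Rightarrow> (nat \<Rightarrow> nat) \<Rightarrow> series" where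
  "dual_groth l m = (\<lambda>w. real (card {T \<in> rpp l m.
     \<forall>i. Poly_Mapping.lookup w i = col_count l m T (Suc i)}))"

definition g_positive :: "(series \<Rightarrow> real) \<Rightarrow> bool" where
  "g_positive \<rho> \<longleftrightarrow>
     (\<forall>l m. is_partition l \<longrightarrow> is_partition m \<longrightarrow> (\<forall>i. m i \<le> l i) \<longrightarrow> 0 \<le> \<rho> (dual_groth l m))"


section \<open>Well-definedness\<close>

lemma finite_splittings: "finite {(a, b). a + b = (m :: monom)}"
proof -
  let ?K = "Poly_Mapping.keys m" and ?L = "Poly_Mapping.lookup :: monom \<Rightarrow> nat \<Rightarrow> nat"
  let ?F = "{g. g ` ?K \<subseteq> {..mdeg m} \<and> (\<forall>i. i \<notin> ?K \<longrightarrow> g i = 0)}"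
  have "?F \<subseteq> {g. \<forall>i. (i \<in> ?K \<longrightarrow> g i \<in> {..mdeg m}) \<and> (i \<notin> ?K \<longrightarrow> g i = (0::nat))}"
    by blast
  then have fF: "finite ?F"
    by (rule finite_subset) (rule finite_set_of_finite_funs, simp_all)
  have bd: "?L m i \<le> mdeg m" if "i \<in> ?K" for i
    unfolding mdeg_def by (rule member_le_sum) (use that in auto)
  have mem: "?L a \<in> ?F" if le: "\<And>i. ?L a i \<le> ?L m i" for a
  proof -
    have "?L a i \<le> mdeg m" if "i \<in> ?K" for i
      using le[of i] bd[OF that] by linarith
    moreover have "?L a i = 0" if "i \<notin> ?K" for i
      using le[of i] that by (simp add: in_keys_iff)
    ultimately show ?thesis by (simp add: image_subset_iff)
  qed
  have sub: "?L a \<in> ?F \<and> ?L b \<in> ?F" if "a + b = m" for a b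
  proof -
    have "?L m i = ?L a i + ?L b i" for i using that by (simp add: lookup_add[symmetric])
    then show ?thesis using mem[of a] mem[of b] by simp
  qed
  let ?G = "\<lambda>(a, b). (?L a, ?L b)"
  have "?G ` {(a, b). a + b = m} \<subseteq> ?F \<times> ?F"
  proof (rule image_subsetI)
    fix p :: "monom \<times> monom"
    assume "p \<in> {(a, b). a + b = m}"
    then have "fst p + snd p = m" by (simp add: case_prod_unfold)
    from sub[OF this] show "?G p \<in> ?F \<times> ?F"
      by (simp only: case_prod_unfold mem_Times_iff fst_conv snd_conv)
  qed
  then have "finite (?G ` {(a, b). a + b = m})"
    by (rule finite_subset) (rule finite_cartesian_product[OF fF fF])
  moreover have "inj_on ?G {(a, b). a + b = m}"
    by (rule inj_onI) (clarsimp simp: lookup_inject)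
  ultimately show ?thesis by (rule finite_imageD)
qed

lemma finite_skew_diagram:
  assumes "is_partition l"
  shows "finite (skew_diagram l m)"
proof -
  have "skew_diagram l m \<subseteq> (SIGMA i:{i. l i \<noteq> 0}. {..<l i})"
    by (auto simp: skew_diagram_def)
  then show ?thesis
    by (rule finite_subset) (use assms in \<open>auto simp: is_partition_def\<close>)
qed

lemma finite_rpp_weight:
  assumes "is_partition l"
  shows "finite {T \<in> rpp l m. \<forall>i. Poly_Mapping.lookup w i = col_count l m T (Suc i)}"
proof -
  let ?D = "skew_diagram l m"
  have fD: "finite ?D" using finite_skew_diagram[OF assms] .
  have "T \<in> ?D \<rightarrow>\<^sub>E Suc ` Poly_Mapping.keys w"
    if T: "T \<in> rpp l m" and w: "\<forall>i. Poly_Mapping.lookup w i = col_count l m T (Suc i)" for T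
  proof -
    have TE: "T \<in> ?D \<rightarrow>\<^sub>E {0<..}" using T by (simp add: rpp_def)
    have "T p \<in> Suc ` Poly_Mapping.keys w" if p: "p \<in> ?D" for p
    proof -
      obtain i j where ij: "p = (i, j)" by (cases p)
      from TE p have "T p > 0" by auto
      then obtain k where k: "T p = Suc k" by (cases "T p") auto
      let ?C = "{j. \<exists>i. (i, j) \<in> ?D \<and> T (i, j) = Suc k}"
      have "?C \<subseteq> snd ` ?D" by force
      then have "finite ?C" using fD finite_subset by blast
      moreover have "j \<in> ?C" using p ij k by auto
      ultimately have "col_count l m T (Suc k) \<noteq> 0" unfolding col_count_def by auto
      then show ?thesis using w k by (auto simp: in_keys_iff)
    qed
    then show ?thesis using TE by auto
  qed
  then have "{T \<in> rpp l m. \<forall>i. Poly_Mapping.lookup w i = col_count l m T (Suc i)}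
      \<subseteq> ?D \<rightarrow>\<^sub>E Suc ` Poly_Mapping.keys w" by blast
  then show ?thesis using finite_PiE[OF fD] by (rule finite_subset) auto
qed

lemma mdeg_add: "mdeg (a + b) = mdeg a + mdeg b"
proof -
  let ?S = "Poly_Mapping.keys a \<union> Poly_Mapping.keys b"
  have *: "mdeg c = (\<Sum>i\<in>?S. Poly_Mapping.lookup c i)" if "Poly_Mapping.keys c \<subseteq> ?S" for c
    unfolding mdeg_def by (rule sum.mono_neutral_left) (use that in \<open>simp_all add: in_keys_iff\<close>)
  have "mdeg (a + b) = (\<Sum>i\<in>?S. Poly_Mapping.lookup (a + b) i)"
    by (rule *) (rule keys_add)
  also have "\<dots> = (\<Sum>i\<in>?S. Poly_Mapping.lookup a i) + (\<Sum>i\<in>?S. Poly_Mapping.lookup b i)"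
    by (simp add: lookup_add sum.distrib)
  also have "\<dots> = mdeg a + mdeg b" using *[of a] *[of b] by simp
  finally show ?thesis .
qed

lemma lookup_map_key_bij:
  "bij \<pi> \<Longrightarrow> Poly_Mapping.lookup (Poly_Mapping.map_key \<pi> m) i = Poly_Mapping.lookup m (\<pi> i)"
  by (simp add: map_key.rep_eq bij_is_inj)

lemma mdeg_map_key:
  assumes "bij \<pi>"
  shows "mdeg (Poly_Mapping.map_key \<pi> m) = mdeg m"
proof -
  have "bij_betw \<pi> (\<pi> -` Poly_Mapping.keys m) (Poly_Mapping.keys m)"
    using assms by (simp add: bij_betw_def surj_image_vimage_eq inj_on_subset[of \<pi> UNIV])
  then have "(\<Sum>i\<in>\<pi> -` Poly_Mapping.keys m. Poly_Mapping.lookup m (\<pi> i)) = mdeg m"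
    unfolding mdeg_def by (rule sum.reindex_bij_betw)
  then show ?thesis
    unfolding mdeg_def by (simp add: lookup_map_key_bij keys_map_key assms bij_is_inj)
qed

lemma complete_h_in_Lambda: "complete_h n \<in> Lambda"
  by (auto simp: Lambda_def complete_h_def mdeg_map_key)

lemma one_in_Lambda: "series_one \<in> Lambda"
proof -
  have z: "m = 0 \<longleftrightarrow> mdeg m = 0" for m
    by (simp add: mdeg_def in_keys_iff flip: keys_eq_empty) (auto simp: in_keys_iff intro: poly_mapping_eqI)
  then have "series_one = complete_h 0"
    by (simp add: series_one_def complete_h_def fun_eq_iff)
  then show ?thesis using complete_h_in_Lambda[of 0] by metis
qed

lemma add_in_Lambda:
  assumes "f \<in> Lambda" "g \<in> Lambda"
  shows "series_add f g \<in> Lambda"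
proof -
  from assms obtain d e where
    "\<forall>m. f m \<noteq> 0 \<longrightarrow> mdeg m \<le> d" "\<forall>m. g m \<noteq> 0 \<longrightarrow> mdeg m \<le> e"
    unfolding Lambda_def by blast
  then have "\<forall>m. f m + g m \<noteq> 0 \<longrightarrow> mdeg m \<le> max d e"
    by (metis add.right_neutral le_max_iff_disj)
  then show ?thesis using assms unfolding Lambda_def series_add_def by auto
qed

lemma scale_in_Lambda: "f \<in> Lambda \<Longrightarrow> series_scale c f \<in> Lambda"
  unfolding Lambda_def series_scale_def by auto

lemma mult_in_Lambda:
  assumes f: "f \<in> Lambda" and g: "g \<in> Lambda"
  shows "series_mult f g \<in> Lambda"
proof -
  from f g obtain d e where
    de: "\<forall>m. f m \<noteq> 0 \<longrightarrow> mdeg m \<le> d" "\<forall>m. g m \<noteq> 0 \<longrightarrow> mdeg m \<le> e"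
    unfolding Lambda_def by blast
  have "mdeg m \<le> d + e" if "series_mult f g m \<noteq> 0" for m
  proof -
    from that obtain a b where "a + b = m" "f a * g b \<noteq> 0"
      unfolding series_mult_def by (auto elim!: sum.not_neutral_contains_not_neutral)
    then have "mdeg a \<le> d" "mdeg b \<le> e" using de by simp_all
    then show ?thesis using mdeg_add[of a b] unfolding \<open>a + b = m\<close> by linarith
  qed
  moreover have "series_mult f g (Poly_Mapping.map_key \<pi> m) = series_mult f g m"
    if p: "bij \<pi>" for \<pi> m
  proof -
    let ?k = "Poly_Mapping.map_key \<pi> :: monom \<Rightarrow> monom"
    let ?k' = "Poly_Mapping.map_key (inv \<pi>) :: monom \<Rightarrow> monom"
    have q: "bij (inv \<pi>)" using p by (rule bij_imp_bij_inv)
    have kk: "?k (?k' a) = a" "?k' (?k a) = a" for a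
      using p q by (simp_all add: map_key_compose bij_is_inj bij_is_surj inj_iff[THEN iffD1]
          surj_iff[THEN iffD1] map_key_id[unfolded id_def[symmetric]])
    note add = map_key_plus[OF bij_is_inj[OF p]] map_key_plus[OF bij_is_inj[OF q]]
    have fg_inv: "f (?k' a) = f a" "g (?k' a) = g a" for a
      using f g q unfolding Lambda_def by auto
    show ?thesis unfolding series_mult_def
    proof (rule sum.reindex_bij_witness[where i = "\<lambda>(a, b). (?k a, ?k b)"
          and j = "\<lambda>(a, b). (?k' a, ?k' b)"], goal_cases)
      case (2 x)
      then show ?case using add(2)[of "fst x" "snd x"] kk(2)[of m] by (cases x) simp
    next
      case (4 x)
      then show ?case using add(1)[of "fst x" "snd x"] by (cases x) simp
    qed (simp_all add: case_prod_unfold kk fg_inv)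
  qed
  ultimately have "\<exists>d. \<forall>m. series_mult f g m \<noteq> 0 \<longrightarrow> mdeg m \<le> d"
    and "\<forall>\<pi> m. bij \<pi> \<longrightarrow> series_mult f g (Poly_Mapping.map_key \<pi> m) = series_mult f g m"
    by iprover+
  then show ?thesis unfolding Lambda_def by (intro CollectI conjI)
qed

end

theory Submission
  imports Defs "HOL-Complex_Analysis.Complex_Analysis"
begin

text \<open>
  Reading off the shapes filled with entries \<open>\<le> 1, \<le> 2, \<dots>\<close> turns a reverse plane partition into a chain
  in Young's lattice, so the coefficients of \<open>g\<^bsub>\<lambda>/\<mu>\<^esub>\<close> are entries of products of the matrices \<open>A\<^sub>n\<close> in the
  incidence algebra, where \<open>A\<^sub>n\<close> relates two shapes whose difference meets exactly \<open>n\<close> columns.  The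
  \<open>A\<^sub>n\<close> commute, because \<open>A(x) = \<Sum> A\<^sub>n x\<^sup>n\<close> is an ordered product of factors \<open>1 + x u\<^sub>i\<close> whose \<open>u\<^sub>i\<close>
  (lengthening column \<open>i\<close>) satisfy the relations of Fomin and Greene.  Writing \<open>A(x)\<close> as the exponential of
  \<open>\<Sum> b\<^sub>k x\<^sup>k / k\<close>, the matrix of all \<open>g\<^bsub>\<lambda>/\<mu>\<^esub>\<close> is the exponential of \<open>\<Sum> b\<^sub>k p\<^sub>k / k\<close>.  Newton's
  identities then show that \<open>g\<^bsub>\<lambda>/\<mu>\<^esub>\<close> is a symmetric function and that its specialization depends only on
  the values \<open>r\<^sub>k\<close> of the power sums \<open>p\<^sub>k\<close>; sums of sequences \<open>r\<close> become products of matrices, so the sequences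
  giving nonnegative matrices form a closed cone.  It contains \<open>\<alpha>\<^sup>k\<close>, giving \<open>A(\<alpha>)\<close>, and
  \<open>1 - (1 - \<beta>)\<^sup>k\<close>, giving \<open>A(1) A(1 - \<beta>)\<^sup>-\<^sup>1\<close>, whose entries are powers of \<open>\<beta>\<close>; the parameters \<open>\<gamma>\<close> and
  \<open>\<delta>\<close> are limits of these.
\<close>

section \<open>Incidence algebras\<close>

text \<open>Power sums are the right coordinates because the factors of the generating function
  contribute additively to each \<open>r k\<close>, and because every entry of a specialized matrix
  is a polynomial in finitely many \<open>r k\<close> with k > 0. Adding sequences thus replaces a
  coproduct on Lambda, and pointwise limits suffice. Two obstacles shape the rest. Neighbouring
  column operators u, v do not commute; only u + v commutes with uv. So commutation is proved for
  pairs of neighbouring factors 1 + xu, 1 + xv and transported along the ordered product, which uses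
  that the factors are invertible. And dual Grothendieck polynomials are not homogeneous:
  \<open>layer n\<close> adds at least n boxes but possibly more. The lower bound makes the
  substitution z = 1 in A(z) a finite sum at each entry. The sequence 1 - (1 - b)^k comes from 1 +
  bz/(1 - z) = (1 - (1 - b)z)/(1 - z). For 0 < b < 1 the inverse of A(1 - b) has negative entries,
  so positivity is read off from an explicit candidate for the quotient, which is then verified by a
  summation identity.\<close>

class locally_finite_order = order +
  assumes finite_interval [simp]: "finite {x..y}"

typedef (overloaded) 'a incidence =
  "{f :: 'a::locally_finite_order \<Rightarrow> 'a \<Rightarrow> real. \<forall>x y. \<not> x \<le> y \<longrightarrow> f x y = 0}"
  morphisms entry Incidence
  by (rule exI[of _ "\<lambda>_ _. 0"]) simp

setup_lifting type_definition_incidence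

lemma entry_outside: "\<not> x \<le> y \<Longrightarrow> entry f x y = 0"
  using entry[of f] by blast

lemma incidence_eqI:
  assumes "\<And>x y. x \<le> y \<Longrightarrow> entry f x y = entry g x y"
  shows "f = g"
proof -
  have "entry f x y = entry g x y" for x y
    by (cases "x \<le> y") (simp_all add: assms entry_outside)
  then show ?thesis by (simp add: entry_inject[symmetric] fun_eq_iff)
qed

instantiation incidence :: (locally_finite_order) real_algebra_1
begin

lift_definition zero_incidence :: "'a incidence" is "\<lambda>_ _. 0" by simp
lift_definition one_incidence :: "'a incidence" is "\<lambda>x y. if x = y then 1 else 0" by auto
lift_definition plus_incidence :: "'a incidence \<Rightarrow> 'a incidence \<Rightarrow> 'a incidence"
  is "\<lambda>f g x y. f x y + g x y" by simp
lift_definition minus_incidence :: "'a incidence \<Rightarrow> 'a incidence \<Rightarrow> 'a incidence"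
  is "\<lambda>f g x y. f x y - g x y" by simp
lift_definition uminus_incidence :: "'a incidence \<Rightarrow> 'a incidence"
  is "\<lambda>f x y. - f x y" by simp
lift_definition scaleR_incidence :: "real \<Rightarrow> 'a incidence \<Rightarrow> 'a incidence"
  is "\<lambda>c f x y. c * f x y" by simp
lift_definition times_incidence :: "'a incidence \<Rightarrow> 'a incidence \<Rightarrow> 'a incidence"
  is "\<lambda>f g x z. \<Sum>y\<in>{x..z}. f x y * g y z"
  by (intro allI impI sum.neutral) auto

instance
proof
  fix a b c :: "'a incidence"
  show "a * b * c = a * (b * c)"
  proof (rule incidence_eqI)
    fix x w :: 'a assume "x \<le> w"
    have "(\<Sum>z\<in>{x..w}. (\<Sum>y\<in>{x..z}. entry a x y * entry b y z) * entry c z w)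
        = (\<Sum>z\<in>{x..w}. \<Sum>y | y \<in> {x..w} \<and> y \<le> z. entry a x y * entry b y z * entry c z w)"
      unfolding sum_distrib_right by (intro sum.cong refl) auto
    also have "\<dots> = (\<Sum>y\<in>{x..w}. \<Sum>z | z \<in> {x..w} \<and> y \<le> z. entry a x y * entry b y z * entry c z w)"
      by (rule sum.swap_restrict) simp_all
    also have "\<dots> = (\<Sum>y\<in>{x..w}. entry a x y * (\<Sum>z\<in>{y..w}. entry b y z * entry c z w))"
      unfolding sum_distrib_left by (intro sum.cong refl) (auto simp: mult.assoc)
    finally show "entry (a * b * c) x w = entry (a * (b * c)) x w"
      by (simp add: times_incidence.rep_eq)
  qed
  show "1 * a = a"
    by (rule incidence_eqI) (simp add: times_incidence.rep_eq one_incidence.rep_eq if_distrib[where f = "\<lambda>t. t * _"] cong: if_cong)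
  show "a * 1 = a"
    by (rule incidence_eqI) (simp add: times_incidence.rep_eq one_incidence.rep_eq if_distrib[where f = "\<lambda>t. _ * t"] cong: if_cong)
  show "0 \<noteq> (1 :: 'a incidence)"
    by transfer (auto simp: fun_eq_iff)
qed (rule incidence_eqI; simp add: zero_incidence.rep_eq plus_incidence.rep_eq
    minus_incidence.rep_eq uminus_incidence.rep_eq scaleR_incidence.rep_eq times_incidence.rep_eq
    algebra_simps sum.distrib sum_distrib_left)+

end

lemmas entry_ring_simps [simp] =
  zero_incidence.rep_eq plus_incidence.rep_eq minus_incidence.rep_eq
  uminus_incidence.rep_eq scaleR_incidence.rep_eq

lemma entry_one: "entry 1 x y = (if x = y then 1 else 0)"
  by (simp add: one_incidence.rep_eq)

lemma entry_mult: "entry (f * g) x z = (\<Sum>y\<in>{x..z}. entry f x y * entry g y z)"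
  by (simp add: times_incidence.rep_eq)

lemma entry_sum: "entry (sum f I) x y = (\<Sum>i\<in>I. entry (f i) x y)"
  by (induction I rule: infinite_finite_induct) auto

lemma entry_Incidence:
  "(\<And>x y. \<not> x \<le> y \<Longrightarrow> f x y = 0) \<Longrightarrow> entry (Incidence f) x y = f x y"
  by (subst Incidence_inverse) auto

text \<open>Neumann series; it is finite at each entry because a strict chain in an interval is.\<close>

lemma incidence_invertible:
  fixes f :: "'a::locally_finite_order incidence"
  assumes diag: "\<And>x. entry f x x = 1"
  shows "\<exists>g. f * g = 1 \<and> g * f = 1"
proof -
  define N where "N = 1 - f"
  have Nd: "entry N x x = 0" for x by (simp add: N_def entry_one diag)
  have nil: "card {x..y} \<le> k \<Longrightarrow> x \<le> y \<Longrightarrow> entry (N ^ k) x y = 0" for k x y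
  proof (induction k arbitrary: x)
    case 0 then show ?case by (auto simp: card_eq_0_iff)
  next
    case (Suc k)
    have "entry N x z * entry (N ^ k) z y = 0" if z: "z \<in> {x..y}" for z
    proof (cases "z = x")
      case False
      have "{z..y} \<subseteq> {x..y}" "x \<in> {x..y}" "x \<notin> {z..y}" using z False by auto
      then have "{z..y} \<subset> {x..y}" by blast
      then have "card {z..y} < card {x..y}" by (simp add: psubset_card_mono)
      then have "entry (N ^ k) z y = 0" using Suc.prems z by (intro Suc.IH) auto
      then show ?thesis by simp
    qed (simp add: Nd)
    then show ?case unfolding power_Suc entry_mult by (intro sum.neutral) blast
  qed
  define g where "g = Incidence (\<lambda>x y. \<Sum>k<card {x..y}. entry (N ^ k) x y)"
  have g0: "entry g x y = (\<Sum>k<card {x..y}. entry (N ^ k) x y)" for x y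
    unfolding g_def by (subst entry_Incidence) (auto intro!: sum.neutral simp: entry_outside)
  \<comment> \<open>Longer truncations give the same entry, so the length chosen for a large
    interval also serves all its subintervals in the products below.\<close>
  have g: "entry g x y = entry (\<Sum>k<K. N ^ k) x y" if "card {x..y} \<le> K" for x y K
  proof (cases "x \<le> y")
    case True
    then show ?thesis
      unfolding g0 entry_sum using that nil[OF _ True] by (intro sum.mono_neutral_left) auto
  qed (simp add: entry_outside)
  have tele: "f * (\<Sum>k<K. N ^ k) = 1 - N ^ K" "(\<Sum>k<K. N ^ k) * f = 1 - N ^ K" for K
  proof -
    have "f = 1 - N" by (simp add: N_def)
    then have f: "f * N ^ k = N ^ k - N ^ Suc k" "N ^ k * f = N ^ k - N ^ Suc k" for k
      by (simp_all only: left_diff_distrib right_diff_distrib power_Suc power_commutes mult_1_left mult_1_right)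
    show "f * (\<Sum>k<K. N ^ k) = 1 - N ^ K"
      by (induction K) (simp_all add: distrib_left f)
    show "(\<Sum>k<K. N ^ k) * f = 1 - N ^ K"
      by (induction K) (simp_all add: distrib_right f)
  qed
  have "f * g = 1"
  proof (rule incidence_eqI)
    fix x z :: 'a assume "x \<le> z"
    have "card {y..z} \<le> card {x..z}" if "y \<in> {x..z}" for y
      using that by (intro card_mono) auto
    then have "entry (f * g) x z = entry (f * (\<Sum>k<card {x..z}. N ^ k)) x z"
      unfolding entry_mult by (intro sum.cong refl) (simp add: g)
    then show "entry (f * g) x z = entry 1 x z"
      using \<open>x \<le> z\<close> by (simp add: tele nil)
  qed
  moreover have "g * f = 1"
  proof (rule incidence_eqI)
    fix x z :: 'a assume "x \<le> z"
    have "card {x..y} \<le> card {x..z}" if "y \<in> {x..z}" for y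
      using that by (intro card_mono) auto
    then have "entry (g * f) x z = entry ((\<Sum>k<card {x..z}. N ^ k) * f) x z"
      unfolding entry_mult by (intro sum.cong refl) (simp add: g)
    then show "entry (g * f) x z = entry 1 x z"
      using \<open>x \<le> z\<close> by (simp add: tele nil)
  qed
  ultimately show ?thesis by blast
qed

section \<open>Young's lattice\<close>

typedef young = "{l. is_partition l}" morphisms parts Young
  by (rule exI[of _ "\<lambda>_. 0"]) (simp add: is_partition_def antimono_def)

setup_lifting type_definition_young

lemma parts_antimono: "i \<le> j \<Longrightarrow> parts \<mu> j \<le> parts \<mu> i"
  using parts[of \<mu>] by (auto simp: is_partition_def antimono_def)

lemma finite_parts: "finite {i. parts \<mu> i \<noteq> 0}"
  using parts[of \<mu>] by (simp add: is_partition_def)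

lemma parts_Young: "is_partition l \<Longrightarrow> parts (Young l) = l"
  by (simp add: Young_inverse)

lemma parts_eventually_0: "\<exists>n. \<forall>j\<ge>n. parts \<mu> j = 0"
proof -
  obtain n where "{i. parts \<mu> i \<noteq> 0} \<subseteq> {..<n}"
    using finite_parts[of \<mu>] finite_nat_iff_bounded by blast
  then show ?thesis by (intro exI[of _ n]) (auto simp: subset_eq not_less[symmetric])
qed

instantiation young :: order
begin

lift_definition less_eq_young :: "young \<Rightarrow> young \<Rightarrow> bool" is "(\<le>)" .
lift_definition less_young :: "young \<Rightarrow> young \<Rightarrow> bool" is "(<)" .

instance
proof
  fix x y z :: young
  show "x < y \<longleftrightarrow> x \<le> y \<and> \<not> y \<le> x"
    unfolding less_eq_young.rep_eq less_young.rep_eq by (rule less_le_not_le)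
  show "x \<le> x"
    unfolding less_eq_young.rep_eq by (rule order_refl)
  show "x \<le> y \<Longrightarrow> y \<le> z \<Longrightarrow> x \<le> z"
    unfolding less_eq_young.rep_eq by (rule order_trans)
  show "x \<le> y \<Longrightarrow> y \<le> x \<Longrightarrow> x = y"
    unfolding less_eq_young.rep_eq parts_inject[symmetric] by (rule antisym)
qed

end

lemma young_le_iff: "\<mu> \<le> \<kappa> \<longleftrightarrow> (\<forall>j. parts \<mu> j \<le> parts \<kappa> j)"
  by (simp add: less_eq_young.rep_eq le_fun_def)

instance young :: locally_finite_order
proof
  fix x y :: young
  obtain n where n: "\<forall>j\<ge>n. parts y j = 0" using parts_eventually_0 ..
  let ?F = "{f. \<forall>i. (i \<in> {..<n} \<longrightarrow> f i \<in> {..parts y 0}) \<and> (i \<notin> {..<n} \<longrightarrow> f i = 0)}"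
  have "parts z \<in> ?F" if "z \<in> {x..y}" for z
  proof -
    have z: "parts z i \<le> parts y i" for i
      using that by (simp add: young_le_iff)
    have "parts z i \<le> parts y 0" for i
      using z[of i] parts_antimono[of 0 i y] by simp
    moreover have "parts z i = 0" if "i \<notin> {..<n}" for i
      using z[of i] spec[OF n, of i] that by simp
    ultimately show ?thesis by simp
  qed
  then have "parts ` {x..y} \<subseteq> ?F" by (rule image_subsetI)
  moreover have "finite ?F"
    by (rule finite_set_of_finite_funs) simp_all
  ultimately have "finite (parts ` {x..y})"
    by (rule finite_subset)
  then show "finite {x..y}"
    by (rule finite_imageD) (simp add: inj_on_def parts_inject)
qed

lemma young_eqI: "(\<And>j. parts \<mu> j = parts \<kappa> j) \<Longrightarrow> \<mu> = \<kappa>"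
  by (simp add: parts_inject[symmetric] fun_eq_iff)

section \<open>Column operators\<close>

text \<open>From here on, the \<open>parts\<close> of an element of \<open>young\<close> are the column lengths of a shape.\<close>

definition grown :: "young \<Rightarrow> young \<Rightarrow> nat set" where
  "grown \<mu> \<kappa> = {j. parts \<mu> j < parts \<kappa> j}"

lemma finite_grown [simp]: "finite (grown \<mu> \<kappa>)"
  unfolding grown_def by (rule finite_subset[OF _ finite_parts[of \<kappa>]]) auto

definition indic :: "('a::locally_finite_order \<Rightarrow> 'a \<Rightarrow> bool) \<Rightarrow> 'a incidence" where
  "indic R = Incidence (\<lambda>x y. if x \<le> y \<and> R x y then 1 else 0)"

lemma entry_indic: "entry (indic R) x y = (if x \<le> y \<and> R x y then 1 else 0)"
  unfolding indic_def by (subst entry_Incidence) auto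

lemma entry_indic_mult:
  "entry (indic R * indic S) x z = card {y. x \<le> y \<and> y \<le> z \<and> R x y \<and> S y z}"
proof -
  have "entry (indic R * indic S) x z = (\<Sum>y\<in>{x..z}. if R x y \<and> S y z then 1 else 0)"
    unfolding entry_mult by (intro sum.cong refl) (auto simp: entry_indic)
  also have "\<dots> = card ({x..z} \<inter> {y. R x y \<and> S y z})"
    by (simp add: sum.If_cases)
  also have "{x..z} \<inter> {y. R x y \<and> S y z} = {y. x \<le> y \<and> y \<le> z \<and> R x y \<and> S y z}" by auto
  finally show ?thesis .
qed

definition set_part :: "young \<Rightarrow> nat \<Rightarrow> nat \<Rightarrow> young" where
  "set_part \<mu> i a = Young ((parts \<mu>)(i := a))"

lemma parts_set_part:
  assumes "parts \<mu> (Suc i) \<le> a" "\<And>j. j < i \<Longrightarrow> a \<le> parts \<mu> j"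
  shows "parts (set_part \<mu> i a) = (parts \<mu>)(i := a)"
proof -
  have "antimono ((parts \<mu>)(i := a))"
  proof (rule antimonoI)
    fix j k :: nat assume jk: "j \<le> k"
    have "parts \<mu> k \<le> a" if "i < k"
      using parts_antimono[of "Suc i" k \<mu>] that assms(1) by simp
    then show "((parts \<mu>)(i := a)) k \<le> ((parts \<mu>)(i := a)) j"
      using jk assms(2)[of j] parts_antimono[OF jk, of \<mu>] by auto
  qed
  moreover have "{j. ((parts \<mu>)(i := a)) j \<noteq> 0} \<subseteq> insert i {j. parts \<mu> j \<noteq> 0}" by auto
  then have "finite {j. ((parts \<mu>)(i := a)) j \<noteq> 0}"
    by (rule finite_subset) (simp only: finite_insert finite_parts)
  ultimately show ?thesis
    unfolding set_part_def by (intro parts_Young) (simp add: is_partition_def)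
qed

text \<open>Turns counting shapes into counting integers: with all other columns fixed, column i may
  take exactly the lengths between its two neighbours, and the hypothesis keeps Q inside that
  range.\<close>

lemma card_change_part:
  assumes "\<And>a. Q a \<Longrightarrow> parts \<sigma> (Suc i) \<le> a \<and> (\<forall>j<i. a \<le> parts \<sigma> j)"
  shows "card {\<nu>. (\<forall>j. j \<noteq> i \<longrightarrow> parts \<nu> j = parts \<sigma> j) \<and> Q (parts \<nu> i)} = card {a. Q a}"
proof (rule bij_betw_same_card[of "\<lambda>\<nu>. parts \<nu> i"], rule bij_betw_imageI)
  show "inj_on (\<lambda>\<nu>. parts \<nu> i) {\<nu>. (\<forall>j. j \<noteq> i \<longrightarrow> parts \<nu> j = parts \<sigma> j) \<and> Q (parts \<nu> i)}"
    by (auto intro!: inj_onI young_eqI) metis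
  show "(\<lambda>\<nu>. parts \<nu> i) ` {\<nu>. (\<forall>j. j \<noteq> i \<longrightarrow> parts \<nu> j = parts \<sigma> j) \<and> Q (parts \<nu> i)} = {a. Q a}"
  proof (intro equalityI subsetI)
    fix a assume "a \<in> {a. Q a}"
    then have "parts (set_part \<sigma> i a) = (parts \<sigma>)(i := a)" "Q a"
      using assms by (auto intro!: parts_set_part)
    then show "a \<in> (\<lambda>\<nu>. parts \<nu> i) ` {\<nu>. (\<forall>j. j \<noteq> i \<longrightarrow> parts \<nu> j = parts \<sigma> j) \<and> Q (parts \<nu> i)}"
      by (intro image_eqI[of _ _ "set_part \<sigma> i a"]) auto
  qed auto
qed

definition grows_in :: "nat set \<Rightarrow> young \<Rightarrow> young \<Rightarrow> bool" where
  "grows_in J \<mu> \<kappa> \<longleftrightarrow> (\<forall>j. if j \<in> J then parts \<mu> j < parts \<kappa> j else parts \<mu> j = parts \<kappa> j)"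

text \<open>Unlike the usual box-adding operator, this adds any positive number of boxes to the
  column at once, matching a weight that counts columns and not boxes.\<close>

definition column_op :: "nat \<Rightarrow> young incidence" where
  "column_op i = indic (grows_in {i})"

lemma grows_in_single:
  "grows_in {i} \<mu> \<nu> \<longleftrightarrow> (\<forall>k. k \<noteq> i \<longrightarrow> parts \<nu> k = parts \<mu> k) \<and> parts \<mu> i < parts \<nu> i"
  unfolding grows_in_def by (metis singletonD singletonI)

lemma grows_in_pair:
  "grows_in {i, j} \<nu> \<kappa> \<longleftrightarrow> (\<forall>k. k \<noteq> i \<longrightarrow> k \<noteq> j \<longrightarrow> parts \<nu> k = parts \<kappa> k) \<and>
    parts \<nu> i < parts \<kappa> i \<and> parts \<nu> j < parts \<kappa> j"
  unfolding grows_in_def by (metis insert_iff singletonD)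

lemma grows_in_trans:
  "grows_in {i} \<mu> \<nu> \<Longrightarrow> grows_in {j} \<nu> \<kappa> \<Longrightarrow> i \<noteq> j \<Longrightarrow> grows_in {i, j} \<mu> \<kappa>"
  unfolding grows_in_def by (metis insert_iff singletonD)

lemma grows_in_split:
  assumes "grows_in {i, j} \<mu> \<kappa>" "i \<noteq> j"
  shows "grows_in {i} \<mu> \<nu> \<and> grows_in {j} \<nu> \<kappa> \<longleftrightarrow>
    (\<forall>k. k \<noteq> i \<longrightarrow> parts \<nu> k = parts \<mu> k) \<and> parts \<nu> i = parts \<kappa> i"
  using assms unfolding grows_in_def by (smt (verit) insert_iff singletonD)

lemma grows_in_le: "grows_in J \<mu> \<kappa> \<Longrightarrow> \<mu> \<le> \<kappa>"
  unfolding grows_in_def young_le_iff by (metis le_refl less_imp_le)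

lemma entry_column_op_mult:
  "entry (column_op i * indic (grows_in J)) \<mu> \<kappa> = card {\<nu>. grows_in {i} \<mu> \<nu> \<and> grows_in J \<nu> \<kappa>}"
  "entry (indic (grows_in J) * column_op i) \<mu> \<kappa> = card {\<nu>. grows_in J \<mu> \<nu> \<and> grows_in {i} \<nu> \<kappa>}"
  unfolding column_op_def entry_indic_mult
  by (auto intro!: arg_cong[where f = card] dest: grows_in_le)

text \<open>The intermediate shape is forced: \<mu> with column i already at its final length. It is
  a legal shape unless i is the right neighbour of j, where column i could overtake a column j that
  has not grown yet.\<close>

lemma column_op_mult:
  assumes "i \<noteq> j" "i \<noteq> Suc j"
  shows "column_op i * column_op j = indic (grows_in {i, j})"
proof (rule incidence_eqI)
  fix \<mu> \<kappa> :: young assume le: "\<mu> \<le> \<kappa>"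
  have entry: "entry (column_op i * column_op j) \<mu> \<kappa>
      = card {\<nu>. grows_in {i} \<mu> \<nu> \<and> grows_in {j} \<nu> \<kappa>}"
    using entry_column_op_mult(1)[of i "{j}"] by (simp add: column_op_def)
  show "entry (column_op i * column_op j) \<mu> \<kappa> = entry (indic (grows_in {i, j})) \<mu> \<kappa>"
  proof (cases "grows_in {i, j} \<mu> \<kappa>")
    case True
    then have same: "parts \<mu> k = parts \<kappa> k" if "k \<noteq> i" "k \<noteq> j" for k
      using that by (auto simp: grows_in_def)
    have "card {\<nu>. (\<forall>k. k \<noteq> i \<longrightarrow> parts \<nu> k = parts \<mu> k) \<and> parts \<nu> i = parts \<kappa> i}
        = card {a. a = parts \<kappa> i}"
    proof (rule card_change_part, clarify, intro conjI allI impI)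
      show "parts \<mu> (Suc i) \<le> parts \<kappa> i"
        using parts_antimono[of i "Suc i" \<kappa>] le unfolding young_le_iff
        by (meson le_trans le_SucI order_refl)
      fix k assume k: "k < i"
      show "parts \<kappa> i \<le> parts \<mu> k"
      proof (cases "k = j")
        case True
        \<comment> \<open>Here j + 1 < i, so column j + 1 is unchanged and separates the two growing
          columns.\<close>
        then have "parts \<kappa> i \<le> parts \<kappa> (Suc j)" "parts \<mu> (Suc j) \<le> parts \<mu> j" "parts \<mu> (Suc j) = parts \<kappa> (Suc j)"
          using k assms by (auto intro: parts_antimono same)
        then show ?thesis using True by simp
      next
        case False
        then show ?thesis using parts_antimono[of k i \<kappa>] same[of k] k by simp
      qed
    qed
    then show ?thesis
      using True le assms by (simp add: entry grows_in_split entry_indic)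
  next
    case False
    then have "{\<nu>. grows_in {i} \<mu> \<nu> \<and> grows_in {j} \<nu> \<kappa>} = {}"
      using grows_in_trans assms by blast
    then show ?thesis using False by (simp only: entry entry_indic card.empty) simp
  qed
qed

lemma column_op_commute_far:
  assumes "Suc i < j"
  shows "column_op i * column_op j = column_op j * column_op i"
  using assms column_op_mult[of i j] column_op_mult[of j i] by (simp add: insert_commute)

text \<open>The relation of Fomin and Greene between adjacent generators, checked by counting intermediate shapes.\<close>

lemma column_op_commute_near:
  fixes i
  defines "u \<equiv> column_op i" and "v \<equiv> column_op (Suc i)"
  shows "(u + v) * (u * v) = (u * v) * (u + v)"
proof (rule incidence_eqI)
  fix \<mu> \<kappa> :: young assume le: "\<mu> \<le> \<kappa>"
  let ?J = "{i, Suc i}"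
  define a b A B where "a = parts \<mu> i" "b = parts \<mu> (Suc i)" "A = parts \<kappa> i" "B = parts \<kappa> (Suc i)"
  note abAB = this
  have ord: "b \<le> a" "B \<le> A" "a \<le> A" "b \<le> B"
    using le by (auto simp: abAB young_le_iff intro: parts_antimono)
  have J: "u * v = indic (grows_in ?J)"
    unfolding u_def v_def by (rule column_op_mult) simp_all
  let ?S1 = "{\<nu>. grows_in {i} \<mu> \<nu> \<and> grows_in ?J \<nu> \<kappa>}"
  let ?S2 = "{\<nu>. grows_in {Suc i} \<mu> \<nu> \<and> grows_in ?J \<nu> \<kappa>}"
  let ?S3 = "{\<nu>. grows_in ?J \<mu> \<nu> \<and> grows_in {i} \<nu> \<kappa>}"
  let ?S4 = "{\<nu>. grows_in ?J \<mu> \<nu> \<and> grows_in {Suc i} \<nu> \<kappa>}"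
  have "card ?S1 + card ?S2 = card ?S3 + card ?S4"
  proof (cases "(\<forall>k. k \<notin> ?J \<longrightarrow> parts \<mu> k = parts \<kappa> k) \<and> a < A \<and> b < B")
    case True
    then have same: "\<And>k. k \<noteq> i \<Longrightarrow> k \<noteq> Suc i \<Longrightarrow> parts \<kappa> k = parts \<mu> k" and gr: "a < A" "b < B"
      by auto
    have mono: "parts \<nu> (Suc i) \<le> parts \<nu> i" for \<nu> by (simp add: parts_antimono)
    have low: "parts \<mu> (Suc (Suc i)) \<le> b" "parts \<kappa> (Suc (Suc i)) \<le> b"
      using parts_antimono[of "Suc i" "Suc (Suc i)" \<mu>] same[of "Suc (Suc i)"] by (auto simp: abAB)
    have high: "A \<le> parts \<mu> k" "A \<le> parts \<kappa> k" "a \<le> parts \<mu> k" if "k < i" for k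
      using parts_antimono[of k i \<kappa>] parts_antimono[of k i \<mu>] same[of k] that by (auto simp: abAB)
    \<comment> \<open>Only the second and third counts feel the interaction of the columns: in the
      second, column i + 1 grows beside a column i still of length a; in the third, column i must at
      once reach the final length B of column i + 1.\<close>
    have 1: "?S1 = {\<nu>. (\<forall>j. j \<noteq> i \<longrightarrow> parts \<nu> j = parts \<mu> j) \<and> a < parts \<nu> i \<and> parts \<nu> i < A}"
      using same gr unfolding grows_in_def abAB by (intro Collect_cong) (smt (verit) insert_iff singletonD)
    have 2: "?S2 = {\<nu>. (\<forall>j. j \<noteq> Suc i \<longrightarrow> parts \<nu> j = parts \<mu> j) \<and>
        (b < parts \<nu> (Suc i) \<and> parts \<nu> (Suc i) < B \<and> parts \<nu> (Suc i) \<le> a)}"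
    proof (intro Collect_cong iffI)
      fix \<nu> assume L: "grows_in {Suc i} \<mu> \<nu> \<and> grows_in ?J \<nu> \<kappa>"
      then have "parts \<nu> i = a" by (auto simp: grows_in_single abAB)
      then show "(\<forall>j. j \<noteq> Suc i \<longrightarrow> parts \<nu> j = parts \<mu> j) \<and>
        (b < parts \<nu> (Suc i) \<and> parts \<nu> (Suc i) < B \<and> parts \<nu> (Suc i) \<le> a)"
        using L mono[of \<nu>] by (auto simp: grows_in_single grows_in_pair abAB)
    next
      fix \<nu> assume "(\<forall>j. j \<noteq> Suc i \<longrightarrow> parts \<nu> j = parts \<mu> j) \<and>
        (b < parts \<nu> (Suc i) \<and> parts \<nu> (Suc i) < B \<and> parts \<nu> (Suc i) \<le> a)"
      then show "grows_in {Suc i} \<mu> \<nu> \<and> grows_in ?J \<nu> \<kappa>"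
        using same gr by (auto simp: grows_in_single grows_in_pair abAB)
    qed
    have 3: "?S3 = {\<nu>. (\<forall>j. j \<noteq> i \<longrightarrow> parts \<nu> j = parts \<kappa> j) \<and> (a < parts \<nu> i \<and> parts \<nu> i < A \<and> B \<le> parts \<nu> i)}"
    proof (intro Collect_cong iffI)
      fix \<nu> assume L: "grows_in ?J \<mu> \<nu> \<and> grows_in {i} \<nu> \<kappa>"
      then have "parts \<kappa> (Suc i) = parts \<nu> (Suc i)" by (simp add: grows_in_single)
      then have "parts \<nu> (Suc i) = B" by (simp add: abAB)
      then show "(\<forall>j. j \<noteq> i \<longrightarrow> parts \<nu> j = parts \<kappa> j) \<and> (a < parts \<nu> i \<and> parts \<nu> i < A \<and> B \<le> parts \<nu> i)"
        using L mono[of \<nu>] by (simp add: grows_in_single grows_in_pair flip: abAB)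
    next
      fix \<nu> assume "(\<forall>j. j \<noteq> i \<longrightarrow> parts \<nu> j = parts \<kappa> j) \<and> (a < parts \<nu> i \<and> parts \<nu> i < A \<and> B \<le> parts \<nu> i)"
      then have \<nu>: "\<And>j. j \<noteq> i \<Longrightarrow> parts \<nu> j = parts \<kappa> j" "a < parts \<nu> i" "parts \<nu> i < A" by blast+
      then show "grows_in ?J \<mu> \<nu> \<and> grows_in {i} \<nu> \<kappa>"
        using gr by (simp add: grows_in_single grows_in_pair same flip: abAB)
    qed
    have 4: "?S4 = {\<nu>. (\<forall>j. j \<noteq> Suc i \<longrightarrow> parts \<nu> j = parts \<kappa> j) \<and> (b < parts \<nu> (Suc i) \<and> parts \<nu> (Suc i) < B)}"
      using same gr unfolding grows_in_def abAB by (intro Collect_cong) (smt (verit) insert_iff singletonD)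
    have "card ?S1 = card {x. a < x \<and> x < A}"
      unfolding 1
    proof (intro card_change_part, clarify, intro conjI allI impI)
      fix x k assume x: "a < x" "x < A"
      show "parts \<mu> (Suc i) \<le> x" using x ord(1) abAB(2) by simp
      show "x \<le> parts \<mu> k" if "k < i" using x high(1)[OF that] by simp
    qed
    moreover have "card ?S2 = card {x. b < x \<and> x < B \<and> x \<le> a}"
      unfolding 2
    proof (intro card_change_part, clarify, intro conjI allI impI)
      fix x k assume x: "b < x" "x < B" "x \<le> a"
      show "parts \<mu> (Suc (Suc i)) \<le> x" using low x by simp
      show "x \<le> parts \<mu> k" if "k < Suc i"
        using x parts_antimono[of k i \<mu>] that by (simp add: abAB)
    qed
    moreover have "card ?S3 = card {x. a < x \<and> x < A \<and> B \<le> x}"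
      unfolding 3
    proof (intro card_change_part, clarify, intro conjI allI impI)
      fix x k assume x: "a < x" "x < A" "B \<le> x"
      show "parts \<kappa> (Suc i) \<le> x" using x abAB(4) by simp
      show "x \<le> parts \<kappa> k" if "k < i" using x high(2)[OF that] by simp
    qed
    moreover have "card ?S4 = card {x. b < x \<and> x < B}"
      unfolding 4
    proof (intro card_change_part, clarify, intro conjI allI impI)
      fix x k assume x: "b < x" "x < B"
      show "parts \<kappa> (Suc (Suc i)) \<le> x" using low x by simp
      show "x \<le> parts \<kappa> k" if "k < Suc i"
        using x parts_antimono[of k "Suc i" \<kappa>] that by (simp add: abAB)
    qed
    moreover have "{x. a < x \<and> x < A} = {Suc a..<A}" "{x. b < x \<and> x < B} = {Suc b..<B}"
      "{x. b < x \<and> x < B \<and> x \<le> a} = {Suc b..<min B (Suc a)}"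
      "{x. a < x \<and> x < A \<and> B \<le> x} = {max (Suc a) B..<A}" by auto
    \<comment> \<open>The first count exceeds the third by max (a + 1) B - (a + 1), and the fourth
      exceeds the second by the same amount, B - min B (a + 1).\<close>
    ultimately show ?thesis using gr ord by (simp add: min_def max_def)
  next
    case False
    have *: "\<not> (grows_in {j} \<mu> \<nu> \<and> grows_in ?J \<nu> \<kappa>)" "\<not> (grows_in ?J \<mu> \<nu> \<and> grows_in {j} \<nu> \<kappa>)"
      if "j \<in> ?J" for j \<nu>
    proof -
      have "(\<forall>k. k \<notin> ?J \<longrightarrow> parts \<mu> k = parts \<kappa> k) \<and> a < A \<and> b < B"
        if "grows_in J \<mu> \<nu>" "grows_in J' \<nu> \<kappa>" "J \<subseteq> ?J" "J' \<subseteq> ?J" "?J = J \<or> ?J = J'" for J J'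
        using that unfolding grows_in_def abAB
        by (smt (verit, best) insertCI le_less_trans less_imp_le_nat less_le_trans order_refl subset_iff)
      then show "\<not> (grows_in {j} \<mu> \<nu> \<and> grows_in ?J \<nu> \<kappa>)" "\<not> (grows_in ?J \<mu> \<nu> \<and> grows_in {j} \<nu> \<kappa>)"
        using False \<open>j \<in> ?J\<close> by (metis empty_subsetI insert_subset subset_refl)+
    qed
    have "?S1 = {}" "?S2 = {}" "?S3 = {}" "?S4 = {}"
      using *[of i] *[of "Suc i"] by blast+
    then show ?thesis by (simp only: card.empty)
  qed
  then have "real (card ?S1) + real (card ?S2) = real (card ?S3) + real (card ?S4)"
    by (simp only: of_nat_add[symmetric])
  then show "entry ((u + v) * (u * v)) \<mu> \<kappa> = entry ((u * v) * (u + v)) \<mu> \<kappa>"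
    unfolding distrib_left distrib_right J
    by (simp only: plus_incidence.rep_eq u_def v_def entry_column_op_mult)
qed


section \<open>Ordered products of the factors 1 + x u over the columns\<close>

definition col_factor :: "nat \<Rightarrow> real \<Rightarrow> young incidence" where
  "col_factor i x = 1 + x *\<^sub>R column_op i"

primrec col_prod :: "nat \<Rightarrow> real \<Rightarrow> young incidence" where
  "col_prod 0 x = 1"
| "col_prod (Suc n) x = col_prod n x * col_factor n x"

lemma col_factor_commute_same: "col_factor i x * col_factor i y = col_factor i y * col_factor i x"
  by (simp add: col_factor_def algebra_simps)

lemma col_factor_commute_far:
  "Suc i < j \<Longrightarrow> col_factor i x * col_factor j y = col_factor j y * col_factor i x"
  using column_op_commute_far[of i j] by (simp add: col_factor_def algebra_simps)

lemma col_prod_commute_far: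
  "n < j \<Longrightarrow> col_prod n x * col_factor j y = col_factor j y * col_prod n x"
proof (induction n)
  case (Suc n)
  then have "col_prod n x * col_factor j y = col_factor j y * col_prod n x"
    "col_factor n x * col_factor j y = col_factor j y * col_factor n x"
    by (simp_all add: col_factor_commute_far)
  then show ?case by (metis col_prod.simps(2) mult.assoc)
qed simp

text \<open>With s = u + v and p = uv the product is 1 + x s + x^2 p, so all these products lie in
  the algebra generated by s and p, which commute by the adjacent relation.\<close>

lemma col_factor_pair_commute:
  fixes i
  defines "F \<equiv> \<lambda>x. col_factor i x * col_factor (Suc i) x"
  shows "F x * F y = F y * F x"
proof -
  define s v where "s = column_op i + column_op (Suc i)" and "v = column_op i * column_op (Suc i)"
  have sv: "s * v = v * s" unfolding s_def v_def by (rule column_op_commute_near)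
  have F: "F x = 1 + x *\<^sub>R s + (x * x) *\<^sub>R v" for x
    by (simp add: F_def col_factor_def s_def v_def algebra_simps)
  show ?thesis unfolding F
    by (simp add: distrib_left distrib_right scaleR_add_right sv ac_simps)
qed

lemma col_factor_invertible: "\<exists>g. col_factor i x * g = 1 \<and> g * col_factor i x = 1"
  by (rule incidence_invertible)
    (simp add: col_factor_def column_op_def entry_one entry_indic grows_in_single)

text \<open>The induction step for ordered products: e is the prefix, p and q are the last two
  factors, and primes mark the second argument. Only the blocks e p and p q are known to commute
  with their primed versions. The inverse r of p rewrites q p' q' as p' r q' p q, after which p r
  cancels in the middle.\<close>

lemma exchange_commute:
  fixes e e' p p' q q' r :: "'a::monoid_mult"
  assumes ep: "e * p * (e' * p') = e' * p' * (e * p)"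
    and pq: "p * q * (p' * q') = p' * q' * (p * q)"
    and pp: "p * p' = p' * p" and eq: "e * q' = q' * e" "e' * q = q * e'"
    and inv: "p * r = 1" "r * p = 1"
  shows "e * p * q * (e' * p' * q') = e' * p' * q' * (e * p * q)"
proof -
  have rp: "r * p' = p' * r"
    by (metis inv pp mult.assoc mult_1_left mult_1_right)
  have "q * p' * q' = r * (p * q * (p' * q'))"
    using inv by (simp add: mult.assoc[symmetric])
  also have "\<dots> = p' * r * (q' * p * q)"
    unfolding pq by (metis rp mult.assoc)
  finally have 1: "q * p' * q' = p' * r * (q' * p * q)" .
  have "e * p * q * (e' * p' * q') = e * p * e' * (q * p' * q')"
    by (metis eq(2) mult.assoc)
  also have "\<dots> = e * p * (e' * p') * (r * (q' * p * q))"
    unfolding 1 by (simp add: mult.assoc)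
  also have "\<dots> = e' * p' * e * (p * r) * (q' * p * q)"
    unfolding ep by (simp add: mult.assoc)
  also have "\<dots> = e' * p' * (e * q') * p * q"
    using inv by (simp add: mult.assoc)
  also have "\<dots> = e' * p' * q' * (e * p * q)"
    unfolding eq by (simp add: mult.assoc)
  finally show ?thesis .
qed

lemma col_prod_commute: "col_prod n x * col_prod n y = col_prod n y * col_prod n x"
proof (induction n rule: less_induct)
  case (less n)
  consider "n = 0" | "n = 1" | m where "n = Suc (Suc m)"
    by (metis One_nat_def not0_implies_Suc)
  then show ?case
  proof cases
    case 3
    obtain r where r: "col_factor m x * r = 1" "r * col_factor m x = 1"
      using col_factor_invertible by blast
    have "col_prod (Suc m) x * col_prod (Suc m) y = col_prod (Suc m) y * col_prod (Suc m) x"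
      by (rule less) (simp add: 3)
    note IH = this[unfolded col_prod.simps]
    show ?thesis
      unfolding 3 col_prod.simps
      by (intro exchange_commute[OF IH _ _ _ _ r] col_factor_pair_commute col_factor_commute_same
          col_prod_commute_far) simp_all
  qed (simp_all add: col_factor_commute_same)
qed

text \<open>Growing columns from left to right never breaks the shape condition, so there is exactly
  one path from \<mu> to \<kappa>: each column that grows jumps to its final length once and
  contributes one x.\<close>

lemma entry_col_prod:
  "entry (col_prod n x) \<mu> \<kappa> =
    (if \<mu> \<le> \<kappa> \<and> (\<forall>j\<ge>n. parts \<mu> j = parts \<kappa> j) then x ^ card (grown \<mu> \<kappa>) else 0)"
proof (induction n arbitrary: \<mu> \<kappa>)
  case 0
  have "\<mu> = \<kappa>" if "\<forall>j. parts \<mu> j = parts \<kappa> j" using that by (intro young_eqI) simp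
  moreover have "grown \<kappa> \<kappa> = {}" by (simp add: grown_def)
  ultimately show ?case by (auto simp: entry_one)
next
  case (Suc n)
  let ?f = "\<lambda>\<nu>. entry (col_prod n x) \<mu> \<nu> * entry (column_op n) \<nu> \<kappa>"
  have E: "entry (col_prod (Suc n) x) \<mu> \<kappa> = entry (col_prod n x) \<mu> \<kappa> + x * (\<Sum>\<nu>\<in>{\<mu>..\<kappa>}. ?f \<nu>)"
    by (simp add: col_factor_def distrib_left entry_mult)
  \<comment> \<open>The only possible intermediate shape is \<kappa> with column n put back to its
    length in \<mu>.\<close>
  have zero: "?f \<nu> = 0"
    if "\<not> ((\<forall>j>n. parts \<mu> j = parts \<kappa> j) \<and> parts \<mu> n < parts \<kappa> n \<and> \<nu> = set_part \<kappa> n (parts \<mu> n))" for \<nu>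
  proof (rule ccontr)
    assume "?f \<nu> \<noteq> 0"
    then have *: "\<forall>j\<ge>n. parts \<mu> j = parts \<nu> j" "grows_in {n} \<nu> \<kappa>"
      by (auto simp: Suc.IH column_op_def entry_indic split: if_splits)
    then have **: "\<forall>j>n. parts \<mu> j = parts \<kappa> j" "parts \<mu> n < parts \<kappa> n" "\<forall>j. j \<noteq> n \<longrightarrow> parts \<nu> j = parts \<kappa> j"
      by (auto simp: grows_in_def)
    have "parts (set_part \<kappa> n (parts \<mu> n)) = (parts \<kappa>)(n := parts \<mu> n)"
    proof (rule parts_set_part)
      show "parts \<kappa> (Suc n) \<le> parts \<mu> n"
        using **(1) parts_antimono[of n "Suc n" \<mu>] by simp
      show "parts \<mu> n \<le> parts \<kappa> j" if "j < n" for j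
        using parts_antimono[of j n \<kappa>] **(2) that by simp
    qed
    then have "\<nu> = set_part \<kappa> n (parts \<mu> n)"
      using *(1) **(3) by (intro young_eqI) auto
    then show False using ** that by blast
  qed
  show ?case
  proof (cases "\<mu> \<le> \<kappa> \<and> (\<forall>j\<ge>Suc n. parts \<mu> j = parts \<kappa> j)")
    case False
    then have "entry (col_prod n x) \<mu> \<kappa> = 0" by (auto simp: Suc.IH)
    moreover have "(\<Sum>\<nu>\<in>{\<mu>..\<kappa>}. ?f \<nu>) = 0"
      using False zero by (intro sum.neutral ballI) (meson Suc_le_eq atLeastAtMost_iff order_trans)
    ultimately show ?thesis using False by (simp only: E) simp
  next
    case True
    then have le: "\<mu> \<le> \<kappa>" and same: "\<And>j. j > n \<Longrightarrow> parts \<mu> j = parts \<kappa> j" by (auto simp: Suc_le_eq)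
    show ?thesis
    proof (cases "parts \<mu> n = parts \<kappa> n")
      case True
      then have "(\<Sum>\<nu>\<in>{\<mu>..\<kappa>}. ?f \<nu>) = 0"
        using zero by (intro sum.neutral ballI) (metis less_irrefl)
      moreover have "\<forall>j\<ge>n. parts \<mu> j = parts \<kappa> j"
        using True same by (metis le_neq_implies_less)
      ultimately show ?thesis using le by (simp only: E) (simp add: Suc.IH)
    next
      case False
      then have lt: "parts \<mu> n < parts \<kappa> n" using le by (simp add: young_le_iff le_neq_implies_less)
      define \<nu> where "\<nu> = set_part \<kappa> n (parts \<mu> n)"
      have p\<nu>: "parts \<nu> = (parts \<kappa>)(n := parts \<mu> n)"
        unfolding \<nu>_def
      proof (rule parts_set_part)
        show "parts \<kappa> (Suc n) \<le> parts \<mu> n"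
          using same parts_antimono[of n "Suc n" \<mu>] by simp
        show "parts \<mu> n \<le> parts \<kappa> j" if "j < n" for j
          using parts_antimono[of j n \<kappa>] lt that by simp
      qed
      have \<nu>: "\<mu> \<le> \<nu>" "\<nu> \<le> \<kappa>" using le lt by (auto simp: young_le_iff p\<nu>)
      have "(\<Sum>\<nu>\<in>{\<mu>..\<kappa>}. ?f \<nu>) = ?f \<nu>"
      proof -
        have "(\<Sum>\<nu>'\<in>{\<mu>..\<kappa>}. ?f \<nu>') = (\<Sum>\<nu>'\<in>{\<nu>}. ?f \<nu>')"
          using \<nu> zero unfolding \<nu>_def by (intro sum.mono_neutral_right) (auto simp del: mult_eq_0_iff)
        then show ?thesis by simp
      qed
      also have "\<dots> = x ^ card (grown \<mu> \<nu>)"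
      proof -
        have "\<forall>j\<ge>n. parts \<mu> j = parts \<nu> j" using same by (auto simp: p\<nu>)
        moreover have "grows_in {n} \<nu> \<kappa>" using lt by (auto simp: grows_in_def p\<nu>)
        ultimately show ?thesis using \<nu> by (simp add: Suc.IH column_op_def entry_indic)
      qed
      finally have S: "(\<Sum>\<nu>\<in>{\<mu>..\<kappa>}. ?f \<nu>) = x ^ card (grown \<mu> \<nu>)" .
      have "grown \<mu> \<kappa> = insert n (grown \<mu> \<nu>)" "n \<notin> grown \<mu> \<nu>"
        using lt by (auto simp: grown_def p\<nu>)
      then have "card (grown \<mu> \<kappa>) = Suc (card (grown \<mu> \<nu>))" by simp
      moreover have "entry (col_prod n x) \<mu> \<kappa> = 0" using lt by (auto simp: Suc.IH)
      ultimately show ?thesis using le same by (simp only: E S) (simp add: Suc_le_eq)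
    qed
  qed
qed

section \<open>One-variable transfer matrices\<close>

definition layer :: "nat \<Rightarrow> young incidence" where
  "layer n = indic (\<lambda>\<mu> \<kappa>. card (grown \<mu> \<kappa>) = n)"

definition transfer :: "real \<Rightarrow> young incidence" where
  "transfer x = Incidence (\<lambda>\<mu> \<kappa>. if \<mu> \<le> \<kappa> then x ^ card (grown \<mu> \<kappa>) else 0)"

lemma entry_layer: "entry (layer n) \<mu> \<kappa> = (if \<mu> \<le> \<kappa> \<and> card (grown \<mu> \<kappa>) = n then 1 else 0)"
  by (simp add: layer_def entry_indic)

lemma entry_transfer: "entry (transfer x) \<mu> \<kappa> = (if \<mu> \<le> \<kappa> then x ^ card (grown \<mu> \<kappa>) else 0)"
  unfolding transfer_def by (subst entry_Incidence) auto

text \<open>Below a fixed \<kappa> only finitely many columns are nonempty, so there the transfer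
  matrix coincides with a finite ordered product.\<close>

lemma transfer_commute: "transfer x * transfer y = transfer y * transfer x"
proof (rule incidence_eqI)
  fix \<mu> \<kappa> :: young
  obtain n where n: "\<forall>j\<ge>n. parts \<kappa> j = 0" using parts_eventually_0 ..
  have n': "parts \<nu> j = 0" if "\<nu> \<le> \<kappa>" "j \<ge> n" for \<nu> j
    using n that by (metis le_zero_eq young_le_iff)
  have eq: "entry (transfer x) \<nu> \<nu>' = entry (col_prod n x) \<nu> \<nu>'" if "\<nu> \<le> \<kappa>" "\<nu>' \<le> \<kappa>" for x \<nu> \<nu>'
    using n' that by (simp add: entry_transfer entry_col_prod)
  have "entry (transfer x * transfer y) \<mu> \<kappa> = entry (col_prod n x * col_prod n y) \<mu> \<kappa>" for x y
    unfolding entry_mult by (intro sum.cong refl) (auto simp: eq intro: order_trans)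
  then show "entry (transfer x * transfer y) \<mu> \<kappa> = entry (transfer y * transfer x) \<mu> \<kappa>"
    using col_prod_commute by metis
qed

definition young_size :: "young \<Rightarrow> nat" where
  "young_size \<mu> = (\<Sum>j | parts \<mu> j \<noteq> 0. parts \<mu> j)"

lemma young_size_eq:
  assumes "\<forall>j\<ge>n. parts \<mu> j = 0"
  shows "young_size \<mu> = (\<Sum>j<n. parts \<mu> j)"
  unfolding young_size_def using assms by (intro sum.mono_neutral_left) (auto simp: not_less[symmetric])

text \<open>Each grown column gains at least one box, possibly several; hence a filtration by size
  and not a grading.\<close>

lemma card_grown_le:
  assumes "\<mu> \<le> \<kappa>"
  shows "young_size \<mu> + card (grown \<mu> \<kappa>) \<le> young_size \<kappa>"
proof -
  obtain n where n: "\<forall>j\<ge>n. parts \<kappa> j = 0" using parts_eventually_0 ..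
  then have n': "\<forall>j\<ge>n. parts \<mu> j = 0" using assms by (metis le_zero_eq young_le_iff)
  have sub: "grown \<mu> \<kappa> \<subseteq> {..<n}" using n by (auto simp: grown_def not_less[symmetric])
  have "card (grown \<mu> \<kappa>) = (\<Sum>j<n. if j \<in> grown \<mu> \<kappa> then 1 else 0)"
    using sub by (simp add: sum.If_cases Int_absorb1)
  then have "young_size \<mu> + card (grown \<mu> \<kappa>) = (\<Sum>j<n. parts \<mu> j + (if j \<in> grown \<mu> \<kappa> then 1 else 0))"
    by (simp add: young_size_eq[OF n'] sum.distrib)
  also have "\<dots> \<le> (\<Sum>j<n. parts \<kappa> j)"
    using assms by (intro sum_mono) (auto simp: grown_def young_le_iff)
  finally show ?thesis by (simp add: young_size_eq[OF n])
qed

lemma entry_transfer_sum: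
  assumes "young_size \<kappa> \<le> N" "\<nu> \<le> \<kappa>"
  shows "entry (transfer x) \<mu> \<nu> = (\<Sum>n\<le>N. entry (layer n) \<mu> \<nu> * x ^ n)"
proof (cases "\<mu> \<le> \<nu>")
  case True
  have "card (grown \<mu> \<nu>) \<le> N"
    using card_grown_le[OF True] card_grown_le[OF assms(2)] assms(1) by linarith
  then show ?thesis
    using True by (simp add: entry_transfer entry_layer if_distrib[where f = "\<lambda>t. t * _"] cong: if_cong)
qed (simp add: entry_transfer entry_layer)

text \<open>At a fixed entry both products of transfer matrices are polynomials in x and y; the
  coefficients of x^m y^n are compared, first in x and then in y.\<close>

lemma layer_commute: "layer m * layer n = layer n * layer m"
proof (rule incidence_eqI)
  fix \<mu> \<kappa> :: young assume "\<mu> \<le> \<kappa>"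
  \<comment> \<open>Large enough to express both transfer matrices on the interval, and for m and n
    to be among the exponents compared.\<close>
  define N where "N = max (young_size \<kappa>) (max m n)"
  have N: "young_size \<kappa> \<le> N" "m \<le> N" "n \<le> N" by (simp_all add: N_def)
  have expand: "entry (transfer x * transfer y) \<mu> \<kappa>
      = (\<Sum>i\<le>N. (\<Sum>j\<le>N. entry (layer i * layer j) \<mu> \<kappa> * y ^ j) * x ^ i)" for x y
  proof -
    have "entry (transfer x * transfer y) \<mu> \<kappa> = (\<Sum>\<nu>\<in>{\<mu>..\<kappa>}. \<Sum>i\<le>N. \<Sum>j\<le>N.
        entry (layer i) \<mu> \<nu> * x ^ i * (entry (layer j) \<nu> \<kappa> * y ^ j))"
      unfolding entry_mult
      by (intro sum.cong refl) (simp add: entry_transfer_sum[OF N(1)] sum_product)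
    also have "\<dots> = (\<Sum>i\<le>N. \<Sum>j\<le>N. \<Sum>\<nu>\<in>{\<mu>..\<kappa>}.
        entry (layer i) \<mu> \<nu> * x ^ i * (entry (layer j) \<nu> \<kappa> * y ^ j))"
      by (subst sum.swap, subst (2) sum.swap) (rule refl)
    also have "\<dots> = (\<Sum>i\<le>N. (\<Sum>j\<le>N. entry (layer i * layer j) \<mu> \<kappa> * y ^ j) * x ^ i)"
      by (simp add: entry_mult sum_distrib_left sum_distrib_right mult_ac)
    finally show ?thesis .
  qed
  define d where "d i j = entry (layer i * layer j) \<mu> \<kappa> - entry (layer j * layer i) \<mu> \<kappa>" for i j
  have "(\<Sum>i\<le>N. (\<Sum>j\<le>N. d i j * y ^ j) * x ^ i) = 0" for x y
  proof -
    have "(\<Sum>i\<le>N. (\<Sum>j\<le>N. entry (layer i * layer j) \<mu> \<kappa> * y ^ j) * x ^ i)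
        = (\<Sum>i\<le>N. (\<Sum>j\<le>N. entry (layer i * layer j) \<mu> \<kappa> * x ^ j) * y ^ i)"
      using expand[of x y] expand[of y x] transfer_commute[of x y] by simp
    also have "\<dots> = (\<Sum>i\<le>N. (\<Sum>j\<le>N. entry (layer j * layer i) \<mu> \<kappa> * y ^ j) * x ^ i)"
      unfolding sum_distrib_right by (subst sum.swap) (simp add: mult_ac)
    finally show ?thesis
      by (simp add: d_def left_diff_distrib sum_subtractf)
  qed
  then have "(\<Sum>j\<le>N. d m j * y ^ j) = 0" for y
    using polyfun_eq_0[of "\<lambda>i. \<Sum>j\<le>N. d i j * y ^ j" N] N(2) by blast
  then have "d m n = 0"
    using polyfun_eq_0[of "d m" N] N(3) by blast
  then show "entry (layer m * layer n) \<mu> \<kappa> = entry (layer n * layer m) \<mu> \<kappa>"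
    by (simp add: d_def)
qed

section \<open>Exponentials of power series over a noncommutative algebra\<close>

text \<open>The Euler operator z d/dz. It shifts no indices, so the logarithmic derivative of an
  exponential of sums C_k z^k / k has coefficients C_k in the right degrees.\<close>

definition fps_theta :: "'a::real_algebra_1 fps \<Rightarrow> 'a fps" where
  "fps_theta F = Abs_fps (\<lambda>n. real n *\<^sub>R fps_nth F n)"

lemma fps_theta_nth [simp]: "fps_nth (fps_theta F) n = real n *\<^sub>R fps_nth F n"
  by (simp add: fps_theta_def)

lemma fps_theta_mult: "fps_theta (F * G) = fps_theta F * G + F * fps_theta G"
proof (rule fps_ext)
  fix n
  have "real n *\<^sub>R (fps_nth F i * fps_nth G (n - i)) =
      real i *\<^sub>R fps_nth F i * fps_nth G (n - i) + fps_nth F i * (real (n - i) *\<^sub>R fps_nth G (n - i))"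
    if "i \<le> n" for i
    using that by (simp add: of_nat_diff scaleR_left_distrib[symmetric])
  then show "fps_nth (fps_theta (F * G)) n = fps_nth (fps_theta F * G + F * fps_theta G) n"
    by (simp add: fps_mult_nth scaleR_sum_right sum.distrib[symmetric])
qed

text \<open>The coefficients of \<open>exp (\<Sum>k\<ge>1. C\<^sub>k z\<^sup>k / k)\<close> when the \<open>C\<^sub>k\<close> commute.\<close>

fun newton :: "'a::real_algebra_1 fps \<Rightarrow> nat \<Rightarrow> 'a" where
  "newton C 0 = 1"
| "newton C (Suc n) = (1 / real (Suc n)) *\<^sub>R (\<Sum>k\<le>n. fps_nth C (Suc k) * newton C (n - k))"

definition theta_exp :: "'a::real_algebra_1 fps \<Rightarrow> 'a fps" where
  "theta_exp C = Abs_fps (newton C)"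

lemma theta_exp_nth [simp]: "fps_nth (theta_exp C) n = newton C n"
  by (simp add: theta_exp_def)

lemma fps_mult_nth_Suc:
  fixes C F :: "'a::ring_1 fps"
  assumes "fps_nth C 0 = 0"
  shows "fps_nth (C * F) (Suc n) = (\<Sum>k\<le>n. fps_nth C (Suc k) * fps_nth F (n - k))"
  unfolding fps_mult_nth atLeast0AtMost sum.atMost_Suc_shift using assms by simp

text \<open>Since C has no constant term, the equation expresses n times the n-th coefficient
  through earlier ones. Later identities between exponentials are all reduced to this first-order
  equation.\<close>

lemma theta_exp_unique:
  assumes C: "fps_nth C 0 = 0" and F: "fps_nth F 0 = 1" "fps_theta F = C * F"
  shows "F = theta_exp C"
proof (rule fps_ext)
  fix n show "fps_nth F n = fps_nth (theta_exp C) n"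
  proof (induction n rule: less_induct)
    case (less n)
    show ?case
    proof (cases n)
      case (Suc m)
      have "real n *\<^sub>R fps_nth F n = (\<Sum>k\<le>m. fps_nth C (Suc k) * fps_nth F (m - k))"
        using arg_cong[OF F(2), of "\<lambda>F. fps_nth F n"] by (simp add: fps_mult_nth_Suc[OF C] Suc del: of_nat_Suc)
      also have "\<dots> = (\<Sum>k\<le>m. fps_nth C (Suc k) * newton C (m - k))"
        using less Suc by (intro sum.cong refl) simp
      finally have "(1 / real n) *\<^sub>R (real n *\<^sub>R fps_nth F n) =
          (1 / real n) *\<^sub>R (\<Sum>k\<le>m. fps_nth C (Suc k) * newton C (m - k))" by simp
      then show ?thesis by (simp add: Suc del: of_nat_Suc)
    qed (simp add: F)
  qed
qed

lemma fps_theta_exp: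
  assumes "fps_nth C 0 = 0"
  shows "fps_theta (theta_exp C) = C * theta_exp C"
proof (rule fps_ext)
  fix n show "fps_nth (fps_theta (theta_exp C)) n = fps_nth (C * theta_exp C) n"
    using assms by (cases n) (simp_all add: fps_mult_nth_Suc del: of_nat_Suc)
qed

lemma theta_exp_0 [simp]: "theta_exp 0 = 1"
  by (rule theta_exp_unique[symmetric]) (simp_all add: fps_eq_iff)

text \<open>By the product rule the right side solves the equation for C + D once D can be moved
  past the exponential of C.\<close>

lemma theta_exp_add:
  assumes "fps_nth C 0 = 0" "fps_nth D 0 = 0" "D * theta_exp C = theta_exp C * D"
  shows "theta_exp (C + D) = theta_exp C * theta_exp D"
proof (rule theta_exp_unique[symmetric])
  have "fps_theta (theta_exp C * theta_exp D)
      = C * theta_exp C * theta_exp D + theta_exp C * D * theta_exp D"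
    by (simp add: fps_theta_mult fps_theta_exp assms mult.assoc)
  then show "fps_theta (theta_exp C * theta_exp D) = (C + D) * (theta_exp C * theta_exp D)"
    by (simp add: assms(3)[symmetric] distrib_right mult.assoc)
qed (simp_all add: assms)

lemma newton_commute:
  assumes "\<And>k. x * fps_nth C k = fps_nth C k * x"
  shows "x * newton C n = newton C n * x"
proof (induction n rule: less_induct)
  case (less n)
  show ?case
  proof (cases n)
    case (Suc m)
    have "x * (fps_nth C (Suc k) * newton C (m - k)) = fps_nth C (Suc k) * newton C (m - k) * x"
      if "k \<le> m" for k
    proof -
      have "x * newton C (m - k) = newton C (m - k) * x" using less Suc that by simp
      then show ?thesis
        unfolding mult.assoc[symmetric] assms by (simp add: mult.assoc)
    qed
    then show ?thesis by (simp add: Suc sum_distrib_left sum_distrib_right del: of_nat_Suc)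
  qed simp
qed

lemma fps_const_commute_iff:
  fixes F :: "'a::ring_1 fps"
  shows "fps_const x * F = F * fps_const x \<longleftrightarrow> (\<forall>n. x * fps_nth F n = fps_nth F n * x)"
  by (simp add: fps_eq_iff)

lemma fps_mult_commuteI:
  fixes F G :: "'a::ring_1 fps"
  assumes "\<And>i j. fps_nth F i * fps_nth G j = fps_nth G j * fps_nth F i"
  shows "F * G = G * F"
proof (rule fps_ext)
  fix n
  have "fps_nth (F * G) n = (\<Sum>i=0..n. fps_nth G (n - i) * fps_nth F i)"
    by (simp add: fps_mult_nth assms)
  also have "\<dots> = (\<Sum>i=0..n. fps_nth G i * fps_nth F (n - i))"
    by (rule sum.reindex_bij_witness[of _ "\<lambda>i. n - i" "\<lambda>i. n - i"]) auto
  finally show "fps_nth (F * G) n = fps_nth (G * F) n" by (simp add: fps_mult_nth)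
qed

section \<open>The logarithmic derivative of the transfer matrices\<close>

definition layers :: "young incidence fps" where
  "layers = Abs_fps layer"

lemma layers_nth [simp]: "fps_nth layers n = layer n"
  by (simp add: layers_def)

lemma grown_empty_iff: "\<mu> \<le> \<kappa> \<Longrightarrow> grown \<mu> \<kappa> = {} \<longleftrightarrow> \<mu> = \<kappa>"
  by (auto simp: grown_def young_le_iff not_less intro!: young_eqI antisym)

lemma layer_0 [simp]: "layer 0 = 1"
  by (rule incidence_eqI) (simp add: entry_layer entry_one grown_empty_iff)

text \<open>The logarithmic derivative z A'(z) A(z)^-1, so that its coefficients are the b_k; the
  quotient is taken on the right because the ring is noncommutative.\<close>

definition layer_log :: "young incidence fps" where
  "layer_log = fps_theta layers * fps_left_inverse layers 1"

lemma layer_log_nth_0 [simp]: "fps_nth layer_log 0 = 0"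
  by (simp add: layer_log_def)

lemma fps_theta_layers: "fps_theta layers = layer_log * layers"
  by (simp add: layer_log_def mult.assoc fps_left_inverse)

text \<open>Whatever commutes with a power series also commutes with its Euler derivative and its
  inverse.\<close>

lemma layer_log_commuteI:
  assumes "\<And>n. x * layer n = layer n * x"
  shows "x * fps_nth layer_log k = fps_nth layer_log k * x"
proof -
  define J where "J = fps_left_inverse layers 1"
  have JL: "J * layers = 1" by (simp add: J_def fps_left_inverse)
  define R where "R = fps_right_inverse layers 1"
  have LR: "layers * R = 1" by (simp add: R_def fps_right_inverse)
  \<comment> \<open>A left and a right inverse agree, so J is two-sided; both cancellations are
    needed to move x past J.\<close>
  have "J = J * layers * R" by (simp add: LR mult.assoc)
  then have LJ: "layers * J = 1" by (simp add: JL LR)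
  have Lx: "fps_const x * layers = layers * fps_const x"
    by (simp add: fps_const_commute_iff assms)
  have tx: "fps_const x * fps_theta layers = fps_theta layers * fps_const x"
    by (simp add: fps_const_commute_iff assms)
  have "fps_const x * J = J * (layers * fps_const x) * J"
    using JL by (simp add: mult.assoc[symmetric])
  also have "\<dots> = J * fps_const x"
    using LJ by (simp add: Lx[symmetric] mult.assoc)
  finally have "fps_const x * J = J * fps_const x" .
  then have "fps_const x * layer_log = layer_log * fps_const x"
    unfolding layer_log_def J_def[symmetric] mult.assoc[symmetric] tx by (simp add: mult.assoc)
  then show ?thesis by (simp add: fps_const_commute_iff)
qed

lemma layer_log_commute_layer: "fps_nth layer_log k * layer n = layer n * fps_nth layer_log k"
  using layer_log_commuteI[of "layer n" k] layer_commute by simp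

lemma layer_log_commute: "fps_nth layer_log i * fps_nth layer_log j = fps_nth layer_log j * fps_nth layer_log i"
  by (intro layer_log_commuteI layer_log_commute_layer)

section \<open>Specialized transfer matrices\<close>

text \<open>Here \<open>r k\<close> plays the role of the value of the power sum \<open>p\<^sub>k\<close>.\<close>

definition log_at :: "(nat \<Rightarrow> real) \<Rightarrow> young incidence fps" where
  "log_at r = Abs_fps (\<lambda>k. r k *\<^sub>R fps_nth layer_log k)"

lemma log_at_nth [simp]: "fps_nth (log_at r) k = r k *\<^sub>R fps_nth layer_log k"
  by (simp add: log_at_def)

definition spec_layers :: "(nat \<Rightarrow> real) \<Rightarrow> young incidence fps" where
  "spec_layers r = theta_exp (log_at r)"

text \<open>Joining two sets of variables adds their power sums. The exponential law applies because
  the coefficients of \<open>layer_log\<close> commute with each other.\<close>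

lemma spec_layers_add: "spec_layers (\<lambda>k. r k + s k) = spec_layers r * spec_layers s"
proof -
  have "log_at (\<lambda>k. r k + s k) = log_at r + log_at s"
    by (simp add: fps_eq_iff scaleR_left_distrib)
  moreover have "log_at s * theta_exp (log_at r) = theta_exp (log_at r) * log_at s"
    by (intro fps_mult_commuteI) (simp add: newton_commute layer_log_commute)
  ultimately show ?thesis
    unfolding spec_layers_def by (simp add: theta_exp_add)
qed

lemma spec_layers_0: "spec_layers (\<lambda>_. 0) = 1"
proof -
  have "log_at (\<lambda>_. 0) = 0" by (simp add: fps_eq_iff)
  then show ?thesis by (simp add: spec_layers_def)
qed

text \<open>The substitution of tz for z in A(z): it multiplies the k-th coefficient of the
  logarithmic derivative by t^k.\<close>

lemma spec_layers_power: "spec_layers (\<lambda>k. t ^ k) = Abs_fps (\<lambda>n. t ^ n *\<^sub>R layer n)"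
  unfolding spec_layers_def
proof (rule theta_exp_unique[symmetric])
  have L: "real n *\<^sub>R layer n = (\<Sum>i=0..n. fps_nth layer_log i * layer (n - i))" for n
    using arg_cong[OF fps_theta_layers, of "\<lambda>F. fps_nth F n"] by (simp add: fps_mult_nth)
  show "fps_theta (Abs_fps (\<lambda>n. t ^ n *\<^sub>R layer n)) = log_at (\<lambda>k. t ^ k) * Abs_fps (\<lambda>n. t ^ n *\<^sub>R layer n)"
  proof (rule fps_ext)
    fix n
    have "real n *\<^sub>R t ^ n *\<^sub>R layer n = t ^ n *\<^sub>R (real n *\<^sub>R layer n)" by simp
    also have "\<dots> = (\<Sum>i=0..n. (t ^ i *\<^sub>R fps_nth layer_log i) * (t ^ (n - i) *\<^sub>R layer (n - i)))"
      unfolding L scaleR_sum_right by (intro sum.cong refl) (simp flip: power_add)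
    finally show "fps_nth (fps_theta (Abs_fps (\<lambda>n. t ^ n *\<^sub>R layer n))) n =
        fps_nth (log_at (\<lambda>k. t ^ k) * Abs_fps (\<lambda>n. t ^ n *\<^sub>R layer n)) n"
      by (simp add: fps_mult_nth)
  qed
qed simp_all

section \<open>Filtration by the number of boxes\<close>

definition raises :: "nat \<Rightarrow> young incidence \<Rightarrow> bool" where
  "raises n f \<longleftrightarrow> (\<forall>\<mu> \<kappa>. entry f \<mu> \<kappa> \<noteq> 0 \<longrightarrow> young_size \<mu> + n \<le> young_size \<kappa>)"

lemma raises_mult: 
  assumes "raises m f" "raises n g"
  shows "raises (m + n) (f * g)"
  unfolding raises_def
proof (intro allI impI)
  fix \<mu> \<kappa> assume "entry (f * g) \<mu> \<kappa> \<noteq> 0"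
  then obtain \<nu> where "entry f \<mu> \<nu> * entry g \<nu> \<kappa> \<noteq> 0"
    unfolding entry_mult by (rule sum.not_neutral_contains_not_neutral)
  then have "entry f \<mu> \<nu> \<noteq> 0" "entry g \<nu> \<kappa> \<noteq> 0" by auto
  then have "young_size \<mu> + m \<le> young_size \<nu>" "young_size \<nu> + n \<le> young_size \<kappa>"
    using assms by (auto simp: raises_def)
  then show "young_size \<mu> + (m + n) \<le> young_size \<kappa>" by linarith
qed

lemma raises_sum:
  assumes "\<And>i. i \<in> I \<Longrightarrow> raises n (f i)"
  shows "raises n (sum f I)"
  unfolding raises_def entry_sum
proof (intro allI impI)
  fix \<mu> \<kappa> assume "(\<Sum>i\<in>I. entry (f i) \<mu> \<kappa>) \<noteq> 0"
  then obtain i where "i \<in> I" "entry (f i) \<mu> \<kappa> \<noteq> 0" by (rule sum.not_neutral_contains_not_neutral)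
  then show "young_size \<mu> + n \<le> young_size \<kappa>" using assms by (auto simp: raises_def)
qed

lemma raises_scaleR: "raises n f \<Longrightarrow> raises n (c *\<^sub>R f)"
  by (auto simp: raises_def)

lemma raises_diff:
  assumes "raises n f" "raises n g" shows "raises n (f - g)"
  unfolding raises_def
proof (intro allI impI)
  fix \<mu> \<kappa> assume "entry (f - g) \<mu> \<kappa> \<noteq> 0"
  then have "entry f \<mu> \<kappa> \<noteq> 0 \<or> entry g \<mu> \<kappa> \<noteq> 0" by auto
  then show "young_size \<mu> + n \<le> young_size \<kappa>" using assms by (auto simp: raises_def)
qed

lemma raises_layer: "raises n (layer n)"
  using card_grown_le by (auto simp: raises_def entry_layer)

text \<open>Newton's recursion solved for its top term, which appears with coefficient
  \<open>layer 0\<close> = 1.\<close>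

lemma raises_layer_log: "raises n (fps_nth layer_log n)"
proof (induction n rule: less_induct)
  case (less n)
  have "real n *\<^sub>R layer n = (\<Sum>i<n. fps_nth layer_log i * layer (n - i)) + fps_nth layer_log n"
    using arg_cong[OF fps_theta_layers, of "\<lambda>F. fps_nth F n"]
    by (simp add: fps_mult_nth atLeast0AtMost flip: lessThan_Suc_atMost)
  then have "fps_nth layer_log n = real n *\<^sub>R layer n - (\<Sum>i<n. fps_nth layer_log i * layer (n - i))"
    by simp
  moreover have "raises n (fps_nth layer_log i * layer (n - i))" if "i < n" for i
    using raises_mult[OF less[OF that] raises_layer, of "n - i"] that by simp
  ultimately show ?case
    by (auto intro!: raises_diff raises_scaleR raises_layer raises_sum)
qed

lemma raises_newton:
  assumes "\<And>k. raises k (fps_nth C k)"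
  shows "raises n (newton C n)"
proof (induction n rule: less_induct)
  case (less n)
  show ?case
  proof (cases n)
    case 0
    then show ?thesis by (simp add: raises_def entry_one)
  next
    case (Suc m)
    have "raises n (fps_nth C (Suc k) * newton C (m - k))" if "k \<le> m" for k
      using raises_mult[OF assms less, of "m - k" "Suc k"] Suc that by simp
    then show ?thesis
      unfolding Suc newton.simps by (intro raises_scaleR raises_sum) simp
  qed
qed

text \<open>Setting the grading variable to 1; the sum is finite by the grading.\<close>

definition total :: "young incidence fps \<Rightarrow> young incidence" where
  "total F = Incidence (\<lambda>\<mu> \<kappa>. \<Sum>n\<le>young_size \<kappa>. entry (fps_nth F n) \<mu> \<kappa>)"

lemma entry_total: "entry (total F) \<mu> \<kappa> = (\<Sum>n\<le>young_size \<kappa>. entry (fps_nth F n) \<mu> \<kappa>)"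
  unfolding total_def by (subst entry_Incidence) (auto intro!: sum.neutral simp: entry_outside)

lemma entry_total_le:
  assumes "\<And>n. raises n (fps_nth F n)" "young_size \<kappa> \<le> N"
  shows "entry (total F) \<mu> \<kappa> = (\<Sum>n\<le>N. entry (fps_nth F n) \<mu> \<kappa>)"
  unfolding entry_total
proof (rule sum.mono_neutral_left)
  show "\<forall>n\<in>{..N} - {..young_size \<kappa>}. entry (fps_nth F n) \<mu> \<kappa> = 0"
    using assms(1) unfolding raises_def by fastforce
qed (use assms in auto)

lemma young_size_mono: "\<mu> \<le> \<kappa> \<Longrightarrow> young_size \<mu> \<le> young_size \<kappa>"
  using card_grown_le by fastforce

text \<open>Multiplying the truncated sums gives a square of index pairs (i, j). Pairs with i + j
  beyond the size of \<kappa> vanish by the filtration, and the remaining triangle is the Cauchy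
  product.\<close>

lemma total_mult:
  assumes F: "\<And>n. raises n (fps_nth F n)" and G: "\<And>n. raises n (fps_nth G n)"
  shows "total (F * G) = total F * total G"
proof (rule incidence_eqI)
  fix \<mu> \<kappa> :: young
  let ?N = "young_size \<kappa>" and ?h = "\<lambda>i j. entry (fps_nth F i * fps_nth G j) \<mu> \<kappa>"
  have "entry (total F * total G) \<mu> \<kappa>
      = (\<Sum>\<nu>\<in>{\<mu>..\<kappa>}. \<Sum>i\<le>?N. \<Sum>j\<le>?N. entry (fps_nth F i) \<mu> \<nu> * entry (fps_nth G j) \<nu> \<kappa>)"
    unfolding entry_mult
  proof (intro sum.cong refl)
    fix \<nu> assume "\<nu> \<in> {\<mu>..\<kappa>}"
    then have "young_size \<nu> \<le> ?N" by (simp add: young_size_mono)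
    show "entry (total F) \<mu> \<nu> * entry (total G) \<nu> \<kappa>
        = (\<Sum>i\<le>?N. \<Sum>j\<le>?N. entry (fps_nth F i) \<mu> \<nu> * entry (fps_nth G j) \<nu> \<kappa>)"
      unfolding entry_total_le[OF F \<open>young_size \<nu> \<le> ?N\<close>] entry_total_le[OF G order_refl]
      by (rule sum_product)
  qed
  also have "\<dots> = (\<Sum>i\<le>?N. \<Sum>j\<le>?N. ?h i j)"
    unfolding entry_mult by (subst sum.swap) (intro sum.cong refl, rule sum.swap)
  also have "\<dots> = (\<Sum>(i, j)\<in>{..?N} \<times> {..?N}. ?h i j)"
    by (simp add: sum.cartesian_product)
  also have "\<dots> = (\<Sum>(i, j)\<in>{(i, j). i + j \<le> ?N}. ?h i j)"
  proof (rule sum.mono_neutral_right)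
    show "\<forall>p\<in>{..?N} \<times> {..?N} - {(i, j). i + j \<le> ?N}. (case p of (i, j) \<Rightarrow> ?h i j) = 0"
      using raises_mult[OF F G] unfolding raises_def by fastforce
  qed auto
  also have "\<dots> = (\<Sum>n\<le>?N. \<Sum>i\<le>n. ?h i (n - i))"
    by (rule sum.triangle_reindex_eq)
  also have "\<dots> = entry (total (F * G)) \<mu> \<kappa>"
    by (simp add: entry_total fps_mult_nth entry_sum atLeast0AtMost)
  finally show "entry (total (F * G)) \<mu> \<kappa> = entry (total F * total G) \<mu> \<kappa>" by simp
qed

definition spec_transfer :: "(nat \<Rightarrow> real) \<Rightarrow> young incidence" where
  "spec_transfer r = total (spec_layers r)"

lemma entry_spec_transfer:
  "entry (spec_transfer r) \<mu> \<kappa> = (\<Sum>n\<le>young_size \<kappa>. entry (newton (log_at r) n) \<mu> \<kappa>)"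
  by (simp add: spec_transfer_def entry_total spec_layers_def)

lemma raises_spec_layers: "raises n (fps_nth (spec_layers r) n)"
  unfolding spec_layers_def theta_exp_nth
  by (rule raises_newton) (simp add: raises_scaleR raises_layer_log)

lemma spec_transfer_add: "spec_transfer (\<lambda>k. r k + s k) = spec_transfer r * spec_transfer s"
  unfolding spec_transfer_def spec_layers_add by (rule total_mult) (rule raises_spec_layers)+

lemma spec_transfer_0: "spec_transfer (\<lambda>_. 0) = 1"
  by (rule incidence_eqI)
    (simp add: spec_transfer_def entry_total spec_layers_0 if_distrib[where f = "\<lambda>f. entry f _ _"] cong: if_cong)

lemma spec_transfer_power: "spec_transfer (\<lambda>k. t ^ k) = transfer t"
  by (rule incidence_eqI)
    (simp add: spec_transfer_def entry_total spec_layers_power entry_transfer_sum[OF order_refl order_refl] mult.commute)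


section \<open>The parameters \<open>\<beta>\<close>\<close>

text \<open>The largest length that column j may have inside \<kappa> once the columns of \<nu> to
  its left are fixed. Equivalently, a box of \<kappa>/\<nu> in column j is leftmost in its row
  exactly when its row index is below this bound; column 0 has no left neighbour.\<close>

fun row_cap :: "young \<Rightarrow> young \<Rightarrow> nat \<Rightarrow> nat" where
  "row_cap \<kappa> \<nu> 0 = parts \<kappa> 0"
| "row_cap \<kappa> \<nu> (Suc j) = min (parts \<nu> j) (parts \<kappa> (Suc j))"

text \<open>
  The exponent of \<open>b\<close> is the number of nonempty rows of \<open>\<kappa>/\<nu>\<close>, each counted at its leftmost box.
\<close>

definition row_transfer :: "real \<Rightarrow> young incidence" where
  "row_transfer b = Incidence (\<lambda>\<nu> \<kappa>. if \<nu> \<le> \<kappa> then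
     (\<Prod>j | parts \<kappa> j \<noteq> 0. b ^ (row_cap \<kappa> \<nu> j - parts \<nu> j)) else 0)"

lemma entry_row_transfer:
  "entry (row_transfer b) \<nu> \<kappa> = (if \<nu> \<le> \<kappa> then
     (\<Prod>j | parts \<kappa> j \<noteq> 0. b ^ (row_cap \<kappa> \<nu> j - parts \<nu> j)) else 0)"
  unfolding row_transfer_def by (subst entry_Incidence) auto

lemma row_cap_le: "row_cap \<kappa> \<nu> j \<le> parts \<kappa> j"
  by (cases j) auto

lemma row_cap_le_parts: "i < j \<Longrightarrow> row_cap \<kappa> \<nu> j \<le> parts \<nu> i"
  by (cases j) (simp_all add: min.coboundedI1 parts_antimono)

lemma parts_le_row_cap: "\<nu> \<le> \<kappa> \<Longrightarrow> parts \<nu> j \<le> row_cap \<kappa> \<nu> j"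
  by (cases j) (auto simp: young_le_iff intro: parts_antimono)

lemma row_cap_cong: "(\<And>i. i < j \<Longrightarrow> parts \<nu> i = parts \<nu>' i) \<Longrightarrow> row_cap \<kappa> \<nu> j = row_cap \<kappa> \<nu>' j"
  by (cases j) auto

text \<open>A truncated geometric distribution: descend from M, stopping with probability 1 - b at
  each value above m and surely at m. It is a polynomial identity, so it also covers b > 1, where
  the weights are no probabilities.\<close>

lemma sum_walk_weight:
  fixes b :: real
  assumes "m \<le> M"
  shows "(\<Sum>a\<in>{m..M}. (if m < a then 1 - b else 1) * b ^ (M - a)) = 1"
  using assms
proof (induction M rule: dec_induct)
  case (step k)
  have "{m..Suc k} = insert (Suc k) {m..k}" using step by auto
  moreover have "(\<Sum>a\<in>{m..k}. (if m < a then 1 - b else 1) * b ^ (Suc k - a))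
      = b * (\<Sum>a\<in>{m..k}. (if m < a then 1 - b else 1) * b ^ (k - a))"
    unfolding sum_distrib_left by (intro sum.cong refl) (simp add: Suc_diff_le)
  ultimately show ?case
    using step by simp
qed simp

text \<open>
  The left side is a total probability: walk along the boundary of \<open>\<nu>\<close> from the south-west, going
  up with probability \<open>b\<close> and right with probability \<open>1 - b\<close> unless a step is forced by
  \<open>\<mu>\<close> or \<open>\<kappa>\<close>.
\<close>

lemma transfer_row_transfer: "transfer (1 - b) * row_transfer b = transfer 1"
proof (rule incidence_eqI)
  fix \<mu> \<kappa> :: young assume le: "\<mu> \<le> \<kappa>"
  \<comment> \<open>Columns are released from left to right: in S n the columns from n on are still
    those of \<mu>, and W n collects the weights of the columns already chosen.\<close>
  define S where "S n = {\<nu>. \<mu> \<le> \<nu> \<and> \<nu> \<le> \<kappa> \<and> (\<forall>j\<ge>n. parts \<nu> j = parts \<mu> j)}" for n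
  define w where "w \<nu> j a = (if parts \<mu> j < a then 1 - b else 1) * b ^ (row_cap \<kappa> \<nu> j - a)" for \<nu> j a
  define W where "W n \<nu> = (\<Prod>j<n. w \<nu> j (parts \<nu> j))" for n \<nu>
  have fin: "finite (S n)" for n
    by (rule finite_subset[of _ "{\<mu>..\<kappa>}"]) (auto simp: S_def)
  have S0: "S 0 = {\<mu>}" using le by (auto simp: S_def intro: young_eqI)
  have sum1: "(\<Sum>\<nu>\<in>S n. W n \<nu>) = 1" for n
  proof (induction n)
    case (Suc n)
    define f where "f = (\<lambda>(\<sigma>, a). set_part \<sigma> n a)"
    \<comment> \<open>Releasing column n lets it take any length from that in \<mu> up to the cap.
      The lower bound also keeps it above the unreleased column n + 1. The weights over this range
      sum to 1, so the total stays 1.\<close>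
    let ?I = "SIGMA \<sigma>:S n. {parts \<mu> n..row_cap \<kappa> \<sigma> n}"
    have pf: "parts (set_part \<sigma> n a) = (parts \<sigma>)(n := a)"
      if "\<sigma> \<in> S n" "parts \<mu> n \<le> a" "a \<le> row_cap \<kappa> \<sigma> n" for \<sigma> a
    proof (rule parts_set_part)
      have "parts \<sigma> (Suc n) = parts \<mu> (Suc n)" using that(1) by (simp add: S_def)
      then show "parts \<sigma> (Suc n) \<le> a" using parts_antimono[of n "Suc n" \<mu>] that(2) by simp
      show "a \<le> parts \<sigma> j" if "j < n" for j
        using row_cap_le_parts[OF that] \<open>a \<le> row_cap \<kappa> \<sigma> n\<close> by (rule order_trans[rotated])
    qed
    have "bij_betw f ?I (S (Suc n))"
    proof (rule bij_betw_byWitness[where f' = "\<lambda>\<nu>. (set_part \<nu> n (parts \<mu> n), parts \<nu> n)"])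
      have rst: "parts (set_part \<nu> n (parts \<mu> n)) = (parts \<nu>)(n := parts \<mu> n)" if "\<nu> \<in> S (Suc n)" for \<nu>
      proof (rule parts_set_part)
        have "parts \<nu> (Suc n) = parts \<mu> (Suc n)" using that by (simp add: S_def)
        then show "parts \<nu> (Suc n) \<le> parts \<mu> n" using parts_antimono[of n "Suc n" \<mu>] by simp
        show "parts \<mu> n \<le> parts \<nu> j" if "j < n" for j
          using parts_antimono[of j n \<mu>] that \<open>\<nu> \<in> S (Suc n)\<close> unfolding S_def young_le_iff
          by (auto intro: order_trans)
      qed
      show "\<forall>p\<in>?I. (set_part (f p) n (parts \<mu> n), parts (f p) n) = p"
      proof
        fix p assume "p \<in> ?I"
        then obtain \<sigma> a where p': "p = (\<sigma>, a)"
          and \<sigma>: "\<sigma> \<in> S n" "a \<in> {parts \<mu> n..row_cap \<kappa> \<sigma> n}" by blast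
        then have p: "parts (f (\<sigma>, a)) = (parts \<sigma>)(n := a)" by (simp add: f_def pf)
        have "parts \<sigma> n = parts \<mu> n" using \<sigma> by (simp add: S_def)
        then have "(parts (f (\<sigma>, a)))(n := parts \<mu> n) = parts \<sigma>" unfolding p by auto
        then have "set_part (f (\<sigma>, a)) n (parts \<mu> n) = \<sigma>"
          by (simp add: set_part_def parts_inverse)
        then show "(set_part (f p) n (parts \<mu> n), parts (f p) n) = p" by (simp add: p p')
      qed
      show "\<forall>\<nu>\<in>S (Suc n). f (set_part \<nu> n (parts \<mu> n), parts \<nu> n) = \<nu>"
        by (simp add: f_def set_part_def[of "set_part _ _ _"] rst parts_inverse)
      show "f ` ?I \<subseteq> S (Suc n)"
      proof clarify
        fix \<sigma> a assume \<sigma>: "\<sigma> \<in> S n" "a \<in> {parts \<mu> n..row_cap \<kappa> \<sigma> n}"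
        then have p: "parts (f (\<sigma>, a)) = (parts \<sigma>)(n := a)" by (simp add: f_def pf)
        have "a \<le> parts \<kappa> n" using \<sigma>(2) row_cap_le[of \<kappa> \<sigma> n] by simp
        then show "f (\<sigma>, a) \<in> S (Suc n)"
          using \<sigma> by (auto simp: S_def young_le_iff p)
      qed
      show "(\<lambda>\<nu>. (set_part \<nu> n (parts \<mu> n), parts \<nu> n)) ` S (Suc n) \<subseteq> ?I"
      proof (rule image_subsetI)
        fix \<nu> assume \<nu>: "\<nu> \<in> S (Suc n)"
        have "set_part \<nu> n (parts \<mu> n) \<in> S n"
          using \<nu> le by (auto simp: S_def young_le_iff rst[OF \<nu>])
        moreover have "row_cap \<kappa> (set_part \<nu> n (parts \<mu> n)) n = row_cap \<kappa> \<nu> n"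
          by (rule row_cap_cong) (simp add: rst[OF \<nu>])
        moreover have "parts \<nu> n \<le> row_cap \<kappa> \<nu> n"
          using \<nu> by (intro parts_le_row_cap) (simp add: S_def)
        moreover have "parts \<mu> n \<le> parts \<nu> n" using \<nu> by (simp add: S_def young_le_iff)
        ultimately show "(set_part \<nu> n (parts \<mu> n), parts \<nu> n) \<in> ?I" by simp
      qed
    qed
    then have "(\<Sum>\<nu>\<in>S (Suc n). W (Suc n) \<nu>) = (\<Sum>p\<in>?I. W (Suc n) (f p))"
      by (simp add: sum.reindex_bij_betw)
    also have "\<dots> = (\<Sum>(\<sigma>, a)\<in>?I. W n \<sigma> * w \<sigma> n a)"
    proof (intro sum.cong refl, clarify)
      fix \<sigma> a assume \<sigma>: "\<sigma> \<in> S n" "a \<in> {parts \<mu> n..row_cap \<kappa> \<sigma> n}"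
      then have p: "parts (f (\<sigma>, a)) = (parts \<sigma>)(n := a)" by (simp add: f_def pf)
      have cap: "row_cap \<kappa> (f (\<sigma>, a)) j = row_cap \<kappa> \<sigma> j" if "j \<le> n" for j
        using that by (intro row_cap_cong) (simp add: p)
      show "W (Suc n) (f (\<sigma>, a)) = W n \<sigma> * w \<sigma> n a"
        by (simp add: W_def w_def p cap)
    qed
    also have "\<dots> = (\<Sum>\<sigma>\<in>S n. \<Sum>a\<in>{parts \<mu> n..row_cap \<kappa> \<sigma> n}. W n \<sigma> * w \<sigma> n a)"
      using fin by (simp add: sum.Sigma)
    also have "\<dots> = (\<Sum>\<sigma>\<in>S n. W n \<sigma>)"
    proof (intro sum.cong refl)
      fix \<sigma> assume "\<sigma> \<in> S n"
      then have "parts \<mu> n \<le> row_cap \<kappa> \<sigma> n"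
        using parts_le_row_cap[of \<sigma> \<kappa> n] by (simp add: S_def)
      then show "(\<Sum>a\<in>{parts \<mu> n..row_cap \<kappa> \<sigma> n}. W n \<sigma> * w \<sigma> n a) = W n \<sigma>"
        by (simp add: sum_distrib_left[symmetric] w_def sum_walk_weight)
    qed
    finally show ?case using Suc by simp
  qed (simp add: S0 W_def)
  obtain n where n: "\<forall>j\<ge>n. parts \<kappa> j = 0" using parts_eventually_0 ..
  have z: "parts \<nu> j = 0" if "\<nu> \<le> \<kappa>" "j \<ge> n" for \<nu> j
    using n that by (metis le_zero_eq young_le_iff)
  have "S n = {\<mu>..\<kappa>}" using z le by (auto simp: S_def)
  have "entry (transfer (1 - b)) \<mu> \<nu> * entry (row_transfer b) \<nu> \<kappa> = W n \<nu>" if \<nu>: "\<nu> \<in> {\<mu>..\<kappa>}" for \<nu>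
  proof -
    have "j < n" if "j \<in> grown \<mu> \<nu>" for j
      using \<nu> z[of \<nu> j] that by (force simp: grown_def not_less[symmetric])
    then have "grown \<mu> \<nu> \<subseteq> {..<n}" by blast
    then have "(1 - b) ^ card (grown \<mu> \<nu>) = (\<Prod>j<n. if parts \<mu> j < parts \<nu> j then 1 - b else 1)"
      by (simp add: prod.If_cases grown_def Int_absorb1 subset_eq Int_commute)
    moreover have "(\<Prod>j | parts \<kappa> j \<noteq> 0. b ^ (row_cap \<kappa> \<nu> j - parts \<nu> j))
        = (\<Prod>j<n. b ^ (row_cap \<kappa> \<nu> j - parts \<nu> j))"
    proof (rule prod.mono_neutral_left)
      show "{j. parts \<kappa> j \<noteq> 0} \<subseteq> {..<n}" using n by (auto simp: not_less[symmetric])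
      show "\<forall>j\<in>{..<n} - {j. parts \<kappa> j \<noteq> 0}. b ^ (row_cap \<kappa> \<nu> j - parts \<nu> j) = 1"
        using row_cap_le[of \<kappa> \<nu>] by (metis DiffD2 diff_is_0_eq le_zero_eq mem_Collect_eq power_0 zero_le)
    qed simp
    ultimately show ?thesis
      using \<nu> by (simp add: entry_transfer entry_row_transfer W_def w_def prod.distrib)
  qed
  then have "entry (transfer (1 - b) * row_transfer b) \<mu> \<kappa> = (\<Sum>\<nu>\<in>S n. W n \<nu>)"
    unfolding entry_mult \<open>S n = {\<mu>..\<kappa>}\<close> by (intro sum.cong refl) simp
  then show "entry (transfer (1 - b) * row_transfer b) \<mu> \<kappa> = entry (transfer 1) \<mu> \<kappa>"
    using le by (simp add: sum1 entry_transfer)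
qed

text \<open>The sequence -(1 - b)^k specializes to the inverse of A(1 - b); applying it to A(1) =
  A(1 - b) times \<open>row_transfer b\<close> leaves the second factor.\<close>

lemma spec_transfer_beta: "spec_transfer (\<lambda>k. 1 - (1 - b) ^ k) = row_transfer b"
proof -
  let ?p = "\<lambda>k. (1 - b) ^ k" and ?m = "\<lambda>k. - ((1 - b) ^ k)"
  have "spec_transfer (\<lambda>k. 1 - (1 - b) ^ k) = spec_transfer ?m * spec_transfer (\<lambda>k. 1 ^ k)"
    unfolding spec_transfer_add[symmetric] by simp
  also have "\<dots> = spec_transfer ?m * spec_transfer ?p * row_transfer b"
    by (simp only: spec_transfer_power transfer_row_transfer mult.assoc)
  also have "spec_transfer ?m * spec_transfer ?p = 1"
    unfolding spec_transfer_add[symmetric] by (simp add: spec_transfer_0)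
  finally show ?thesis by simp
qed

section \<open>The cone of positive specializations\<close>

definition positive_powers :: "(nat \<Rightarrow> real) \<Rightarrow> bool" where
  "positive_powers r \<longleftrightarrow> (\<forall>\<mu> \<kappa>. 0 \<le> entry (spec_transfer r) \<mu> \<kappa>)"

lemma positive_powers_add:
  "positive_powers r \<Longrightarrow> positive_powers s \<Longrightarrow> positive_powers (\<lambda>k. r k + s k)"
  unfolding positive_powers_def spec_transfer_add entry_mult by (simp add: sum_nonneg)

lemma positive_powers_0: "positive_powers (\<lambda>_. 0)"
  by (simp add: positive_powers_def spec_transfer_0 entry_one)

lemma positive_powers_sum:
  "(\<And>i. i \<in> I \<Longrightarrow> positive_powers (r i)) \<Longrightarrow> positive_powers (\<lambda>k. \<Sum>i\<in>I. r i k)"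
  by (induction I rule: infinite_finite_induct) (simp_all add: positive_powers_0 positive_powers_add)

lemma positive_powers_alpha: "a \<ge> 0 \<Longrightarrow> positive_powers (\<lambda>k. a ^ k)"
  by (simp add: positive_powers_def spec_transfer_power entry_transfer)

lemma positive_powers_beta: "b \<ge> 0 \<Longrightarrow> positive_powers (\<lambda>k. 1 - (1 - b) ^ k)"
  by (simp add: positive_powers_def spec_transfer_beta entry_row_transfer prod_nonneg)

text \<open>Newton's recursion and matrix products over finite intervals make every entry a
  polynomial in finitely many r k with k > 0, hence continuous under pointwise convergence.\<close>

lemma positive_powers_limit:
  assumes pos: "\<And>N. positive_powers (r N)" and lim: "\<And>k. k > 0 \<Longrightarrow> (\<lambda>N. r N k) \<longlonglongrightarrow> s k"
  shows "positive_powers s"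
proof -
  have "(\<lambda>N. entry (newton (log_at (r N)) n) \<mu> \<kappa>) \<longlonglongrightarrow> entry (newton (log_at s) n) \<mu> \<kappa>" for n \<mu> \<kappa>
  proof (induction n arbitrary: \<mu> \<kappa> rule: less_induct)
    case (less n)
    show ?case
    proof (cases n)
      case (Suc m)
      then show ?thesis
        unfolding Suc newton.simps scaleR_incidence.rep_eq entry_sum entry_mult log_at_nth
        by (intro tendsto_mult tendsto_const tendsto_sum less lim) (simp_all add: Suc)
    qed simp
  qed
  then have "(\<lambda>N. entry (spec_transfer (r N)) \<mu> \<kappa>) \<longlonglongrightarrow> entry (spec_transfer s) \<mu> \<kappa>" for \<mu> \<kappa>
    unfolding entry_spec_transfer by (intro tendsto_sum)
  then show ?thesis
    using pos unfolding positive_powers_def by (blast intro: LIMSEQ_le_const)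
qed

text \<open>Splitting c into N + 1 equal parameters \<alpha> keeps the first power sum equal to c
  and sends all higher ones to 0.\<close>

lemma positive_powers_gamma:
  assumes "c \<ge> 0"
  shows "positive_powers (\<lambda>k. if k = 1 then c else 0)"
proof (rule positive_powers_limit)
  fix N
  show "positive_powers (\<lambda>k. \<Sum>i<Suc N. (c / real (Suc N)) ^ k)"
    using assms by (intro positive_powers_sum positive_powers_alpha) simp
next
  fix k :: nat assume "k > 0"
  then obtain m where m: "k = Suc m" by (cases k) auto
  \<comment> \<open>Here m = k - 1, so 0^m separates k = 1, where it is 1, from all larger
    k.\<close>
  have "(\<lambda>N. c * (c / real (Suc N)) ^ m) \<longlonglongrightarrow> c * 0 ^ m"
    by (intro tendsto_intros LIMSEQ_Suc[OF lim_const_over_n])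
  then show "(\<lambda>N. \<Sum>i<Suc N. (c / real (Suc N)) ^ k) \<longlonglongrightarrow> (if k = 1 then c else 0)"
    by (simp add: m del: of_nat_Suc) (cases m, simp_all)
qed

text \<open>N + 1 parameters \<beta> = d / (N + 1): since 1 - (1 - t)^k is t times the sum of (1 -
  t)^i over i < k, the total is d times a sum of k terms, each tending to 1.\<close>

lemma positive_powers_delta:
  assumes "d \<ge> 0"
  shows "positive_powers (\<lambda>k. d * real k)"
proof (rule positive_powers_limit)
  fix N
  show "positive_powers (\<lambda>k. \<Sum>i<Suc N. 1 - (1 - d / real (Suc N)) ^ k)"
    using assms by (intro positive_powers_sum positive_powers_beta) simp
next
  fix k :: nat
  have "(\<lambda>N. d * (\<Sum>i<k. (1 - d / real (Suc N)) ^ i)) \<longlonglongrightarrow> d * (\<Sum>i<k. (1 - 0) ^ i)"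
    by (intro tendsto_intros LIMSEQ_Suc[OF lim_const_over_n])
  moreover have "(\<Sum>i<Suc N. 1 - (1 - d / real (Suc N)) ^ k) = d * (\<Sum>i<k. (1 - d / real (Suc N)) ^ i)" for N
  proof -
    have "1 - (1 - d / real (Suc N)) ^ k = (d / real (Suc N)) * (\<Sum>i<k. (1 - d / real (Suc N)) ^ i)"
      using one_diff_power_eq[of "1 - d / real (Suc N)" k] by simp
    then show ?thesis by (simp del: of_nat_Suc)
  qed
  ultimately show "(\<lambda>N. \<Sum>i<Suc N. 1 - (1 - d / real (Suc N)) ^ k) \<longlonglongrightarrow> d * real k"
    by simp
qed

section \<open>Power sums of the generating function\<close>

text \<open>The constant term is set to 0, as \<open>theta_exp\<close> requires, although sequences
  such as a^k have the value 1 at k = 0.\<close>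

definition power_fps :: "(nat \<Rightarrow> real) \<Rightarrow> 'a::real_algebra_1 fps" where
  "power_fps r = Abs_fps (\<lambda>k. if k = 0 then 0 else of_real (r k))"

lemma power_fps_nth: "fps_nth (power_fps r) k = (if k = 0 then 0 else of_real (r k))"
  by (simp add: power_fps_def)

lemma newton_power_fps_of_real:
  "newton (power_fps r :: complex fps) n = of_real (newton (power_fps r) n)"
proof (induction n rule: less_induct)
  case (less n)
  show ?case
  proof (cases n)
    case (Suc m)
    have "newton (power_fps r :: complex fps) (m - k) = of_real (newton (power_fps r) (m - k))" for k
      using less Suc by simp
    then show ?thesis
      by (simp add: Suc power_fps_nth scaleR_conv_of_real del: of_nat_Suc)
  qed simp
qed

lemma power_fps_0: "power_fps (\<lambda>_. 0) = 0"
  by (simp add: fps_eq_iff power_fps_nth)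

lemma theta_exp_power_fps_add:
  "theta_exp (power_fps (\<lambda>k. r k + s k)) = theta_exp (power_fps r) * theta_exp (power_fps s :: complex fps)"
proof -
  have "power_fps (\<lambda>k. r k + s k) = power_fps r + (power_fps s :: complex fps)"
    by (simp add: fps_eq_iff power_fps_nth)
  then show ?thesis by (simp add: theta_exp_add power_fps_nth mult.commute)
qed

lemma theta_exp_power_fps_sum:
  "theta_exp (power_fps (\<lambda>k. \<Sum>i\<in>I. r i k)) = (\<Prod>i\<in>I. theta_exp (power_fps (r i)) :: complex fps)"
proof (induction I rule: infinite_finite_induct)
  case (insert i I)
  then show ?case by (simp add: theta_exp_power_fps_add)
qed (simp_all add: power_fps_0)

lemma theta_exp_geometric: "theta_exp (power_fps (\<lambda>k. a ^ k)) = Abs_fps (\<lambda>n. of_real a ^ n :: complex)"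
proof (rule theta_exp_unique[symmetric])
  show "fps_theta (Abs_fps (\<lambda>n. of_real a ^ n)) = power_fps (\<lambda>k. a ^ k) * Abs_fps (\<lambda>n. of_real a ^ n :: complex)"
  proof (rule fps_ext)
    fix n
    show "fps_nth (fps_theta (Abs_fps (\<lambda>n. of_real a ^ n))) n
        = fps_nth (power_fps (\<lambda>k. a ^ k) * Abs_fps (\<lambda>n. of_real a ^ n :: complex)) n"
    proof (cases n)
      case (Suc m)
      have "(\<Sum>k\<le>m. of_real a ^ Suc k * of_real a ^ (m - k)) = (\<Sum>k\<le>m. of_real a ^ Suc m :: complex)"
        by (intro sum.cong refl) (simp flip: power_add)
      then show ?thesis
        by (simp add: Suc fps_mult_nth_Suc power_fps_nth scaleR_conv_of_real)
    qed (simp add: power_fps_nth)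
  qed
qed (simp_all add: power_fps_nth)

lemma has_fps_expansion_alpha:
  "(\<lambda>z. 1 / (1 - of_real a * z)) has_fps_expansion (theta_exp (power_fps (\<lambda>k. a ^ k)) :: complex fps)"
  unfolding theta_exp_geometric
proof (rule has_fps_expansionI)
  have "((\<lambda>z. norm (of_real a * z :: complex)) \<longlongrightarrow> norm (of_real a * 0 :: complex)) (nhds 0)"
    by (intro tendsto_intros filterlim_ident)
  then have "eventually (\<lambda>z. norm (of_real a * z :: complex) < 1) (nhds 0)"
    by (rule order_tendstoD) simp
  then show "eventually (\<lambda>z. (\<lambda>n. fps_nth (Abs_fps (\<lambda>n. of_real a ^ n)) n * z ^ n) sums
      (1 / (1 - of_real a * z :: complex))) (nhds 0)"
  proof eventually_elim
    case (elim z)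
    then show ?case using geometric_sums[of "of_real a * z"] by (simp add: power_mult_distrib)
  qed
qed

text \<open>The function equals (1 - tz)/(1 - z) with t = 1 - b. Its expansion follows from two
  geometric series, because multiplying by the one for t must give the one for 1.\<close>

lemma has_fps_expansion_beta:
  "(\<lambda>z. 1 + of_real b * z / (1 - z)) has_fps_expansion
    (theta_exp (power_fps (\<lambda>k. 1 - (1 - b) ^ k)) :: complex fps)"
proof -
  let ?E = "\<lambda>r. theta_exp (power_fps r) :: complex fps" and ?t = "complex_of_real (1 - b)"
  have lin: "(1 - fps_const ?t * fps_X) * Abs_fps (\<lambda>n. ?t ^ n) = 1"
  proof (rule fps_ext)
    fix n
    show "fps_nth ((1 - fps_const ?t * fps_X) * Abs_fps (\<lambda>n. ?t ^ n)) n = fps_nth 1 n"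
      by (cases n) (simp_all add: left_diff_distrib mult.assoc)
  qed
  have "?E (\<lambda>k. 1 - (1 - b) ^ k) * ?E (\<lambda>k. (1 - b) ^ k) = ?E (\<lambda>k. 1 ^ k)"
    unfolding theta_exp_power_fps_add[symmetric] by simp
  then have "?E (\<lambda>k. 1 - (1 - b) ^ k) * (Abs_fps (\<lambda>n. ?t ^ n) * (1 - fps_const ?t * fps_X))
      = ?E (\<lambda>k. 1 ^ k) * (1 - fps_const ?t * fps_X)"
    unfolding theta_exp_geometric mult.assoc[symmetric] by simp
  then have E: "?E (\<lambda>k. 1 - (1 - b) ^ k) = ?E (\<lambda>k. 1 ^ k) * (1 - fps_const ?t * fps_X)"
    unfolding mult.commute[of "Abs_fps _" "1 - _"] lin by simp
  have 1: "(\<lambda>z. 1 / (1 - of_real 1 * z) * (1 - ?t * z)) has_fps_expansion ?E (\<lambda>k. 1 - (1 - b) ^ k)"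
    unfolding E by (intro has_fps_expansion_mult has_fps_expansion_alpha fps_expansion_intros)
  have "eventually (\<lambda>z :: complex. z \<noteq> 1) (nhds 0)"
    by (rule t1_space_nhds) simp
  then have "eventually (\<lambda>z. 1 / (1 - of_real 1 * z) * (1 - ?t * z) = 1 + of_real b * z / (1 - z)) (nhds 0)"
    by eventually_elim (simp add: field_simps)
  from iffD1[OF has_fps_expansion_cong[OF this refl] 1] show ?thesis .
qed

text \<open>The exponent g satisfies z g'(z) = cz + dz/(1 - z)^2, whose coefficients are the claimed
  power sums. An expansion F of exp g exists by analyticity and is identified through F' = g' F and
  F(0) = 1.\<close>

lemma has_fps_expansion_gamma_delta:
  "(\<lambda>z. exp (of_real c * z + of_real d * z / (1 - z))) has_fps_expansion
    (theta_exp (power_fps (\<lambda>k. (if k = 1 then c else 0) + d * real k)) :: complex fps)"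
proof -
  let ?g = "\<lambda>z :: complex. of_real c * z + of_real d * z / (1 - z)"
  let ?f = "\<lambda>z. exp (?g z)"
  define G :: "complex fps" where
    "G = fps_const (of_real c) * fps_X + fps_const (of_real d) * fps_X * theta_exp (power_fps (\<lambda>k. 1 ^ k))"
  have "(\<lambda>z. of_real c * z + of_real d * z * (1 / (1 - of_real 1 * z))) has_fps_expansion G"
    unfolding G_def by (intro fps_expansion_intros has_fps_expansion_alpha)
  then have g: "?g has_fps_expansion G" by simp
  have "?f analytic_on {0}"
    by (intro analytic_intros) auto
  then obtain F where F: "?f has_fps_expansion F"
    using analytic_at_imp_has_fps_expansion_0 by blast
  have 1: "deriv ?f has_fps_expansion fps_deriv F" by (intro has_fps_expansion_deriv F)
  have 2: "(\<lambda>z. deriv ?g z * ?f z) has_fps_expansion fps_deriv G * F"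
    by (intro has_fps_expansion_mult has_fps_expansion_deriv g F)
  have "eventually (\<lambda>z :: complex. z \<noteq> 1) (nhds 0)"
    by (rule t1_space_nhds) simp
  then have "eventually (\<lambda>z. deriv ?f z = deriv ?g z * ?f z) (nhds 0)"
  proof eventually_elim
    case (elim z)
    then have "?g field_differentiable at z"
      by (intro derivative_intros field_differentiable_divide) auto
    then have "(?g has_field_derivative deriv ?g z) (at z)"
      by (simp add: field_differentiable_derivI)
    then show "deriv ?f z = deriv ?g z * ?f z"
      by (intro DERIV_imp_deriv) (rule DERIV_chain2[OF DERIV_exp, THEN DERIV_cong], assumption, simp)
  qed
  from iffD1[OF has_fps_expansion_cong[OF this refl] 1] have "fps_deriv F = fps_deriv G * F"
    using 2 by (rule fps_expansion_unique_complex)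
  have theta: "fps_theta H = fps_X * fps_deriv H" for H :: "complex fps"
  proof (rule fps_ext)
    fix n show "fps_nth (fps_theta H) n = fps_nth (fps_X * fps_deriv H) n"
      by (cases n) (simp_all add: scaleR_conv_of_real)
  qed
  have "fps_theta G = power_fps (\<lambda>k. (if k = 1 then c else 0) + d * real k)"
  proof (rule fps_ext)
    fix n
    show "fps_nth (fps_theta G) n = fps_nth (power_fps (\<lambda>k. (if k = 1 then c else 0) + d * real k)) n"
      unfolding G_def theta_exp_geometric
      by (cases n) (auto simp: power_fps_nth scaleR_conv_of_real mult.assoc)
  qed
  then have "F = theta_exp (power_fps (\<lambda>k. (if k = 1 then c else 0) + d * real k))"
    using \<open>fps_deriv F = fps_deriv G * F\<close> F
    by (intro theta_exp_unique) (auto simp: power_fps_nth theta mult.assoc has_fps_expansion_imp_0_eq_fps_nth_0[symmetric])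
  then show ?thesis using F by simp
qed

text \<open>The summable majorant makes the partial products converge uniformly on the disc. Uniform
  limits of holomorphic functions carry all derivatives at 0 along, hence the Taylor
  coefficients.\<close>

lemma prodinf_coefficients:
  fixes f :: "nat \<Rightarrow> complex \<Rightarrow> complex"
  assumes R: "R > 0"
    and holo: "\<And>n. f n holomorphic_on cball 0 R"
    and bound: "\<And>n z. z \<in> cball 0 R \<Longrightarrow> norm (f n z - 1) \<le> M n"
    and M: "summable M"
    and exp: "\<And>n. f n has_fps_expansion F n"
  obtains P where "(\<lambda>z. prodinf (\<lambda>n. f n z)) has_fps_expansion P"
    and "\<And>k. (\<lambda>N. fps_nth (\<Prod>n<N. F n) k) \<longlonglongrightarrow> fps_nth P k"
proof -
  let ?p = "\<lambda>N z. \<Prod>n<N. f n z" and ?q = "\<lambda>z. prodinf (\<lambda>n. f n z)"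
  have "uniformly_convergent_on (cball 0 R) (\<lambda>N z. \<Sum>n<N. norm (f n z - 1))"
    using bound M by (intro Weierstrass_m_test') auto
  then have "uniformly_convergent_on (cball 0 R) ?p"
    using holo by (intro uniformly_convergent_on_prod' holomorphic_on_imp_continuous_on) auto
  then obtain l where l: "uniform_limit (cball 0 R) ?p l sequentially"
    by (auto simp: uniformly_convergent_on_def)
  have lq: "l z = ?q z" if z: "z \<in> cball 0 R" for z
  proof -
    have "summable (\<lambda>n. norm (f n z - 1))"
      using bound[OF z] by (intro summable_comparison_test[OF _ M]) auto
    then have "convergent_prod (\<lambda>n. f n z)"
      by (intro abs_convergent_prod_imp_convergent_prod summable_imp_abs_convergent_prod)
    then have "(\<lambda>N. \<Prod>n\<le>N. f n z) \<longlonglongrightarrow> ?q z"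
      by (rule convergent_prod_LIMSEQ)
    moreover have "(\<lambda>N. ?p (Suc N) z) \<longlonglongrightarrow> l z"
      using tendsto_uniform_limitI[OF l z] by (rule LIMSEQ_Suc)
    ultimately show ?thesis
      by (simp add: lessThan_Suc_atMost LIMSEQ_unique)
  qed
  have "uniform_limit (cball 0 R) ?p l sequentially \<longleftrightarrow> uniform_limit (cball 0 R) ?p ?q sequentially"
    by (rule uniform_limit_cong') (simp_all only: lq)
  then have "uniform_limit (cball 0 R) ?p ?q sequentially"
    using l by (simp only:)
  then have lim: "uniform_limit (ball 0 R) ?p ?q sequentially"
    by (rule uniform_limit_on_subset) auto
  have holo_p: "?p N holomorphic_on ball 0 R" for N
    by (intro holomorphic_on_prod holomorphic_on_subset[OF holo] ball_subset_cball)
  have "?q holomorphic_on ball 0 R"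
  proof (rule holomorphic_uniform_sequence[of _ ?p])
    show "\<exists>d>0. cball x d \<subseteq> ball 0 R \<and> uniform_limit (cball x d) ?p ?q sequentially"
      if x: "x \<in> ball 0 R" for x
    proof -
      obtain d where "d > 0" "cball x d \<subseteq> ball 0 R"
        using x open_contains_cball[of "ball 0 R"] open_ball[of 0 R] by blast
      then show ?thesis using uniform_limit_on_subset[OF lim] by blast
    qed
  qed (simp_all add: holo_p)
  then have q: "?q has_fps_expansion fps_expansion ?q 0"
    using R by (intro has_fps_expansion_fps_expansion[of "ball 0 R"]) auto
  have L: "(\<lambda>N. (deriv ^^ k) (?p N) 0 / fact k) \<longlonglongrightarrow> (deriv ^^ k) ?q 0 / fact k" for k
    using R holo_p
    by (intro tendsto_divide tendsto_const higher_deriv_complex_uniform_limit[OF lim]) auto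
  have p: "?p N has_fps_expansion (\<Prod>n<N. F n)" for N
    by (intro has_fps_expansion_prod exp)
  have "(\<lambda>N. fps_nth (\<Prod>n<N. F n) k) \<longlonglongrightarrow> fps_nth (fps_expansion ?q 0) k" for k
    unfolding fps_nth_fps_expansion[OF p] fps_nth_fps_expansion[OF q] by (rule L)
  then show ?thesis using q that by blast
qed

text \<open>Newton's recursion solved for the last C_k: convergence of the complete symmetric values
  forces that of the power sums.\<close>

lemma newton_tendsto_imp:
  fixes C :: "nat \<Rightarrow> 'a::{real_normed_algebra_1} fps"
  assumes "\<And>n. (\<lambda>N. newton (C N) n) \<longlonglongrightarrow> newton D n" "k > 0"
  shows "(\<lambda>N. fps_nth (C N) k) \<longlonglongrightarrow> fps_nth D k"
  using assms(2)
proof (induction k rule: less_induct)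
  case (less k)
  then obtain m where k: "k = Suc m" by (cases k) auto
  have eq: "fps_nth E (Suc m) = real (Suc m) *\<^sub>R newton E (Suc m) - (\<Sum>i<m. fps_nth E (Suc i) * newton E (m - i))"
    for E :: "'a fps"
    by (simp add: lessThan_Suc_atMost[symmetric] del: of_nat_Suc)
  show ?case
    unfolding k eq using less.IH unfolding k
    by (intro tendsto_intros assms(1)) auto
qed

text \<open>The infinite products enter only as limits: the coefficients of the generating function
  with N factors of each kind converge to those of the full one, and inverting Newton's recursion
  transfers this to power sums.\<close>

lemma power_sums_of_generating_function:
  fixes \<alpha> \<beta> r :: "nat \<Rightarrow> real" and \<gamma> \<delta> :: real
  assumes "\<And>n. \<alpha> n \<ge> 0" and "\<And>n. \<beta> n \<ge> 0"
    and summable: "summable (\<lambda>n. \<alpha> n + \<beta> n)"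
    and gen: "\<forall>\<^sub>F z :: complex in nhds 0.
           summable (\<lambda>n. of_real (newton (power_fps r) (Suc n)) * z ^ Suc n) \<and>
           1 + suminf (\<lambda>n. of_real (newton (power_fps r) (Suc n)) * z ^ Suc n) =
             exp (of_real \<gamma> * z + of_real \<delta> * z / (1 - z))
             * prodinf (\<lambda>n. 1 / (1 - of_real (\<alpha> n) * z))
             * prodinf (\<lambda>n. 1 + of_real (\<beta> n) * z / (1 - z))"
    and k: "k > 0"
  shows "(\<lambda>N. ((if k = 1 then \<gamma> else 0) + \<delta> * real k)
      + (\<Sum>n<N. \<alpha> n ^ k) + (\<Sum>n<N. 1 - (1 - \<beta> n) ^ k)) \<longlonglongrightarrow> r k"
proof -
  define S where "S = suminf (\<lambda>n. \<alpha> n + \<beta> n)"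
  have \<alpha>: "summable \<alpha>" and \<beta>: "summable \<beta>"
    using assms(1,2) by (auto intro!: summable_comparison_test[OF _ summable] exI[of _ 0])
  have \<alpha>S: "\<alpha> n \<le> S" for n
  proof -
    have "\<alpha> n \<le> (\<Sum>i\<in>{n}. \<alpha> i + \<beta> i)" using assms(2) by simp
    also have "\<dots> \<le> S" unfolding S_def using assms(1,2) summable by (intro sum_le_suminf) (auto simp: add_nonneg_nonneg)
    finally show ?thesis .
  qed
  then have S: "S \<ge> 0" using assms(1) order_trans by blast
  \<comment> \<open>On this disc |z| and all |\<alpha> n z| are at most 1/2, which keeps every
    denominator at distance at least 1/2 from 0, uniformly in n.\<close>
  define R where "R = 1 / (2 * (1 + S))"
  have R: "R > 0" "R \<le> 1 / 2" using S by (auto simp: R_def field_simps)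
  have \<alpha>z: "norm (of_real (\<alpha> n) * z) \<le> \<alpha> n * R" "\<alpha> n * R \<le> 1 / 2" if "z \<in> cball 0 R" for n and z :: complex
  proof -
    show "norm (of_real (\<alpha> n) * z) \<le> \<alpha> n * R"
      using that assms(1)[of n] by (simp add: norm_mult mult_left_mono)
    have "\<alpha> n * R \<le> (1 + S) * R" using \<alpha>S[of n] R by (intro mult_right_mono) auto
    also have "(1 + S) * R = 1 / 2"
      using S by (simp add: R_def)
    finally show "\<alpha> n * R \<le> 1 / 2" .
  qed
  have \<alpha>1: "norm (1 - of_real (\<alpha> n) * z) \<ge> 1 / 2" if "z \<in> cball 0 R" for n and z :: complex
    using \<alpha>z[OF that, of n] norm_triangle_ineq2[of 1 "of_real (\<alpha> n) * z"] by simp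
  have \<beta>1: "norm (1 - z) \<ge> 1 / 2" if "z \<in> cball 0 R" for z :: complex
    using that R norm_triangle_ineq2[of 1 z] by simp
  have \<alpha>0: "1 - of_real (\<alpha> n) * z \<noteq> 0" if "z \<in> cball 0 R" for n and z :: complex
    using \<alpha>1[OF that, of n] by auto
  have \<beta>0: "1 - z \<noteq> 0" if "z \<in> cball 0 R" for z :: complex
    using \<beta>1[OF that] by auto
  let ?A = "\<lambda>n. theta_exp (power_fps (\<lambda>k. \<alpha> n ^ k)) :: complex fps"
  let ?B = "\<lambda>n. theta_exp (power_fps (\<lambda>k. 1 - (1 - \<beta> n) ^ k)) :: complex fps"
  let ?E = "theta_exp (power_fps (\<lambda>k. (if k = 1 then \<gamma> else 0) + \<delta> * real k)) :: complex fps"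
  obtain P where P: "(\<lambda>z. prodinf (\<lambda>n. 1 / (1 - of_real (\<alpha> n) * z))) has_fps_expansion P"
    "\<And>k. (\<lambda>N. fps_nth (\<Prod>n<N. ?A n) k) \<longlonglongrightarrow> fps_nth P k"
  proof (rule prodinf_coefficients[OF R(1) _ _ \<alpha> has_fps_expansion_alpha])
    fix n
    show "(\<lambda>z. 1 / (1 - of_real (\<alpha> n) * z)) holomorphic_on cball 0 R"
      by (intro holomorphic_intros \<alpha>0)
    fix z :: complex assume z: "z \<in> cball 0 R"
    have "1 / (1 - of_real (\<alpha> n) * z) - 1 = of_real (\<alpha> n) * z / (1 - of_real (\<alpha> n) * z)"
      using \<alpha>0[OF z] by (simp add: field_simps)
    then have "norm (1 / (1 - of_real (\<alpha> n) * z) - 1) = norm (of_real (\<alpha> n) * z) / norm (1 - of_real (\<alpha> n) * z)"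
      by (simp add: norm_divide)
    also have "\<dots> \<le> (\<alpha> n * R) / (1 / 2)"
      using \<alpha>z[OF z, of n] \<alpha>1[OF z, of n] assms(1)[of n] R by (intro frac_le) auto
    also have "\<dots> \<le> \<alpha> n" using R assms(1)[of n] mult_left_mono[of R "1/2" "\<alpha> n"] by simp
    finally show "norm (1 / (1 - of_real (\<alpha> n) * z) - 1) \<le> \<alpha> n" .
  qed (rule that)
  obtain Q where Q: "(\<lambda>z. prodinf (\<lambda>n. 1 + of_real (\<beta> n) * z / (1 - z))) has_fps_expansion Q"
    "\<And>k. (\<lambda>N. fps_nth (\<Prod>n<N. ?B n) k) \<longlonglongrightarrow> fps_nth Q k"
  proof (rule prodinf_coefficients[OF R(1) _ _ \<beta> has_fps_expansion_beta])
    fix n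
    show "(\<lambda>z. 1 + of_real (\<beta> n) * z / (1 - z)) holomorphic_on cball 0 R"
      by (intro holomorphic_intros \<beta>0)
    fix z :: complex assume z: "z \<in> cball 0 R"
    have "norm (of_real (\<beta> n) * z / (1 - z)) = \<beta> n * norm z / norm (1 - z)"
      using assms(2)[of n] by (simp add: norm_divide norm_mult)
    also have "\<dots> \<le> (\<beta> n * (1 / 2)) / (1 / 2)"
      using z R \<beta>1[OF z] assms(2)[of n] by (intro frac_le mult_left_mono mult_nonneg_nonneg) auto
    finally show "norm (1 + of_real (\<beta> n) * z / (1 - z) - 1) \<le> \<beta> n" by simp
  qed (rule that)
  let ?H = "theta_exp (power_fps r) :: complex fps"
  let ?h = "\<lambda>z. exp (of_real \<gamma> * z + of_real \<delta> * z / (1 - z))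
             * prodinf (\<lambda>n. 1 / (1 - of_real (\<alpha> n) * z))
             * prodinf (\<lambda>n. 1 + of_real (\<beta> n) * z / (1 - z))"
  have "?h has_fps_expansion ?H"
  proof (rule has_fps_expansionI)
    show "eventually (\<lambda>z. (\<lambda>n. fps_nth ?H n * z ^ n) sums ?h z) (nhds 0)"
      using gen
    proof eventually_elim
      case (elim z)
      then have "(\<lambda>n. of_real (newton (power_fps r) (Suc n)) * z ^ Suc n) sums (?h z - 1)"
        by (simp only: sums_iff) (simp add: algebra_simps)
      then have "(\<lambda>n. of_real (newton (power_fps r) n) * z ^ n) sums ?h z"
        by (subst (asm) sums_Suc_iff) simp
      then show ?case by (simp add: newton_power_fps_of_real)
    qed
  qed
  moreover have "?h has_fps_expansion ?E * P * Q"
    by (intro has_fps_expansion_mult has_fps_expansion_gamma_delta P Q)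
  ultimately have H: "?H = ?E * P * Q" by (rule fps_expansion_unique_complex)
  define s where "s N = (\<lambda>k. ((if k = 1 then \<gamma> else 0) + \<delta> * real k)
      + (\<Sum>n<N. \<alpha> n ^ k) + (\<Sum>n<N. 1 - (1 - \<beta> n) ^ k))" for N
  have "theta_exp (power_fps (s N)) = ?E * (\<Prod>n<N. ?A n) * (\<Prod>n<N. ?B n)" for N
    unfolding s_def by (simp only: theta_exp_power_fps_add theta_exp_power_fps_sum)
  then have "newton (power_fps (s N)) n = fps_nth (?E * (\<Prod>n<N. ?A n) * (\<Prod>n<N. ?B n)) n" for n N
    unfolding theta_exp_nth[symmetric] by (simp only:)
  moreover have "(\<lambda>N. fps_nth (?E * (\<Prod>n<N. ?A n) * (\<Prod>n<N. ?B n)) n) \<longlonglongrightarrow> fps_nth (?E * P * Q) n" for n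
    unfolding fps_mult_nth[of "_ * _"] fps_mult_nth[of ?E] by (intro tendsto_intros P Q)
  ultimately have "(\<lambda>N. newton (power_fps (s N) :: complex fps) n) \<longlonglongrightarrow> newton (power_fps r) n" for n
    unfolding theta_exp_nth[symmetric] H by (simp only:)
  then have "(\<lambda>N. fps_nth (power_fps (s N) :: complex fps) k) \<longlonglongrightarrow> fps_nth (power_fps r) k"
    using k by (rule newton_tendsto_imp)
  then have "(\<lambda>N. complex_of_real (s N k)) \<longlonglongrightarrow> of_real (r k)"
    using k by (simp add: power_fps_nth)
  then show ?thesis unfolding s_def by (simp only: tendsto_of_real_iff)
qed

section \<open>Reverse plane partitions as chains of shapes\<close>

lemma initial_segment_eq:
  fixes A :: "nat set"
  assumes "finite A" "\<And>x y. x \<in> A \<Longrightarrow> y \<le> x \<Longrightarrow> y \<in> A"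
  shows "A = {..<card A}"
proof -
  have "\<exists>n. A = {..<n}"
  proof (cases "A = {}")
    case False
    have "Max A \<in> A" using assms(1) False by (rule Max_in)
    then have "A = {..<Suc (Max A)}"
      using assms(2)[of "Max A"] Max_ge[OF assms(1)] by (intro equalityI subsetI) (simp_all add: less_Suc_eq_le)
    then show ?thesis ..
  qed (auto intro: exI[of _ 0])
  then show ?thesis by auto
qed

lemma young_of_columns:
  assumes fin: "\<And>j. finite (A j)" and down: "\<And>i i' j. i \<in> A j \<Longrightarrow> i' \<le> i \<Longrightarrow> i' \<in> A j"
    and anti: "\<And>j j'. j \<le> j' \<Longrightarrow> A j' \<subseteq> A j" and cols: "finite {j. A j \<noteq> {}}"
  obtains \<nu> where "\<And>i j. i \<in> A j \<longleftrightarrow> i < parts \<nu> j"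
proof -
  have P: "is_partition (\<lambda>j. card (A j))"
    unfolding is_partition_def
    using fin anti cols by (auto intro!: antimonoI card_mono)
  have "i \<in> A j \<longleftrightarrow> i < parts (Young (\<lambda>j. card (A j))) j" for i j
  proof -
    have "A j = {..<card (A j)}" by (rule initial_segment_eq[OF fin down])
    then have "i \<in> A j \<longleftrightarrow> i \<in> {..<card (A j)}" by simp
    then show ?thesis by (simp add: parts_Young[OF P])
  qed
  then show ?thesis using that by blast
qed

text \<open>The conjugate partition: the passage from the row lengths in the theorem to the column
  lengths used by the operators.\<close>

lemma conjugate_exists:
  assumes l: "is_partition l"
  obtains \<kappa> where "\<And>i j. j < l i \<longleftrightarrow> i < parts \<kappa> j"
proof -
  have anti: "i' \<le> i \<Longrightarrow> l i \<le> l i'" for i i'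
    using l by (simp add: is_partition_def antimono_def)
  show ?thesis
  proof (rule young_of_columns[of "\<lambda>j. {i. j < l i}"])
    show "finite {i. j < l i}" for j
      by (rule finite_subset[of _ "{i. l i \<noteq> 0}"]) (use l in \<open>auto simp: is_partition_def\<close>)
    show "finite {j. {i. j < l i} \<noteq> {}}"
    proof (rule finite_subset)
      show "{j. {i. j < l i} \<noteq> {}} \<subseteq> {..<l 0}"
      proof
        fix j assume "j \<in> {j. {i. j < l i} \<noteq> {}}"
        then obtain i where "j < l i" by blast
        then show "j \<in> {..<l 0}" using anti[of 0 i] by simp
      qed
    qed simp
    show "i' \<in> {i. j < l i}" if "i \<in> {i. j < l i}" "i' \<le> i" for i i' j
      using that anti[of i' i] by simp
    show "{i. j' < l i} \<subseteq> {i. j < l i}" if "j \<le> j'" for j j'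
      using that by auto
    show thesis if "\<And>i j. (i \<in> {i. j < l i}) = (i < parts \<nu> j)" for \<nu>
      using that by (intro \<open>\<And>\<kappa>. (\<And>i j. (j < l i) = (i < parts \<kappa> j)) \<Longrightarrow> thesis\<close>) simp
  qed
qed

section \<open>Fillings with bounded entries\<close>

definition col_diagram :: "young \<Rightarrow> young \<Rightarrow> (nat \<times> nat) set" where
  "col_diagram \<mu> \<kappa> = {(i, j). parts \<mu> j \<le> i \<and> i < parts \<kappa> j}"

lemma finite_col_diagram: "finite (col_diagram \<mu> \<kappa>)"
proof (rule finite_subset)
  show "col_diagram \<mu> \<kappa> \<subseteq> {..<parts \<kappa> 0} \<times> {j. parts \<kappa> j \<noteq> 0}"
    using parts_antimono[of 0 _ \<kappa>] by (auto simp: col_diagram_def intro: order.strict_trans2)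
qed (simp only: finite_cartesian_product finite_lessThan finite_parts)

text \<open>Entries start at 1 but exponents at position 0, so \<open>w k\<close> prescribes the
  number of columns containing k + 1.\<close>

definition fillings :: "nat \<Rightarrow> (nat \<Rightarrow> nat) \<Rightarrow> young \<Rightarrow> young \<Rightarrow> (nat \<times> nat \<Rightarrow> nat) set" where
  "fillings N w \<mu> \<kappa> = {T \<in> col_diagram \<mu> \<kappa> \<rightarrow>\<^sub>E {0<..N}.
     (\<forall>i j j'. (i, j) \<in> col_diagram \<mu> \<kappa> \<longrightarrow> (i, j') \<in> col_diagram \<mu> \<kappa> \<longrightarrow> j \<le> j'
        \<longrightarrow> T (i, j) \<le> T (i, j')) \<and>
     (\<forall>i i' j. (i, j) \<in> col_diagram \<mu> \<kappa> \<longrightarrow> (i', j) \<in> col_diagram \<mu> \<kappa> \<longrightarrow> i \<le> i'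
        \<longrightarrow> T (i, j) \<le> T (i', j)) \<and>
     (\<forall>k<N. card {j. \<exists>i. (i, j) \<in> col_diagram \<mu> \<kappa> \<and> T (i, j) = Suc k} = w k)}"

lemma finite_fillings: "finite (fillings N w \<mu> \<kappa>)"
  unfolding fillings_def
  by (rule finite_subset[of _ "col_diagram \<mu> \<kappa> \<rightarrow>\<^sub>E {0<..N}"]) (auto intro!: finite_PiE finite_col_diagram)

definition add_layer :: "nat \<Rightarrow> young \<Rightarrow> young \<Rightarrow> young \<Rightarrow> (nat \<times> nat \<Rightarrow> nat) \<Rightarrow> nat \<times> nat \<Rightarrow> nat" where
  "add_layer N \<mu> \<kappa> \<nu> T = (\<lambda>p\<in>col_diagram \<mu> \<kappa>. if p \<in> col_diagram \<mu> \<nu> then T p else Suc N)"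

text \<open>The boxes with entry at most N, together with \<mu>, form a shape \<nu>. The boxes of
  \<kappa>/\<nu> all carry N + 1, so this entry occupies exactly the columns that grow from \<nu> to
  \<kappa>.\<close>

lemma fillings_Suc_bij:
  assumes le: "\<mu> \<le> \<kappa>"
  shows "bij_betw (\<lambda>(\<nu>, T). add_layer N \<mu> \<kappa> \<nu> T)
    (SIGMA \<nu>:{\<nu>. \<mu> \<le> \<nu> \<and> \<nu> \<le> \<kappa> \<and> card (grown \<nu> \<kappa>) = w N}. fillings N w \<mu> \<nu>)
    (fillings (Suc N) w \<mu> \<kappa>)"
    (is "bij_betw ?f ?I ?F")
proof -
  let ?D = "col_diagram \<mu> \<kappa>"
  have sub: "col_diagram \<mu> \<nu> \<subseteq> ?D" if "\<nu> \<le> \<kappa>" for \<nu>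
    using that by (auto simp: col_diagram_def young_le_iff intro: order.strict_trans2)
  have in_iff: "(i, j) \<in> col_diagram \<mu> \<nu> \<longleftrightarrow> i < parts \<nu> j" if "(i, j) \<in> ?D" for i j \<nu>
    using that by (auto simp: col_diagram_def)
  have val: "0 < T p" "T p \<le> N" if "T \<in> fillings N w \<mu> \<nu>" "p \<in> col_diagram \<mu> \<nu>" for T \<nu> p
    using that by (auto simp: fillings_def PiE_iff)
  have layer_eq: "add_layer N \<mu> \<kappa> \<nu> T (i, j) = (if i < parts \<nu> j then T (i, j) else Suc N)"
    if "(i, j) \<in> ?D" for \<nu> T i j
    using that by (simp add: add_layer_def in_iff)
  have le_N: "add_layer N \<mu> \<kappa> \<nu> T (i, j) \<le> N \<longleftrightarrow> i < parts \<nu> j"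
    if "(i, j) \<in> ?D" "T \<in> fillings N w \<mu> \<nu>" for \<nu> T i j
    using that val(2)[OF that(2), of "(i, j)"] by (simp add: layer_eq in_iff)
  have into: "add_layer N \<mu> \<kappa> \<nu> T \<in> ?F"
    if \<nu>: "\<mu> \<le> \<nu>" "\<nu> \<le> \<kappa>" "card (grown \<nu> \<kappa>) = w N" and T: "T \<in> fillings N w \<mu> \<nu>" for \<nu> T
  proof -
    let ?T = "add_layer N \<mu> \<kappa> \<nu> T"
    have pos: "?T p \<in> {0<..Suc N}" if "p \<in> ?D" for p
      using that val[OF T, of p] by (auto simp: add_layer_def)
    have row: "?T (i, j) \<le> ?T (i, j')" if "(i, j) \<in> ?D" "(i, j') \<in> ?D" "j \<le> j'" for i j j'
    proof (cases "i < parts \<nu> j'")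
      case True
      then have "i < parts \<nu> j" using parts_antimono[OF that(3), of \<nu>] by simp
      moreover have "T (i, j) \<le> T (i, j')"
        using T that in_iff[OF that(1), of \<nu>] in_iff[OF that(2), of \<nu>] True calculation
        by (simp add: fillings_def)
      ultimately show ?thesis using True that by (simp add: layer_eq)
    qed (use pos[OF that(1)] that in \<open>simp add: layer_eq[OF that(2)]\<close>)
    have col: "?T (i, j) \<le> ?T (i', j)" if "(i, j) \<in> ?D" "(i', j) \<in> ?D" "i \<le> i'" for i i' j
    proof (cases "i' < parts \<nu> j")
      case True
      then have "i < parts \<nu> j" using that by simp
      moreover have "T (i, j) \<le> T (i', j)"
        using T that in_iff[OF that(1), of \<nu>] in_iff[OF that(2), of \<nu>] True calculation
        by (simp add: fillings_def)
      ultimately show ?thesis using True that by (simp add: layer_eq)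
    qed (use pos[OF that(1)] that in \<open>simp add: layer_eq[OF that(2)]\<close>)
    have count: "card {j. \<exists>i. (i, j) \<in> ?D \<and> ?T (i, j) = Suc k} = w k" if "k < Suc N" for k
    proof (cases "k = N")
      case True
      have "{j. \<exists>i. (i, j) \<in> ?D \<and> ?T (i, j) = Suc N} = grown \<nu> \<kappa>"
      proof (intro equalityI subsetI)
        fix j assume "j \<in> {j. \<exists>i. (i, j) \<in> ?D \<and> ?T (i, j) = Suc N}"
        then obtain i where i: "(i, j) \<in> ?D" "?T (i, j) = Suc N" by blast
        then have "\<not> i < parts \<nu> j" using le_N[OF i(1) T] by simp
        then show "j \<in> grown \<nu> \<kappa>" using i(1) by (simp add: grown_def col_diagram_def)
      next
        fix j assume j: "j \<in> grown \<nu> \<kappa>"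
        then have D: "(parts \<nu> j, j) \<in> ?D"
          using \<nu>(1) by (simp add: grown_def col_diagram_def young_le_iff)
        then show "j \<in> {j. \<exists>i. (i, j) \<in> ?D \<and> ?T (i, j) = Suc N}"
          using layer_eq[OF D] by auto
      qed
      then show ?thesis using True \<nu>(3) by simp
    next
      case False
      have "(i, j) \<in> ?D \<and> ?T (i, j) = Suc k \<longleftrightarrow> (i, j) \<in> col_diagram \<mu> \<nu> \<and> T (i, j) = Suc k" for i j
        using False sub[OF \<nu>(2)] layer_eq[of i j \<nu> T] in_iff[of i j \<nu>] by auto
      then show ?thesis using T that False by (simp add: fillings_def)
    qed
    have mem: "?T \<in> ?D \<rightarrow>\<^sub>E {0<..Suc N}"
      using pos by (auto simp: PiE_iff add_layer_def)
    show ?thesis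
      unfolding fillings_def
      by (intro CollectI conjI allI impI) (assumption | rule mem row col count)+
  qed
  have inj: "\<nu>1 = \<nu>2 \<and> T1 = T2"
    if "\<mu> \<le> \<nu>1" "\<nu>1 \<le> \<kappa>" "T1 \<in> fillings N w \<mu> \<nu>1" "\<mu> \<le> \<nu>2" "\<nu>2 \<le> \<kappa>" "T2 \<in> fillings N w \<mu> \<nu>2"
      and eq: "add_layer N \<mu> \<kappa> \<nu>1 T1 = add_layer N \<mu> \<kappa> \<nu>2 T2" for \<nu>1 \<nu>2 T1 T2
  proof -
    have iff: "i < parts \<nu>1 j \<longleftrightarrow> i < parts \<nu>2 j" if "(i, j) \<in> ?D" for i j
      using le_N[OF that \<open>T1 \<in> _\<close>] le_N[OF that \<open>T2 \<in> _\<close>] eq by simp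
    have "i < parts \<nu>1 j \<longleftrightarrow> i < parts \<nu>2 j" for i j
    proof (cases "(i, j) \<in> ?D")
      case False
      have b: "parts \<mu> j \<le> parts \<nu>1 j" "parts \<nu>1 j \<le> parts \<kappa> j" "parts \<mu> j \<le> parts \<nu>2 j" "parts \<nu>2 j \<le> parts \<kappa> j"
        using that(1,2,4,5) by (auto simp: young_le_iff)
      show ?thesis using False b unfolding col_diagram_def by force
    qed (rule iff)
    then have "parts \<nu>1 j = parts \<nu>2 j" for j
      by (metis less_irrefl linorder_neqE_nat)
    then have \<nu>: "\<nu>1 = \<nu>2" by (rule young_eqI)
    have "T1 p = T2 p" for p
    proof (cases "p \<in> col_diagram \<mu> \<nu>1")
      case True
      then show ?thesis
        using fun_cong[OF eq, of p] sub[OF that(2)] \<nu> by (simp add: add_layer_def subset_eq)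
    next
      case False
      then show ?thesis using that(3,6) \<nu> by (cases p) (simp add: fillings_def PiE_iff extensional_def)
    qed
    then show ?thesis using \<nu> by auto
  qed
  have onto: "\<exists>\<nu> T'. \<mu> \<le> \<nu> \<and> \<nu> \<le> \<kappa> \<and> card (grown \<nu> \<kappa>) = w N \<and> T' \<in> fillings N w \<mu> \<nu> \<and>
      T = add_layer N \<mu> \<kappa> \<nu> T'" if T: "T \<in> ?F" for T
  proof -
    have row: "T (i, j) \<le> T (i, j')" if "(i, j) \<in> ?D" "(i, j') \<in> ?D" "j \<le> j'" for i j j'
      using T that by (simp add: fillings_def)
    have col: "T (i, j) \<le> T (i', j)" if "(i, j) \<in> ?D" "(i', j) \<in> ?D" "i \<le> i'" for i i' j
      using T that by (simp add: fillings_def)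
    have count: "card {j. \<exists>i. (i, j) \<in> ?D \<and> T (i, j) = Suc k} = w k" if "k < Suc N" for k
      using T that by (simp add: fillings_def)
    have T_val: "0 < T p" "T p \<le> Suc N" if "p \<in> ?D" for p
      using T that by (auto simp: fillings_def PiE_iff)
    \<comment> \<open>The rows of column j of the future \<nu>. Monotonicity down columns makes each
      set an initial segment; monotonicity along rows makes the sets shrink to the right.\<close>
    define A where "A j = {i. i < parts \<mu> j \<or> (i, j) \<in> ?D \<and> T (i, j) \<le> N}" for j
    have A_less: "A j \<subseteq> {..<parts \<kappa> j}" for j
      using le by (auto simp: A_def col_diagram_def young_le_iff intro: order.strict_trans2)
    obtain \<nu> where A: "\<And>i j. i \<in> A j \<longleftrightarrow> i < parts \<nu> j"
    proof (rule young_of_columns[of A])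
      show "finite (A j)" for j using A_less finite_subset by blast
      show "i' \<in> A j" if "i \<in> A j" "i' \<le> i" for i i' j
      proof (cases "i' < parts \<mu> j")
        case False
        then have D: "(i, j) \<in> ?D" "T (i, j) \<le> N" using that by (auto simp: A_def)
        then have D': "(i', j) \<in> ?D" using False that by (simp add: col_diagram_def)
        show ?thesis using col[OF D' D(1) that(2)] D(2) D' by (simp add: A_def)
      qed (simp add: A_def)
      show "A j' \<subseteq> A j" if "j \<le> j'" for j j'
      proof
        fix i assume i: "i \<in> A j'"
        show "i \<in> A j"
        proof (cases "i < parts \<mu> j")
          case False
          then have D: "(i, j') \<in> ?D" "T (i, j') \<le> N"
            using i parts_antimono[OF that, of \<mu>] by (auto simp: A_def)
          then have D': "(i, j) \<in> ?D"
            using False parts_antimono[OF that, of \<kappa>] by (simp add: col_diagram_def)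
          show ?thesis using row[OF D' D(1) that] D(2) D' by (simp add: A_def)
        qed (simp add: A_def)
      qed
      show "finite {j. A j \<noteq> {}}"
        by (rule finite_subset[OF _ finite_parts[of \<kappa>]]) (use A_less in force)
    qed (rule that)
    have \<mu>\<nu>: "\<mu> \<le> \<nu>"
      unfolding young_le_iff
    proof
      fix j show "parts \<mu> j \<le> parts \<nu> j"
      proof (rule ccontr)
        assume "\<not> ?thesis"
        then have "parts \<nu> j \<in> A j" by (simp add: A_def)
        then show False using A by simp
      qed
    qed
    have \<nu>\<kappa>: "\<nu> \<le> \<kappa>"
      unfolding young_le_iff
    proof
      fix j show "parts \<nu> j \<le> parts \<kappa> j"
      proof (rule ccontr)
        assume "\<not> ?thesis"
        then have "parts \<kappa> j \<in> A j" by (simp add: A)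
        then show False using A_less by blast
      qed
    qed
    have T_le: "T (i, j) \<le> N \<longleftrightarrow> i < parts \<nu> j" if "(i, j) \<in> ?D" for i j
      using that A[of i j, symmetric] by (auto simp: A_def col_diagram_def)
    define T' where "T' = restrict T (col_diagram \<mu> \<nu>)"
    have T'_eq: "T' p = T p" if "p \<in> col_diagram \<mu> \<nu>" for p
      using that by (simp add: T'_def)
    have T_N: "T p \<le> N" if "p \<in> col_diagram \<mu> \<nu>" for p
      using that sub[OF \<nu>\<kappa>] T_le by (cases p) (auto simp: col_diagram_def)
    have TN: "T (i, j) = Suc N" if "(i, j) \<in> ?D" "\<not> i < parts \<nu> j" for i j
      using T_le[OF that(1)] T_val(2)[OF that(1)] that(2) by simp
    have "T = add_layer N \<mu> \<kappa> \<nu> T'"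
    proof
      fix p :: "nat \<times> nat"
      obtain i j where p: "p = (i, j)" by (cases p)
      show "T p = add_layer N \<mu> \<kappa> \<nu> T' p"
      proof (cases "p \<in> ?D")
        case True
        then show ?thesis
          using TN[of i j] T'_eq[of p] in_iff[of i j \<nu>] unfolding p by (auto simp: layer_eq)
      next
        case False
        then show ?thesis using T by (simp add: fillings_def PiE_iff extensional_def add_layer_def p)
      qed
    qed
    moreover have "{j. \<exists>i. (i, j) \<in> ?D \<and> T (i, j) = Suc N} = grown \<nu> \<kappa>"
    proof (intro equalityI subsetI)
      fix j assume "j \<in> {j. \<exists>i. (i, j) \<in> ?D \<and> T (i, j) = Suc N}"
      then obtain i where i: "(i, j) \<in> ?D" "T (i, j) = Suc N" by blast
      then have "\<not> i < parts \<nu> j" using T_le[OF i(1)] by simp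
      then show "j \<in> grown \<nu> \<kappa>" using i(1) by (simp add: grown_def col_diagram_def)
    next
      fix j assume j: "j \<in> grown \<nu> \<kappa>"
      then have D: "(parts \<nu> j, j) \<in> ?D"
        using \<mu>\<nu> by (simp add: grown_def col_diagram_def young_le_iff)
      then show "j \<in> {j. \<exists>i. (i, j) \<in> ?D \<and> T (i, j) = Suc N}"
        using TN[OF D] by auto
    qed
    then have "card (grown \<nu> \<kappa>) = w N" using count[of N] by simp
    moreover have "T' \<in> fillings N w \<mu> \<nu>"
    proof -
      have mem': "T' \<in> col_diagram \<mu> \<nu> \<rightarrow>\<^sub>E {0<..N}"
        using T_N T_val(1) sub[OF \<nu>\<kappa>] by (auto simp: T'_def)
      have row': "T' (i, j) \<le> T' (i, j')"
        if "(i, j) \<in> col_diagram \<mu> \<nu>" "(i, j') \<in> col_diagram \<mu> \<nu>" "j \<le> j'" for i j j'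
        using that row[of i j j'] sub[OF \<nu>\<kappa>] by (auto simp: T'_eq)
      have col': "T' (i, j) \<le> T' (i', j)"
        if "(i, j) \<in> col_diagram \<mu> \<nu>" "(i', j) \<in> col_diagram \<mu> \<nu>" "i \<le> i'" for i i' j
        using that col[of i j i'] sub[OF \<nu>\<kappa>] by (auto simp: T'_eq)
      have count': "card {j. \<exists>i. (i, j) \<in> col_diagram \<mu> \<nu> \<and> T' (i, j) = Suc k} = w k" if "k < N" for k
      proof -
        have "(i, j) \<in> col_diagram \<mu> \<nu> \<and> T' (i, j) = Suc k \<longleftrightarrow> (i, j) \<in> ?D \<and> T (i, j) = Suc k" for i j
          using that sub[OF \<nu>\<kappa>] TN[of i j] T'_eq[of "(i, j)"] in_iff[of i j \<nu>] by auto
        then show ?thesis using count[of k] that by simp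
      qed
      show ?thesis
        unfolding fillings_def
        by (intro CollectI conjI allI impI) (assumption | rule mem' row' col' count')+
    qed
    ultimately show ?thesis using \<mu>\<nu> \<nu>\<kappa> by blast
  qed
  show ?thesis
  proof (rule bij_betw_imageI)
    show "inj_on ?f ?I"
      by (rule inj_onI) (use inj in auto)
    show "?f ` ?I = ?F"
    proof (intro equalityI subsetI)
      fix T assume "T \<in> ?f ` ?I"
      then show "T \<in> ?F" using into by auto
    next
      fix T assume "T \<in> ?F"
      from onto[OF this] obtain \<nu> T' where "\<mu> \<le> \<nu>" "\<nu> \<le> \<kappa>" "card (grown \<nu> \<kappa>) = w N"
        "T' \<in> fillings N w \<mu> \<nu>" "T = add_layer N \<mu> \<kappa> \<nu> T'" by blast
      then show "T \<in> ?f ` ?I" by (intro image_eqI[of _ _ "(\<nu>, T')"]) auto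
    qed
  qed
qed

primrec layer_prod :: "nat \<Rightarrow> (nat \<Rightarrow> nat) \<Rightarrow> young incidence" where
  "layer_prod 0 w = 1"
| "layer_prod (Suc N) w = layer_prod N w * layer (w N)"

lemma card_fillings: "\<mu> \<le> \<kappa> \<Longrightarrow> real (card (fillings N w \<mu> \<kappa>)) = entry (layer_prod N w) \<mu> \<kappa>"
proof (induction N arbitrary: \<kappa>)
  case 0
  show ?case
  proof (cases "\<mu> = \<kappa>")
    case True
    then have "col_diagram \<mu> \<kappa> = {}" by (auto simp: col_diagram_def)
    then have "fillings 0 w \<mu> \<kappa> = {\<lambda>_. undefined}" by (auto simp: fillings_def)
    then show ?thesis using True by (simp add: entry_one)
  next
    case False
    have "\<exists>j. parts \<mu> j < parts \<kappa> j"
    proof (rule ccontr)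
      assume "\<not> ?thesis"
      then have "parts \<mu> j = parts \<kappa> j" for j
        using 0 by (simp add: young_le_iff not_less le_antisym)
      then show False using False young_eqI by blast
    qed
    then obtain j where "parts \<mu> j < parts \<kappa> j" ..
    then have "(parts \<mu> j, j) \<in> col_diagram \<mu> \<kappa>" by (simp add: col_diagram_def)
    then have "fillings 0 w \<mu> \<kappa> = {}" by (auto simp: fillings_def PiE_iff)
    then show ?thesis using False by (simp add: entry_one)
  qed
next
  case (Suc N)
  let ?S = "{\<nu>. \<mu> \<le> \<nu> \<and> \<nu> \<le> \<kappa> \<and> card (grown \<nu> \<kappa>) = w N}"
  have fin: "finite ?S" by (rule finite_subset[of _ "{\<mu>..\<kappa>}"]) auto
  have "card (fillings (Suc N) w \<mu> \<kappa>) = card (SIGMA \<nu>:?S. fillings N w \<mu> \<nu>)"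
    by (rule bij_betw_same_card[symmetric]) (rule fillings_Suc_bij[OF Suc.prems])
  also have "\<dots> = (\<Sum>\<nu>\<in>?S. card (fillings N w \<mu> \<nu>))"
    using fin by (simp add: finite_fillings)
  finally have "real (card (fillings (Suc N) w \<mu> \<kappa>)) = (\<Sum>\<nu>\<in>?S. entry (layer_prod N w) \<mu> \<nu>)"
    by (simp add: Suc.IH)
  also have "\<dots> = (\<Sum>\<nu>\<in>{\<mu>..\<kappa>}. entry (layer_prod N w) \<mu> \<nu> * entry (layer (w N)) \<nu> \<kappa>)"
    by (rule sum.mono_neutral_cong_left) (auto simp: entry_layer)
  finally show ?case by (simp add: entry_mult)
qed


text \<open>An entry beyond N would give a nonzero exponent outside the support of w, so bounding
  the entries by N loses nothing.\<close>

lemma dual_groth_eq_layer_prod: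
  assumes l: "is_partition l" and diag: "skew_diagram l m = col_diagram \<mu> \<kappa>"
    and le: "\<mu> \<le> \<kappa>" and N: "Poly_Mapping.keys w \<subseteq> {..<N}"
  shows "dual_groth l m w = entry (layer_prod N (Poly_Mapping.lookup w)) \<mu> \<kappa>"
proof -
  let ?L = "Poly_Mapping.lookup w" and ?D = "col_diagram \<mu> \<kappa>"
  have fin: "finite {j. \<exists>i. (i, j) \<in> ?D \<and> T (i, j) = k}" for T and k :: nat
  proof (rule finite_subset)
    show "{j. \<exists>i. (i, j) \<in> ?D \<and> T (i, j) = k} \<subseteq> snd ` ?D"
      by (auto simp: image_iff Bex_def)
  qed (simp add: finite_col_diagram)
  have w0: "?L k = 0" if "k \<ge> N" for k
  proof (rule ccontr)
    assume "?L k \<noteq> 0"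
    then have "k \<in> Poly_Mapping.keys w" by (simp add: in_keys_iff)
    then have "k \<in> {..<N}" using N by blast
    then show False using that by simp
  qed
  have "{T \<in> rpp l m. \<forall>i. ?L i = col_count l m T (Suc i)} = fillings N ?L \<mu> \<kappa>"
  proof (intro equalityI subsetI)
    fix T assume "T \<in> {T \<in> rpp l m. \<forall>i. ?L i = col_count l m T (Suc i)}"
    then have T: "T \<in> rpp l m" and c: "\<And>i. ?L i = col_count l m T (Suc i)" by auto
    have TD: "T \<in> ?D \<rightarrow>\<^sub>E {0<..}" using T by (simp add: rpp_def diag)
    have "T p \<le> N" if p: "p \<in> ?D" for p
    proof (rule ccontr)
      assume "\<not> T p \<le> N"
      then obtain k where k: "T p = Suc k" "k \<ge> N" by (cases "T p") auto
      obtain i j where ij: "p = (i, j)" by (cases p)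
      have "j \<in> {j. \<exists>i. (i, j) \<in> ?D \<and> T (i, j) = Suc k}" using p k ij by auto
      then have "col_count l m T (Suc k) > 0"
        using fin[of T "Suc k"] unfolding col_count_def diag by (subst card_gt_0_iff) blast
      then show False using c[of k] w0[OF k(2)] by simp
    qed
    then have "T \<in> ?D \<rightarrow>\<^sub>E {0<..N}" using TD by (auto simp: PiE_iff)
    then show "T \<in> fillings N ?L \<mu> \<kappa>"
      using T c unfolding rpp_def fillings_def diag col_count_def by simp
  next
    fix T assume T: "T \<in> fillings N ?L \<mu> \<kappa>"
    then have TD: "T \<in> ?D \<rightarrow>\<^sub>E {0<..N}" by (simp add: fillings_def)
    have "?L k = col_count l m T (Suc k)" for k
    proof (cases "k < N")
      case True
      then show ?thesis using T by (simp add: fillings_def col_count_def diag)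
    next
      case False
      have "T p \<noteq> Suc k" if "p \<in> ?D" for p
        using TD that False by (auto simp: PiE_iff)
      then have E: "{j. \<exists>i. (i, j) \<in> ?D \<and> T (i, j) = Suc k} = {}" by blast
      show ?thesis unfolding col_count_def diag E using w0[of k] False by simp
    qed
    moreover have "T \<in> ?D \<rightarrow>\<^sub>E {0<..}" using TD by (auto simp: PiE_iff)
    then have "T \<in> rpp l m"
      using T unfolding rpp_def fillings_def diag by simp
    ultimately show "T \<in> {T \<in> rpp l m. \<forall>i. ?L i = col_count l m T (Suc i)}" by simp
  qed
  then show ?thesis unfolding dual_groth_def by (simp add: card_fillings[OF le])
qed

section \<open>Newton's identity for dual Grothendieck polynomials\<close>

lemma layer_log_commute_layer_prod:
  "layer_prod N w * fps_nth layer_log k = fps_nth layer_log k * layer_prod N w"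
proof (induction N)
  case (Suc N)
  have "layer_prod N w * layer (w N) * fps_nth layer_log k
      = layer_prod N w * fps_nth layer_log k * layer (w N)"
    by (simp add: mult.assoc layer_log_commute_layer)
  then show ?case by (simp add: Suc mult.assoc)
qed simp

lemma layer_prod_cong: "(\<And>i. i < N \<Longrightarrow> w i = w' i) \<Longrightarrow> layer_prod N w = layer_prod N w'"
  by (induction N) auto

lemma layer_prod_extend:
  assumes "\<And>i. i \<ge> N \<Longrightarrow> w i = 0"
  shows "layer_prod (N + d) w = layer_prod N w"
  using assms by (induction d) auto

lemma layer_newton: "real n *\<^sub>R layer n = (\<Sum>k\<in>{1..n}. fps_nth layer_log k * layer (n - k))"
proof -
  have "real n *\<^sub>R layer n = (\<Sum>k=0..n. fps_nth layer_log k * layer (n - k))"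
    using arg_cong[OF fps_theta_layers, of "\<lambda>F. fps_nth F n"] by (simp add: fps_mult_nth)
  also have "\<dots> = (\<Sum>k\<in>{1..n}. fps_nth layer_log k * layer (n - k))"
    by (rule sum.mono_neutral_right) (auto simp: Suc_le_eq intro: gr0I)
  finally show ?thesis .
qed

text \<open>A Leibniz rule: each factor is expanded by Newton's identity, and commutation brings b_k
  to the front, where it accompanies the lowering of one exponent by k.\<close>

lemma layer_prod_newton:
  "real (\<Sum>i<N. w i) *\<^sub>R layer_prod N w
    = (\<Sum>i<N. \<Sum>k\<in>{1..w i}. fps_nth layer_log k * layer_prod N (w(i := w i - k)))"
proof (induction N)
  case (Suc N)
  let ?b = "fps_nth layer_log"
  have "real (\<Sum>i<Suc N. w i) *\<^sub>R layer_prod (Suc N) w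
      = (real (\<Sum>i<N. w i) *\<^sub>R layer_prod N w) * layer (w N) + layer_prod N w * (real (w N) *\<^sub>R layer (w N))"
    by (simp add: scaleR_left_distrib)
  also have "(real (\<Sum>i<N. w i) *\<^sub>R layer_prod N w) * layer (w N)
      = (\<Sum>i<N. \<Sum>k\<in>{1..w i}. ?b k * layer_prod (Suc N) (w(i := w i - k)))"
    unfolding Suc sum_distrib_right by (intro sum.cong refl) (simp add: mult.assoc)
  also have "layer_prod N w * (real (w N) *\<^sub>R layer (w N))
      = (\<Sum>k\<in>{1..w N}. ?b k * layer_prod (Suc N) (w(N := w N - k)))"
    unfolding layer_newton sum_distrib_left
  proof (intro sum.cong refl)
    fix k
    have "layer_prod N (w(N := w N - k)) = layer_prod N w" by (rule layer_prod_cong) simp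
    then show "layer_prod N w * (?b k * layer (w N - k)) = ?b k * layer_prod (Suc N) (w(N := w N - k))"
      by (simp add: mult.assoc[symmetric] layer_log_commute_layer_prod)
  qed
  finally show ?case by (simp only: sum.lessThan_Suc)
qed simp

lemma raises_layer_prod: "raises (\<Sum>i<N. w i) (layer_prod N w)"
proof (induction N)
  case 0
  then show ?case by (simp add: raises_def entry_one)
next
  case (Suc N)
  then show ?case using raises_mult[OF Suc raises_layer] by simp
qed

definition key_bound :: "monom \<Rightarrow> nat" where
  "key_bound w = (LEAST N. Poly_Mapping.keys w \<subseteq> {..<N})"

lemma keys_key_bound: "Poly_Mapping.keys w \<subseteq> {..<key_bound w}"
  unfolding key_bound_def by (rule LeastI_ex) (simp add: finite_nat_iff_bounded[symmetric])

lemma mdeg_eq_sum: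
  assumes "Poly_Mapping.keys w \<subseteq> {..<N}"
  shows "mdeg w = (\<Sum>i<N. Poly_Mapping.lookup w i)"
  unfolding mdeg_def using assms by (intro sum.mono_neutral_left) (auto simp: in_keys_iff)

text \<open>
  Degree \<open>n\<close> of \<open>g\<^bsub>\<lambda>/m\<^esub>\<close>, where \<open>\<kappa>\<close> and \<open>\<mu>\<close> list the column lengths of \<open>\<lambda>\<close> and \<open>m\<close>.
\<close>

definition homog_part :: "nat \<Rightarrow> young \<Rightarrow> young \<Rightarrow> series" where
  "homog_part n \<mu> \<kappa> = (\<lambda>w. if mdeg w = n
     then entry (layer_prod (key_bound w) (Poly_Mapping.lookup w)) \<mu> \<kappa> else 0)"

lemma homog_part_eq:
  assumes "Poly_Mapping.keys w \<subseteq> {..<N}"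
  shows "homog_part n \<mu> \<kappa> w = (if mdeg w = n then entry (layer_prod N (Poly_Mapping.lookup w)) \<mu> \<kappa> else 0)"
proof -
  have le: "key_bound w \<le> N" unfolding key_bound_def using assms by (rule Least_le)
  have "Poly_Mapping.lookup w i = 0" if "i \<ge> key_bound w" for i
    using keys_key_bound[of w] that by (force simp: in_keys_iff)
  then have "layer_prod N (Poly_Mapping.lookup w) = layer_prod (key_bound w) (Poly_Mapping.lookup w)"
    using layer_prod_extend[of "key_bound w" "Poly_Mapping.lookup w" "N - key_bound w"] le by simp
  then show ?thesis by (simp add: homog_part_def)
qed

section \<open>Multiplication by power sums\<close>

definition power_sum :: "nat \<Rightarrow> series" where
  "power_sum k = (\<lambda>w. if \<exists>i. w = Poly_Mapping.single i k then 1 else 0)"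

lemma mdeg_single [simp]: "mdeg (Poly_Mapping.single i k) = k"
  by (cases "k = 0") (simp_all add: mdeg_def)

lemma power_sum_in_Lambda: "power_sum k \<in> Lambda"
proof -
  have single: "Poly_Mapping.map_key \<pi> (Poly_Mapping.single i k) = Poly_Mapping.single (inv \<pi> i) k"
    if "bij \<pi>" for \<pi> :: "nat \<Rightarrow> nat" and i
  proof (rule poly_mapping_eqI)
    fix j
    have "i = \<pi> j \<longleftrightarrow> inv \<pi> i = j"
      using that by (metis bij_inv_eq_iff)
    then show "Poly_Mapping.lookup (Poly_Mapping.map_key \<pi> (Poly_Mapping.single i k)) j
        = Poly_Mapping.lookup (Poly_Mapping.single (inv \<pi> i) k) j"
      by (simp add: lookup_map_key_bij[OF that] lookup_single when_def)
  qed
  have inv: "Poly_Mapping.map_key (inv \<pi>) (Poly_Mapping.map_key \<pi> w) = w"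
    if "bij \<pi>" for \<pi> :: "nat \<Rightarrow> nat" and w :: monom
    by (rule poly_mapping_eqI)
      (simp add: lookup_map_key_bij that bij_imp_bij_inv surj_f_inv_f[OF bij_is_surj])
  have "(\<exists>i. Poly_Mapping.map_key \<pi> w = Poly_Mapping.single i k) \<longleftrightarrow> (\<exists>i. w = Poly_Mapping.single i k)"
    if \<pi>: "bij \<pi>" for \<pi> :: "nat \<Rightarrow> nat" and w :: monom
    using single[OF \<pi>] single[OF bij_imp_bij_inv[OF \<pi>]] inv[OF \<pi>, of w] by metis
  then have "\<forall>\<pi> w. bij \<pi> \<longrightarrow> power_sum k (Poly_Mapping.map_key \<pi> w) = power_sum k w"
    by (simp add: power_sum_def)
  moreover have "\<forall>w. power_sum k w \<noteq> 0 \<longrightarrow> mdeg w \<le> k"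
    by (auto simp: power_sum_def)
  ultimately show ?thesis unfolding Lambda_def by blast
qed

lemma lookup_minus_single:
  "Poly_Mapping.lookup (w - Poly_Mapping.single i k) = (Poly_Mapping.lookup w)(i := Poly_Mapping.lookup w i - (k::nat))"
  by (auto simp: lookup_minus lookup_single when_def)

lemma single_add_minus:
  "k \<le> Poly_Mapping.lookup w i \<Longrightarrow> Poly_Mapping.single i k + (w - Poly_Mapping.single i k) = (w :: monom)"
  by (rule poly_mapping_eqI) (auto simp: lookup_add lookup_minus lookup_single when_def)

text \<open>Splittings of w whose first part is a k-th power of one variable correspond to the
  positions with exponent at least k; k > 0 makes these powers distinct.\<close>

lemma series_mult_power_sum:
  assumes k: "k > 0" and N: "Poly_Mapping.keys w \<subseteq> {..<N}"
  shows "series_mult (power_sum k) f w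
    = (\<Sum>i | i \<in> {..<N} \<and> k \<le> Poly_Mapping.lookup w i. f (w - Poly_Mapping.single i k))"
proof -
  let ?I = "{i. i \<in> {..<N} \<and> k \<le> Poly_Mapping.lookup w i}"
  let ?s = "\<lambda>i. (Poly_Mapping.single i k, w - Poly_Mapping.single i k)"
  have inj: "inj_on ?s ?I"
    using k by (auto simp: inj_on_def dest!: arg_cong[of _ _ Poly_Mapping.keys])
  have "series_mult (power_sum k) f w = (\<Sum>(a, b)\<in>?s ` ?I. power_sum k a * f b)"
    unfolding series_mult_def
  proof (rule sum.mono_neutral_right)
    show "?s ` ?I \<subseteq> {(a, b). a + b = w}" by (auto simp: single_add_minus)
    show "\<forall>p\<in>{(a, b). a + b = w} - ?s ` ?I. (case p of (a, b) \<Rightarrow> power_sum k a * f b) = 0"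
    proof
      fix p assume "p \<in> {(a, b). a + b = w} - ?s ` ?I"
      then obtain a b where p: "p = (a, b)" and ab: "w = a + b" "(a, b) \<notin> ?s ` ?I" by blast
      have "a \<noteq> Poly_Mapping.single i k" for i
      proof
        assume a: "a = Poly_Mapping.single i k"
        then have "k \<le> Poly_Mapping.lookup w i" by (simp add: ab lookup_add)
        moreover from this have "i \<in> Poly_Mapping.keys w" using k by (simp add: in_keys_iff)
        moreover have "b = w - Poly_Mapping.single i k" by (simp add: ab a)
        ultimately show False using ab(2) a N by blast
      qed
      then show "(case p of (a, b) \<Rightarrow> power_sum k a * f b) = 0" by (simp add: power_sum_def p)
    qed
  qed (rule finite_splittings)
  also have "\<dots> = (\<Sum>i\<in>?I. f (w - Poly_Mapping.single i k))"
    by (subst sum.reindex[OF inj]) (auto simp: power_sum_def intro!: sum.cong)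
  finally show ?thesis .
qed

lemma mdeg_minus_single:
  "k \<le> Poly_Mapping.lookup w i \<Longrightarrow> mdeg w = k + mdeg (w - Poly_Mapping.single i k)"
  by (metis mdeg_add mdeg_single single_add_minus)

lemma keys_minus_single: "Poly_Mapping.keys (w - Poly_Mapping.single i k) \<subseteq> Poly_Mapping.keys (w :: monom)"
  by (auto simp: in_keys_iff lookup_minus)

text \<open>Exchanging the sums over positions and over k in \<open>layer_prod_newton\<close>
  leaves, for each k, a sum over positions that is exactly a coefficient of a product with the k-th
  power sum.\<close>

lemma newton_identity_homog_part:
  "real n * homog_part n \<mu> \<kappa> w
    = (\<Sum>k\<in>{1..n}. \<Sum>\<nu>\<in>{\<mu>..\<kappa>}. entry (fps_nth layer_log k) \<mu> \<nu>
        * series_mult (power_sum k) (homog_part (n - k) \<nu> \<kappa>) w)"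
proof -
  define N where "N = key_bound w"
  have N: "Poly_Mapping.keys w \<subseteq> {..<N}" unfolding N_def by (rule keys_key_bound)
  let ?w = "Poly_Mapping.lookup w" and ?b = "\<lambda>k. fps_nth layer_log k"
  have part: "homog_part (n - k) \<nu> \<kappa> (w - Poly_Mapping.single i k)
      = (if mdeg w = n then entry (layer_prod N (?w(i := ?w i - k))) \<nu> \<kappa> else 0)"
    if "k \<le> n" "k \<le> ?w i" for i k \<nu>
    using homog_part_eq[OF order_trans[OF keys_minus_single N], of "n - k" \<nu> \<kappa> i k]
      mdeg_minus_single[OF that(2)] that(1) by (auto simp: lookup_minus_single)
  have sm: "series_mult (power_sum k) (homog_part (n - k) \<nu> \<kappa>) w
      = (\<Sum>i | i \<in> {..<N} \<and> k \<le> ?w i. if mdeg w = n then entry (layer_prod N (?w(i := ?w i - k))) \<nu> \<kappa> else 0)"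
    if "k > 0" "k \<le> n" for k \<nu>
    using that by (subst series_mult_power_sum[OF _ N]) (auto simp: part intro!: sum.cong)
  show ?thesis
  proof (cases "mdeg w = n")
    case False
    then have "(\<Sum>k\<in>{1..n}. \<Sum>\<nu>\<in>{\<mu>..\<kappa>}. entry (?b k) \<mu> \<nu>
        * series_mult (power_sum k) (homog_part (n - k) \<nu> \<kappa>) w) = 0"
      by (intro sum.neutral ballI) (simp add: sm)
    then show ?thesis using False by (simp add: homog_part_eq[OF N])
  next
    case True
    have le_n: "?w i \<le> n" if "i < N" for i
      using True mdeg_eq_sum[OF N] that member_le_sum[of i "{..<N}" ?w] by simp
    have "real n * homog_part n \<mu> \<kappa> w = entry (real (\<Sum>i<N. ?w i) *\<^sub>R layer_prod N ?w) \<mu> \<kappa>"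
      using True mdeg_eq_sum[OF N] by (simp add: homog_part_eq[OF N])
    also have "\<dots> = (\<Sum>i<N. \<Sum>k\<in>{1..?w i}. entry (?b k * layer_prod N (?w(i := ?w i - k))) \<mu> \<kappa>)"
      by (simp only: layer_prod_newton entry_sum)
    also have "\<dots> = (\<Sum>i\<in>{..<N}. \<Sum>k | k \<in> {1..n} \<and> k \<le> ?w i. entry (?b k * layer_prod N (?w(i := ?w i - k))) \<mu> \<kappa>)"
      using le_n by (intro sum.cong refl) (auto intro: order_trans)
    also have "\<dots> = (\<Sum>k\<in>{1..n}. \<Sum>i | i \<in> {..<N} \<and> k \<le> ?w i. entry (?b k * layer_prod N (?w(i := ?w i - k))) \<mu> \<kappa>)"
      by (rule sum.swap_restrict) simp_all
    also have "\<dots> = (\<Sum>k\<in>{1..n}. \<Sum>\<nu>\<in>{\<mu>..\<kappa>}. entry (?b k) \<mu> \<nu>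
        * series_mult (power_sum k) (homog_part (n - k) \<nu> \<kappa>) w)"
    proof (intro sum.cong refl)
      fix k assume "k \<in> {1..n}"
      then show "(\<Sum>i | i \<in> {..<N} \<and> k \<le> ?w i. entry (?b k * layer_prod N (?w(i := ?w i - k))) \<mu> \<kappa>)
          = (\<Sum>\<nu>\<in>{\<mu>..\<kappa>}. entry (?b k) \<mu> \<nu> * series_mult (power_sum k) (homog_part (n - k) \<nu> \<kappa>) w)"
        using True unfolding entry_mult by (subst sum.swap) (simp add: sm sum_distrib_left)
    qed
    finally show ?thesis .
  qed
qed

text \<open>At a monomial of degree n the right side counts the pairs (i, k) with k between 1 and
  the exponent at i; there are n of them.\<close>

lemma newton_identity_complete_h:
  "real n * complete_h n w = (\<Sum>k\<in>{1..n}. series_mult (power_sum k) (complete_h (n - k)) w)"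
proof -
  define N where "N = key_bound w"
  have N: "Poly_Mapping.keys w \<subseteq> {..<N}" unfolding N_def by (rule keys_key_bound)
  let ?w = "Poly_Mapping.lookup w"
  have "series_mult (power_sum k) (complete_h (n - k)) w
      = (\<Sum>i | i \<in> {..<N} \<and> k \<le> ?w i. if mdeg w = n then 1 else 0)" if k: "k \<in> {1..n}" for k
  proof -
    have "complete_h (n - k) (w - Poly_Mapping.single i k) = (if mdeg w = n then 1 else 0)" if "k \<le> ?w i" for i
      using mdeg_minus_single[OF that] k by (auto simp: complete_h_def)
    then show ?thesis
      using k by (subst series_mult_power_sum[OF _ N]) (auto intro!: sum.cong)
  qed
  then have R: "(\<Sum>k\<in>{1..n}. series_mult (power_sum k) (complete_h (n - k)) w)
      = (\<Sum>k\<in>{1..n}. \<Sum>i | i \<in> {..<N} \<and> k \<le> ?w i. if mdeg w = n then 1 else 0)"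
    by (intro sum.cong refl)
  show ?thesis
  proof (cases "mdeg w = n")
    case True
    have le_n: "?w i \<le> n" if "i < N" for i
      using True mdeg_eq_sum[OF N] that member_le_sum[of i "{..<N}" ?w] by simp
    have "(\<Sum>k\<in>{1..n}. \<Sum>i | i \<in> {..<N} \<and> k \<le> ?w i. 1) = (\<Sum>i<N. \<Sum>k | k \<in> {1..n} \<and> k \<le> ?w i. 1 :: real)"
      by (rule sum.swap_restrict) simp_all
    also have "\<dots> = (\<Sum>i<N. \<Sum>k\<in>{1..?w i}. 1 :: real)"
      using le_n by (intro sum.cong refl) (auto intro: order_trans)
    also have "\<dots> = real n"
      using True mdeg_eq_sum[OF N] by (simp flip: of_nat_sum)
    finally show ?thesis unfolding R using True by (simp add: complete_h_def)
  next
    case False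
    then show ?thesis unfolding R by (simp add: complete_h_def)
  qed
qed

section \<open>Specializing\<close>

context
  fixes \<rho> :: "series \<Rightarrow> real"
  assumes spec: "specialization \<rho>"
begin

lemma spec_add: "f \<in> Lambda \<Longrightarrow> g \<in> Lambda \<Longrightarrow> \<rho> (series_add f g) = \<rho> f + \<rho> g"
  and spec_scale: "f \<in> Lambda \<Longrightarrow> \<rho> (series_scale c f) = c * \<rho> f"
  and spec_mult: "f \<in> Lambda \<Longrightarrow> g \<in> Lambda \<Longrightarrow> \<rho> (series_mult f g) = \<rho> f * \<rho> g"
  and spec_one: "\<rho> series_one = 1"
  using spec by (auto simp: specialization_def)

lemma spec_sum:
  assumes "finite I" "\<And>i. i \<in> I \<Longrightarrow> f i \<in> Lambda"
  shows "(\<lambda>w. \<Sum>i\<in>I. c i * f i w) \<in> Lambda \<and> \<rho> (\<lambda>w. \<Sum>i\<in>I. c i * f i w) = (\<Sum>i\<in>I. c i * \<rho> (f i))"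
  using assms
proof (induction I rule: finite_induct)
  case empty
  have "(\<lambda>w. 0) = series_scale 0 series_one" by (simp add: series_scale_def)
  then show ?case using spec_scale[OF one_in_Lambda, of 0] scale_in_Lambda[OF one_in_Lambda, of 0] by simp
next
  case (insert j I)
  have eq: "(\<lambda>w. \<Sum>i\<in>insert j I. c i * f i w) = series_add (series_scale (c j) (f j)) (\<lambda>w. \<Sum>i\<in>I. c i * f i w)"
    using insert by (simp add: series_add_def series_scale_def)
  have j: "f j \<in> Lambda" and I: "(\<lambda>w. \<Sum>i\<in>I. c i * f i w) \<in> Lambda"
    "\<rho> (\<lambda>w. \<Sum>i\<in>I. c i * f i w) = (\<Sum>i\<in>I. c i * \<rho> (f i))"
    using insert by auto
  show ?case
    unfolding eq using add_in_Lambda[OF scale_in_Lambda[OF j] I(1)]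
    by (simp add: spec_add scale_in_Lambda j I spec_scale insert.hyps)
qed

lemma mdeg_0_iff: "mdeg w = 0 \<longleftrightarrow> w = 0"
  by (auto simp: mdeg_def in_keys_iff intro!: poly_mapping_eqI)

lemma complete_h_0: "complete_h 0 = series_one"
  by (simp add: complete_h_def series_one_def mdeg_0_iff fun_eq_iff)

text \<open>Puts the coefficients of the given generating function into the form to which the
  inversion of Newton's recursion applies.\<close>

lemma spec_complete_h: "\<rho> (complete_h n) = newton (power_fps (\<lambda>k. \<rho> (power_sum k))) n"
proof (induction n rule: less_induct)
  case (less n)
  show ?case
  proof (cases n)
    case 0
    then show ?thesis by (simp add: complete_h_0 spec_one)
  next
    case (Suc m)
    have "complete_h n = (\<lambda>w. \<Sum>k\<in>{1..n}. (1 / real n) * series_mult (power_sum k) (complete_h (n - k)) w)"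
    proof
      fix w show "complete_h n w = (\<Sum>k\<in>{1..n}. (1 / real n) * series_mult (power_sum k) (complete_h (n - k)) w)"
        using newton_identity_complete_h[of n w] Suc
        by (simp add: sum_distrib_left[symmetric] sum_divide_distrib[symmetric] field_simps del: of_nat_Suc)
    qed
    then have "\<rho> (complete_h n) = (\<Sum>k\<in>{1..n}. (1 / real n) * \<rho> (series_mult (power_sum k) (complete_h (n - k))))"
      using spec_sum[of "{1..n}" "\<lambda>k. series_mult (power_sum k) (complete_h (n - k))" "\<lambda>_. 1 / real n"]
      by (simp add: mult_in_Lambda power_sum_in_Lambda complete_h_in_Lambda)
    also have "\<dots> = (\<Sum>k\<in>{1..n}. (1 / real n) * (\<rho> (power_sum k) * newton (power_fps (\<lambda>k. \<rho> (power_sum k))) (n - k)))"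
      using Suc by (intro sum.cong refl) (simp add: spec_mult power_sum_in_Lambda complete_h_in_Lambda less)
    also have "\<dots> = (\<Sum>k\<le>m. (1 / real n) * (\<rho> (power_sum (Suc k)) * newton (power_fps (\<lambda>k. \<rho> (power_sum k))) (m - k)))"
      unfolding Suc by (rule sum.reindex_bij_witness[of _ Suc "\<lambda>k. k - 1"]) auto
    finally show ?thesis
      by (simp add: Suc power_fps_nth sum_distrib_left sum_divide_distrib)
  qed
qed

text \<open>Symmetry needs no bijection on fillings: Newton's identity builds each part from power
  sums and parts of lower degree, so membership in Lambda and the value under \<rho> come out of one
  induction.\<close>

lemma spec_homog_part:
  "homog_part n \<mu> \<kappa> \<in> Lambda \<and>
    \<rho> (homog_part n \<mu> \<kappa>) = entry (newton (log_at (\<lambda>k. \<rho> (power_sum k))) n) \<mu> \<kappa>"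
proof (induction n arbitrary: \<mu> rule: less_induct)
  case (less n)
  let ?r = "\<lambda>k. \<rho> (power_sum k)"
  show ?case
  proof (cases n)
    case 0
    have "homog_part 0 \<mu> \<kappa> = series_scale (entry 1 \<mu> \<kappa>) series_one"
    proof
      fix w show "homog_part 0 \<mu> \<kappa> w = series_scale (entry 1 \<mu> \<kappa>) series_one w"
      proof (cases "w = 0")
        case True
        then show ?thesis
          using homog_part_eq[of w 0 0 \<mu> \<kappa>] by (simp add: mdeg_0_iff series_scale_def series_one_def)
      qed (simp add: homog_part_def mdeg_0_iff series_scale_def series_one_def)
    qed
    then show ?thesis
      using 0 by (simp add: spec_scale scale_in_Lambda one_in_Lambda spec_one)
  next
    case (Suc m)
    let ?I = "{1..n} \<times> {\<mu>..\<kappa>}"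
    let ?c = "\<lambda>p. (1 / real n) * entry (fps_nth layer_log (fst p)) \<mu> (snd p)"
    let ?f = "\<lambda>p. series_mult (power_sum (fst p)) (homog_part (n - fst p) (snd p) \<kappa>)"
    have IH: "homog_part (n - fst p) (snd p) \<kappa> \<in> Lambda"
      "\<rho> (homog_part (n - fst p) (snd p) \<kappa>) = entry (newton (log_at ?r) (n - fst p)) (snd p) \<kappa>"
      if "p \<in> ?I" for p
      using less[of "n - fst p" "snd p"] that by (auto simp: mem_Times_iff)
    have f: "?f p \<in> Lambda" if "p \<in> ?I" for p
      using IH(1)[OF that] by (intro mult_in_Lambda power_sum_in_Lambda)
    have eq: "homog_part n \<mu> \<kappa> = (\<lambda>w. \<Sum>p\<in>?I. ?c p * ?f p w)"
    proof
      fix w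
      have "real n * homog_part n \<mu> \<kappa> w = (\<Sum>p\<in>?I. entry (fps_nth layer_log (fst p)) \<mu> (snd p) * ?f p w)"
        unfolding newton_identity_homog_part by (simp add: sum.cartesian_product case_prod_unfold)
      then have "homog_part n \<mu> \<kappa> w = (1 / real n) * (\<Sum>p\<in>?I. entry (fps_nth layer_log (fst p)) \<mu> (snd p) * ?f p w)"
        using Suc by (simp add: field_simps del: of_nat_Suc)
      then show "homog_part n \<mu> \<kappa> w = (\<Sum>p\<in>?I. ?c p * ?f p w)"
        by (simp only: sum_distrib_left mult.assoc)
    qed
    have "\<rho> (homog_part n \<mu> \<kappa>) = (\<Sum>p\<in>?I. ?c p * \<rho> (?f p))"
      and mem: "homog_part n \<mu> \<kappa> \<in> Lambda"
      unfolding eq using spec_sum[of ?I ?f ?c] f by auto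
    note this(1)
    also have "(\<Sum>p\<in>?I. ?c p * \<rho> (?f p)) = (\<Sum>p\<in>?I. ?c p * (?r (fst p) * entry (newton (log_at ?r) (n - fst p)) (snd p) \<kappa>))"
      by (intro sum.cong refl) (simp only: spec_mult power_sum_in_Lambda IH)
    also have "\<dots> = (\<Sum>k\<in>{1..n}. \<Sum>\<nu>\<in>{\<mu>..\<kappa>}. (1 / real n) * entry (fps_nth layer_log k) \<mu> \<nu>
        * (?r k * entry (newton (log_at ?r) (n - k)) \<nu> \<kappa>))"
      by (simp only: sum.cartesian_product case_prod_unfold)
    also have "\<dots> = (\<Sum>k\<in>{1..n}. (1 / real n) * (?r k * entry (fps_nth layer_log k * newton (log_at ?r) (n - k)) \<mu> \<kappa>))"
      by (simp add: entry_mult sum_distrib_left mult_ac)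
    also have "\<dots> = (\<Sum>k\<le>m. (1 / real n) * (?r (Suc k) * entry (fps_nth layer_log (Suc k) * newton (log_at ?r) (m - k)) \<mu> \<kappa>))"
      unfolding Suc by (rule sum.reindex_bij_witness[of _ Suc "\<lambda>k. k - 1"]) auto
    also have "\<dots> = entry (newton (log_at ?r) n) \<mu> \<kappa>"
      by (simp add: Suc entry_sum sum_distrib_left sum_divide_distrib del: of_nat_Suc)
    finally show ?thesis using mem by simp
  qed
qed

lemma g_positive_if_positive_powers:
  assumes pos: "positive_powers (\<lambda>k. \<rho> (power_sum k))"
  shows "g_positive \<rho>"
  unfolding g_positive_def
proof (intro allI impI)
  fix l m assume lm: "is_partition l" "is_partition m" "\<forall>i. m i \<le> l i"
  obtain \<kappa> where \<kappa>: "\<And>i j. j < l i \<longleftrightarrow> i < parts \<kappa> j" using conjugate_exists[OF lm(1)] by blast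
  obtain \<mu> where \<mu>: "\<And>i j. j < m i \<longleftrightarrow> i < parts \<mu> j" using conjugate_exists[OF lm(2)] by blast
  have le: "\<mu> \<le> \<kappa>"
    unfolding young_le_iff
  proof
    fix j
    have "i < parts \<mu> j \<Longrightarrow> i < parts \<kappa> j" for i
      using \<mu>[of j i] \<kappa>[of j i] lm(3) by (meson order.strict_trans2)
    then show "parts \<mu> j \<le> parts \<kappa> j" by (meson not_less less_irrefl)
  qed
  have diag: "skew_diagram l m = col_diagram \<mu> \<kappa>"
    using \<mu> \<kappa> by (auto simp: skew_diagram_def col_diagram_def not_less[symmetric])
  \<comment> \<open>The degree is bounded by the number of boxes of \<kappa>, because a product of
    layers of total degree d adds at least d boxes.\<close>
  have "dual_groth l m w = (\<Sum>n\<in>{..young_size \<kappa>}. 1 * homog_part n \<mu> \<kappa> w)" for w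
  proof -
    let ?N = "key_bound w"
    have g: "dual_groth l m w = entry (layer_prod ?N (Poly_Mapping.lookup w)) \<mu> \<kappa>"
      by (rule dual_groth_eq_layer_prod[OF lm(1) diag le keys_key_bound])
    have "mdeg w \<le> young_size \<kappa>" if "dual_groth l m w \<noteq> 0"
      using raises_layer_prod[where N = ?N and w = "Poly_Mapping.lookup w"] that
      unfolding g raises_def mdeg_eq_sum[OF keys_key_bound[of w], symmetric] by fastforce
    then show ?thesis
      using g by (cases "mdeg w \<le> young_size \<kappa>") (auto simp: homog_part_def)
  qed
  then have "dual_groth l m = (\<lambda>w. \<Sum>n\<in>{..young_size \<kappa>}. 1 * homog_part n \<mu> \<kappa> w)" by blast
  then have "\<rho> (dual_groth l m) = (\<Sum>n\<in>{..young_size \<kappa>}. 1 * \<rho> (homog_part n \<mu> \<kappa>))"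
    using spec_sum[of "{..young_size \<kappa>}" "\<lambda>n. homog_part n \<mu> \<kappa>" "\<lambda>_. 1"] spec_homog_part by simp
  also have "\<dots> = entry (spec_transfer (\<lambda>k. \<rho> (power_sum k))) \<mu> \<kappa>"
    by (simp add: spec_homog_part entry_spec_transfer)
  finally show "0 \<le> \<rho> (dual_groth l m)"
    using pos by (simp add: positive_powers_def)
qed

end

theorem proposition7p5:
  fixes \<rho> :: "series \<Rightarrow> real"
    and \<alpha> \<beta> :: "nat \<Rightarrow> real" and \<gamma> \<delta> :: real
  assumes "specialization \<rho>"
    and "\<And>n. \<alpha> n \<ge> 0" and "\<And>n. \<beta> n \<ge> 0" and "\<gamma> \<ge> 0" and "\<delta> \<ge> 0"
    and "summable (\<lambda>n. \<alpha> n + \<beta> n)"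
    and "\<forall>\<^sub>F z :: complex in nhds 0.
           summable (\<lambda>n. of_real (\<rho> (complete_h (Suc n))) * z ^ Suc n) \<and>
           1 + suminf (\<lambda>n. of_real (\<rho> (complete_h (Suc n))) * z ^ Suc n) =
             exp (of_real \<gamma> * z + of_real \<delta> * z / (1 - z))
             * prodinf (\<lambda>n. 1 / (1 - of_real (\<alpha> n) * z))
             * prodinf (\<lambda>n. 1 + of_real (\<beta> n) * z / (1 - z))"
  shows "g_positive \<rho>"
proof (rule g_positive_if_positive_powers[OF assms(1)], rule positive_powers_limit)
  fix N
  \<comment> \<open>Truncating both infinite products after N factors leaves a finite sum of
    generators of the cone.\<close>
  show "positive_powers (\<lambda>k. ((if k = 1 then \<gamma> else 0) + \<delta> * real k)
      + (\<Sum>n<N. \<alpha> n ^ k) + (\<Sum>n<N. 1 - (1 - \<beta> n) ^ k))"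
    by (intro positive_powers_add positive_powers_sum positive_powers_gamma positive_powers_delta
        positive_powers_alpha positive_powers_beta assms)
next
  fix k :: nat assume "k > 0"
  then show "(\<lambda>N. ((if k = 1 then \<gamma> else 0) + \<delta> * real k)
      + (\<Sum>n<N. \<alpha> n ^ k) + (\<Sum>n<N. 1 - (1 - \<beta> n) ^ k)) \<longlonglongrightarrow> \<rho> (power_sum k)"
    using assms(7) unfolding spec_complete_h[OF assms(1)]
    by (intro power_sums_of_generating_function assms)
qed

end
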